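(* Let $T>0$, $\mu\in\mathbb{R}$, $D=(0,1)$, and $r=2$ or $3$. Let $\mathsf{u}$ be the solution to the canvas problem with load $\mathcal W$ (depending on $\mathsf{N},\mathsf{M}\in\mathbb{N}$, $\Delta t=T/\mathsf{N}$; see context). For $M\in\mathbb{N}$, $\Delta\tau=T/M$, $\tau_m=m\Delta\tau$, $\Delta_m=(\tau_{m-1},\tau_m)$, let $(\mathsf{U}_h^m)_{m=0}^M\subset\mathsf{M}_h^r$ be the IMEX finite element approximations defined by $\mathsf{U}_h^0:=0$ and, for $m=1,\dots,M$, $$(\mathsf{U}_h^m-\mathsf{U}_h^{m-1},\chi)_{0,D}+\Delta\tau\left[(\partial_x^2\mathsf{U}_h^m,\partial_x^2\chi)_{0,D}+\mu(\partial_x^2\mathsf{U}_h^{m-1},\chi)_{0,D}\right]=\int_{\Delta_m}(\partial_x\mathcal{W},\chi)_{0,D}\,d\tau\quad\forall\chi\in\mathsf{M}_h^r .$$ Then there exists a constant $\widehat c>0$, independent of $h$, $\Delta\tau$, $\Delta t$ and $\mathsf{M}$, such that $$\max_{0\le m\le M}\left(\mathbb{E}\left[\|\mathsf{U}_h^m-\mathsf{u}(\tau_m,\cdot)\|_{0,D}^2\right]\right)^{1/2}\le\widehat c\,\left(\epsilon_1^{-1/2}\,\Delta\tau^{\frac18-\epsilon_1}+\epsilon_2^{-1/2}\,h^{\frac r6-\epsilon_2}\right)$$ for all $\epsilon_1\in(0,\frac18]$ and $\epsilon_2\in(0,\frac r6]$.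
   Context: $(\cdot,\cdot)_{0,D}$ and $\|\cdot\|_{0,D}$ are the inner product and norm of $L^2(D)$; $\|\cdot\|_{s,D}$ is the usual norm of the Sobolev space $H^s(D)$. $(\Omega,\mathcal F,P)$ is a complete probability space, $\dot W$ is a space-time white noise on $[0,T]\times D$, and $\int\!\int g\,dW$ denotes the stochastic integral with respect to it. For $k\in\mathbb{N}=\{1,2,\dots\}$: $\lambda_k:=k\pi$, $\varepsilon_k(z):=\sqrt2\sin(\lambda_kz)$, $\varphi_k(z):=\sqrt2\cos(\lambda_kz)$, and $\Psi_t(x,y):=-\sum_{k=1}^\infty\lambda_k e^{-\lambda_k^2(\lambda_k^2-\mu)t}\varepsilon_k(x)\varphi_k(y)$. Canvas problem: for $\mathsf{M},\mathsf{N}\in\mathbb{N}$ (not to be confused with the number $M$ of numerical time-steps), put $\Delta t:=T/\mathsf{N}$, $t_n:=n\Delta t$, $\mathsf{T}_n:=(t_{n-1},t_n)$ for $n=1,\dots,\mathsf N$, and $$R_i^n:=\int_{\mathsf{T}_n}\int_D\varphi_i(x)\,dW(t,x),\qquad \mathcal{W}(t,x):=\frac1{\Delta t}\sum_{i=1}^{\mathsf{M}}R_i^n\varphi_i(x)\ \text{ for }t\in\mathsf{T}_n,\ x\in D,\ n=1,\dots,\mathsf{N}.$$ The $R_i^n$ are independent $\mathcal{N}(0,\Delta t)$ random variables. The canvas solution $\mathsf{u}$ solves $\mathsf{u}_t+\mathsf{u}_{xxxx}+\mu\mathsf{u}_{xx}=\partial_x\mathcal{W}$ in $(0,T]\times D$,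 $\mathsf{u}(t,\cdot)|_{\partial D}=\mathsf{u}_{xx}(t,\cdot)|_{\partial D}=0$ for $t\in(0,T]$, $\mathsf{u}(0,\cdot)=0$, and is given by $\mathsf{u}(t,x)=\int_0^t\int_D\Psi_{t-s}(x,y)\,\mathcal{W}(s,y)\,dy\,ds$. Finite element space: $\mathsf{M}_h^r\subset H^2(D)\cap H_0^1(D)$ is a finite element space consisting of functions that are piecewise polynomials of degree at most $r$ over a partition of $D$ into intervals with maximum length $h$. It has the standard approximation property $\inf_{\chi\in\mathsf{M}_h^r}\|v-\chi\|_{2,D}\le C_r h^{s-2}\|v\|_{s,D}$ for all $v\in H^{s+1}(D)\cap H_0^1(D)$ and $s=3,\dots,r+1$, with $C_r>0$ independent of $h$ and $v$. *)

theory Defs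
  imports "HOL-Probability.Probability" "HOL-Computational_Algebra.Polynomial"
begin

section \<open>Sobolev spaces on the unit interval\<close>

text \<open>Elements of \<open>L\<^sup>2(D)\<close> and \<open>H\<^sup>s(D)\<close> are represented by functions on the real line, of which
  only the values on \<open>D\<close> matter; all notions below are invariant under changes on null sets,
  except the finite element space, which consists of continuous representatives.\<close>

abbreviation D :: "real set" where
  "D \<equiv> {0<..<1}"

definition L2 :: "'a::euclidean_space set \<Rightarrow> ('a \<Rightarrow> real) set" where
  "L2 Q = {f \<in> borel_measurable (lebesgue_on Q). integrable (lebesgue_on Q) (\<lambda>x. (f x)\<^sup>2)}"

definition L2_inner :: "'a::euclidean_space set \<Rightarrow> ('a \<Rightarrow> real) \<Rightarrow> ('a \<Rightarrow> real) \<Rightarrow> real" where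
  "L2_inner Q f g = (\<integral>x. f x * g x \<partial>lebesgue_on Q)"

definition L2_norm :: "'a::euclidean_space set \<Rightarrow> ('a \<Rightarrow> real) \<Rightarrow> real" where
  "L2_norm Q f = sqrt (L2_inner Q f f)"

text \<open>\<open>C\<^sub>c\<^sup>\<infinity>(D)\<close>, each function being extended by zero to the real line.\<close>

definition test_function :: "(real \<Rightarrow> real) \<Rightarrow> bool" where
  "test_function \<eta> \<longleftrightarrow>
     (\<forall>k x. (deriv ^^ k) \<eta> field_differentiable at x) \<and>
     (\<exists>a b. 0 < a \<and> b < 1 \<and> (\<forall>x. x \<notin> {a..b} \<longrightarrow> \<eta> x = 0))"

definition is_weak_deriv :: "nat \<Rightarrow> (real \<Rightarrow> real) \<Rightarrow> (real \<Rightarrow> real) \<Rightarrow> bool" where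
  "is_weak_deriv k f g \<longleftrightarrow> g \<in> L2 D \<and>
     (\<forall>\<eta>. test_function \<eta> \<longrightarrow> L2_inner D f ((deriv ^^ k) \<eta>) = (-1) ^ k * L2_inner D g \<eta>)"

definition sobolev :: "nat \<Rightarrow> (real \<Rightarrow> real) set" where
  "sobolev s = {f \<in> L2 D. \<forall>k\<le>s. \<exists>g. is_weak_deriv k f g}"

text \<open>The weak derivative is only determined up to null sets; it is used below solely inside
  integrals, where the choice of the representative is immaterial.\<close>

definition weak_deriv :: "nat \<Rightarrow> (real \<Rightarrow> real) \<Rightarrow> real \<Rightarrow> real" where
  "weak_deriv k f = (SOME g. is_weak_deriv k f g)"

definition sobolev_norm :: "nat \<Rightarrow> (real \<Rightarrow> real) \<Rightarrow> real" where
  "sobolev_norm s f = sqrt (\<Sum>k\<le>s. (L2_norm D (weak_deriv k f))\<^sup>2)"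

text \<open>\<open>H\<^sub>0\<^sup>1(D)\<close> as the closure of \<open>C\<^sub>c\<^sup>\<infinity>(D)\<close> in \<open>H\<^sup>1(D)\<close>.\<close>

definition sobolev_0_1 :: "(real \<Rightarrow> real) set" where
  "sobolev_0_1 = {f \<in> sobolev 1. \<forall>e>0. \<exists>\<eta>. test_function \<eta> \<and> sobolev_norm 1 (\<lambda>x. f x - \<eta> x) < e}"


section \<open>White noise and the canvas problem\<close>

definition centered_gaussian :: "'w measure \<Rightarrow> real \<Rightarrow> ('w \<Rightarrow> real) \<Rightarrow> bool" where
  "centered_gaussian P \<sigma> X \<longleftrightarrow> X \<in> borel_measurable P \<and>
     (if \<sigma> = 0 then AE \<omega> in P. X \<omega> = 0 else distributed P lborel X (normal_density 0 \<sigma>))"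

text \<open>White noise on \<open>Q\<close>, given through its stochastic integral \<open>g \<mapsto> \<integral>\<integral> g dW\<close>, as an isonormal
  Gaussian process over \<open>L\<^sup>2(Q)\<close>: an almost surely linear map with \<open>I g \<sim> N(0, \<parallel>g\<parallel>\<^sup>2)\<close>. Together the
  two conditions make \<open>I\<close> a jointly Gaussian family with covariance \<open>E[I f * I g] = (f, g)\<close>.
  The white noise measure of a Borel set \<open>A \<subseteq> Q\<close> is \<open>I\<close> of its indicator function.\<close>

definition white_noise :: "'w measure \<Rightarrow> 'a::euclidean_space set \<Rightarrow> (('a \<Rightarrow> real) \<Rightarrow> 'w \<Rightarrow> real) \<Rightarrow> bool"
  where
  "white_noise P Q I \<longleftrightarrow>
     (\<forall>g\<in>L2 Q. centered_gaussian P (L2_norm Q g) (I g)) \<and>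
     (\<forall>f\<in>L2 Q. \<forall>g\<in>L2 Q. \<forall>a b.
        AE \<omega> in P. I (\<lambda>z. a * f z + b * g z) \<omega> = a * I f \<omega> + b * I g \<omega>)"

definition lam :: "nat \<Rightarrow> real" where
  "lam k = real k * pi"

definition eps :: "nat \<Rightarrow> real \<Rightarrow> real" where
  "eps k z = sqrt 2 * sin (lam k * z)"

definition phi :: "nat \<Rightarrow> real \<Rightarrow> real" where
  "phi k z = sqrt 2 * cos (lam k * z)"

definition Psi :: "real \<Rightarrow> real \<Rightarrow> real \<Rightarrow> real \<Rightarrow> real" where
  "Psi \<mu> t x y =
     - (\<Sum>j. let k = Suc j in
          lam k * exp (- ((lam k)\<^sup>2 * ((lam k)\<^sup>2 - \<mu>) * t)) * eps k x * phi k y)"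

definition subint :: "real \<Rightarrow> nat \<Rightarrow> real set" where
  "subint \<delta> n = {(real n - 1) * \<delta><..<real n * \<delta>}"

definition canvas_R ::
  "((real \<times> real \<Rightarrow> real) \<Rightarrow> 'w \<Rightarrow> real) \<Rightarrow> real \<Rightarrow> nat \<Rightarrow> nat \<Rightarrow> 'w \<Rightarrow> real" where
  "canvas_R I dt i n = I (\<lambda>(s, y). indicator (subint dt n) s * phi i y)"

text \<open>\<open>N\<close> is the number of time slabs of length \<open>dt = T / N\<close> and \<open>K\<close> the number of spatial modes;
  at the nodes \<open>n * dt\<close> the load is set to zero.\<close>

definition canvas_load ::
  "((real \<times> real \<Rightarrow> real) \<Rightarrow> 'w \<Rightarrow> real) \<Rightarrow> real \<Rightarrow> nat \<Rightarrow> nat \<Rightarrow> 'w \<Rightarrow> real \<Rightarrow> real \<Rightarrow> real" where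
  "canvas_load I T N K \<omega> t x =
     (let dt = T / real N in
      \<Sum>n=1..N. indicator (subint dt n) t * (1 / dt * (\<Sum>i=1..K. canvas_R I dt i n \<omega> * phi i x)))"

text \<open>The solution of \<open>u\<^sub>t + u\<^sub>x\<^sub>x\<^sub>x\<^sub>x + \<mu> u\<^sub>x\<^sub>x = \<partial>\<^sub>x w\<close> with \<open>u = u\<^sub>x\<^sub>x = 0\<close> on \<open>\<partial>D\<close> and \<open>u(0) = 0\<close>. One
  integration by parts in \<open>y\<close> moves the derivative from \<open>w\<close> to the Green function, which is where
  \<open>Psi\<close> comes from.\<close>

definition canvas_solution :: "real \<Rightarrow> (real \<Rightarrow> real \<Rightarrow> real) \<Rightarrow> real \<Rightarrow> real \<Rightarrow> real" where
  "canvas_solution \<mu> w t x =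
     (\<integral>s. (\<integral>y. Psi \<mu> (t - s) x y * w s y \<partial>lebesgue_on D) \<partial>lebesgue_on {0<..<t})"


section \<open>Finite elements and the IMEX method\<close>

definition piecewise_poly :: "nat \<Rightarrow> nat \<Rightarrow> (nat \<Rightarrow> real) \<Rightarrow> (real \<Rightarrow> real) \<Rightarrow> bool" where
  "piecewise_poly r J z f \<longleftrightarrow>
     (\<forall>j<J. \<exists>p :: real poly. degree p \<le> r \<and> (\<forall>x\<in>{z j..z (Suc j)}. f x = poly p x))"

definition fe_space :: "nat \<Rightarrow> real \<Rightarrow> (real \<Rightarrow> real) set \<Rightarrow> bool" where
  "fe_space r h S \<longleftrightarrow>
     S \<subseteq> sobolev 2 \<inter> sobolev_0_1 \<and>
     (\<lambda>x. 0) \<in> S \<and>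
     (\<forall>f\<in>S. \<forall>g\<in>S. \<forall>a b. (\<lambda>x. a * f x + b * g x) \<in> S) \<and>
     (\<exists>J z. J \<ge> 1 \<and> z 0 = 0 \<and> z J = 1 \<and> (\<forall>j<J. z j < z (Suc j)) \<and>
        h = Max ((\<lambda>j. z (Suc j) - z j) ` {..<J}) \<and>
        (\<forall>f\<in>S. piecewise_poly r J z f))"

definition approximation_property :: "nat \<Rightarrow> real \<Rightarrow> real \<Rightarrow> (real \<Rightarrow> real) set \<Rightarrow> bool" where
  "approximation_property r C h S \<longleftrightarrow>
     (\<forall>s\<in>{3..r+1}. \<forall>v \<in> sobolev (s + 1) \<inter> sobolev_0_1.
        (INF \<zeta>\<in>S. sobolev_norm 2 (\<lambda>x. v x - \<zeta> x)) \<le> C * h ^ (s - 2) * sobolev_norm s v)"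

text \<open>The scheme for one realisation \<open>w\<close> of the load, with \<open>M\<close> time steps of length \<open>T / M\<close>.\<close>

definition imex_fem ::
  "real \<Rightarrow> real \<Rightarrow> (real \<Rightarrow> real) set \<Rightarrow> (real \<Rightarrow> real \<Rightarrow> real) \<Rightarrow> nat \<Rightarrow> (nat \<Rightarrow> real \<Rightarrow> real) \<Rightarrow> bool"
  where
  "imex_fem T \<mu> S w M U \<longleftrightarrow>
     (let d\<tau> = T / real M in
      U 0 = (\<lambda>x. 0) \<and>
      (\<forall>m\<in>{1..M}. U m \<in> S \<and>
        (\<forall>\<zeta>\<in>S.
          L2_inner D (\<lambda>x. U m x - U (m - 1) x) \<zeta>
          + d\<tau> * (L2_inner D (weak_deriv 2 (U m)) (weak_deriv 2 \<zeta>)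
                  + \<mu> * L2_inner D (weak_deriv 2 (U (m - 1))) \<zeta>)
          = (\<integral>\<tau>. L2_inner D (deriv (w \<tau>)) \<zeta> \<partial>lebesgue_on (subint d\<tau> m)))))"

end

theory Submission
  imports Defs
begin

text \<open>Everything is linear in the Gaussian increments of the load, which are uncorrelated, so the mean square
  error is a sum over the modes \<open>\<epsilon>\<^sub>i\<close> of deterministic errors. For one mode it is the \<open>L\<^sup>2\<close> error in time and
  space between the response \<open>V\<close> of the scheme to an impulse \<open>\<epsilon>\<^sub>i\<close> and the exact solution
  \<open>y(t) \<epsilon>\<^sub>i\<close>, \<open>y(t) = exp(- \<lambda>\<^sup>2(\<lambda>\<^sup>2 - \<mu>)t)\<close>, \<open>\<lambda> = \<lambda>\<^sub>i\<close>. Summing the scheme over the time steps and testing with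
  the solution itself bounds it in \<open>L\<^sup>2\<close>. Applied to \<open>V\<close> this gives the stability bound \<open>C \<lambda>\<^sup>-\<^sup>4\<close>; applied to the
  difference of \<open>V\<close> and \<open>q\<^sub>n\<close> times the Ritz projection of \<open>\<epsilon>\<^sub>i\<close>, with \<open>q\<^sub>n\<close> the mean of \<open>y\<close> over the \<open>n\<close>-th step,
  it gives the bound \<open>C \<lambda>\<^sup>-\<^sup>4(\<Delta>\<tau>\<^sup>2\<lambda>\<^sup>8 + h\<^sup>2\<^sup>r\<lambda>\<^sup>6 + h\<^sup>2\<lambda>\<^sup>2)\<close>, the Ritz error being estimated by duality. The load contributes
  another factor \<open>\<lambda>\<^sup>2\<close>, and interpolating the two bounds yields a sum over the modes that converges like
  \<open>\<Sum> i powr (- 1 - \<delta>)\<close>.\<close>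

section \<open>The space L2 and its inner product\<close>

text \<open>White noise turns the error at the single time \<open>\<tau> m\<close> into an
  \<open>L2\<close> norm over all earlier times: the increments are uncorrelated, so their responses
  add in square. Hence an energy estimate in \<open>L2\<close> of time and space suffices. The two
  time grids are unrelated; the load slabs merely average over the steps of the scheme, so by
  Cauchy-Schwarz N leaves no trace in the constants. The exponents come from summability. A mode
  contributes l^2 times its error, and a bound l^-4 * X powr \<theta> with X = d^2 l^8 gives l powr
  (8 \<theta> - 2), summable for \<theta> < 1/8; X = h^(2r) l^6 gives \<theta> < 1/6, hence h powr
  (r/6). For h^2 l^2 the same power of h costs l powr (r/3 - 2), harmless for r at most 3. The
  nearly divergent sums are of size 1 / \<epsilon>, and the square root turns this into the power
  -1/2. \<open>U\<close> is given only through the scheme, with no measurability in \<omega>;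
  identifying it with a superposition of impulse responses also makes the squared error a quadratic
  polynomial in Gaussian variables.\<close>

lemma discriminant_le:
  fixes a b c :: real
  assumes "\<And>s t. 0 \<le> s\<^sup>2 * a + 2 * s * t * b + t\<^sup>2 * c"
  shows "\<bar>b\<bar> \<le> sqrt a * sqrt c"
proof -
  have a: "a \<ge> 0" using assms[of 1 0] by simp
  have c: "c \<ge> 0" using assms[of 0 1] by simp
  have "b\<^sup>2 \<le> a * c"
  \<comment> \<open>The form may degenerate, as the lemma also serves the semidefinite form of
    \<open>riesz_on_span\<close>. If c = 0 and s = 1, the expression is affine in t; the witness
    used below makes it -1 unless b = 0.\<close>
  proof (cases "c = 0")
    case True
    have "b = 0"
    proof (rule ccontr)
      assume "b \<noteq> 0"
      then show False using assms[of 1 "- (a + 1) / (2 * b)"] True by (simp add: field_simps)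
    qed
    then show ?thesis using True by simp
  next
    case False
    have "0 \<le> c * (a * c - b\<^sup>2)"
      using assms[of c "- b"] by (simp add: algebra_simps power2_eq_square)
    then show ?thesis using False c by (simp add: zero_le_mult_iff)
  qed
  then have "sqrt (b\<^sup>2) \<le> sqrt (a * c)" by (rule real_sqrt_le_mono)
  then show ?thesis by (simp only: real_sqrt_abs real_sqrt_mult)
qed

lemma L2_mult_integrable:
  assumes "f \<in> L2 Q" "g \<in> L2 Q"
  shows "integrable (lebesgue_on Q) (\<lambda>x. f x * g x)"
proof (rule Bochner_Integration.integrable_bound)
  show "integrable (lebesgue_on Q) (\<lambda>x. (f x)\<^sup>2 + (g x)\<^sup>2)"
    using assms by (auto simp: L2_def)
  show "(\<lambda>x. f x * g x) \<in> borel_measurable (lebesgue_on Q)"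
    using assms by (auto simp: L2_def)
  have "\<bar>a * b\<bar> \<le> a\<^sup>2 + b\<^sup>2" for a b :: real
  proof -
    have "2 * \<bar>a\<bar> * \<bar>b\<bar> \<le> a\<^sup>2 + b\<^sup>2" using sum_squares_bound[of "\<bar>a\<bar>" "\<bar>b\<bar>"] by simp
    moreover have "0 \<le> \<bar>a\<bar> * \<bar>b\<bar>" by simp
    ultimately show ?thesis unfolding abs_mult by linarith
  qed
  then have "norm (f x * g x) \<le> norm ((f x)\<^sup>2 + (g x)\<^sup>2)" for x
    unfolding real_norm_def by (metis abs_ge_self order_trans)
  then show "AE x in lebesgue_on Q. norm (f x * g x) \<le> norm ((f x)\<^sup>2 + (g x)\<^sup>2)"
    by simp
qed

lemma L2_lincomb:
  assumes "f \<in> L2 Q" "g \<in> L2 Q"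
  shows "(\<lambda>x. a * f x + b * g x) \<in> L2 Q"
proof -
  have "integrable (lebesgue_on Q) (\<lambda>x. a\<^sup>2 * (f x)\<^sup>2 + 2 * a * b * (f x * g x) + b\<^sup>2 * (g x)\<^sup>2)"
    using assms L2_mult_integrable[OF assms] by (auto simp: L2_def)
  moreover have "(\<lambda>x. a\<^sup>2 * (f x)\<^sup>2 + 2 * a * b * (f x * g x) + b\<^sup>2 * (g x)\<^sup>2)
      = (\<lambda>x. (a * f x + b * g x)\<^sup>2)"
    by (simp add: fun_eq_iff power2_eq_square algebra_simps)
  ultimately show ?thesis using assms by (auto simp: L2_def)
qed

lemma L2_zero [simp]: "(\<lambda>x. 0) \<in> L2 Q"
  by (simp add: L2_def)

lemma L2_cmult: "f \<in> L2 Q \<Longrightarrow> (\<lambda>x. a * f x) \<in> L2 Q"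
  using L2_lincomb[of f Q "\<lambda>x. 0" a 0] by simp

lemma L2_add: "f \<in> L2 Q \<Longrightarrow> g \<in> L2 Q \<Longrightarrow> (\<lambda>x. f x + g x) \<in> L2 Q"
  using L2_lincomb[of f Q g 1 1] by simp

lemma L2_diff: "f \<in> L2 Q \<Longrightarrow> g \<in> L2 Q \<Longrightarrow> (\<lambda>x. f x - g x) \<in> L2 Q"
  using L2_lincomb[of f Q g 1 "-1"] by simp

lemma L2_sum:
  assumes "\<And>i. i \<in> A \<Longrightarrow> f i \<in> L2 Q"
  shows "(\<lambda>x. \<Sum>i\<in>A. c i * f i x) \<in> L2 Q"
  using assms
  by (induction A rule: infinite_finite_induct) (auto intro!: L2_add L2_cmult)

lemma L2_inner_commute: "L2_inner Q f g = L2_inner Q g f"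
  by (simp add: L2_inner_def mult.commute)

lemma L2_inner_lincomb:
  assumes "f \<in> L2 Q" "g \<in> L2 Q" "k \<in> L2 Q"
  shows "L2_inner Q (\<lambda>x. a * f x + b * g x) k = a * L2_inner Q f k + b * L2_inner Q g k"
proof -
  have "L2_inner Q (\<lambda>x. a * f x + b * g x) k
      = (\<integral>x. a * (f x * k x) + b * (g x * k x) \<partial>lebesgue_on Q)"
    by (simp add: L2_inner_def algebra_simps)
  also have "\<dots> = a * L2_inner Q f k + b * L2_inner Q g k"
    using L2_mult_integrable[OF assms(1,3)] L2_mult_integrable[OF assms(2,3)]
    by (simp add: L2_inner_def)
  finally show ?thesis .
qed

lemma L2_inner_lincomb_right:
  assumes "f \<in> L2 Q" "g \<in> L2 Q" "k \<in> L2 Q"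
  shows "L2_inner Q k (\<lambda>x. a * f x + b * g x) = a * L2_inner Q k f + b * L2_inner Q k g"
  using L2_inner_lincomb[OF assms] by (simp add: L2_inner_commute)

lemma L2_inner_zero [simp]: "L2_inner Q (\<lambda>x. 0) f = 0" "L2_inner Q f (\<lambda>x. 0) = 0"
  by (simp_all add: L2_inner_def)

lemma L2_inner_cmult [simp]: "L2_inner Q (\<lambda>x. a * f x) g = a * L2_inner Q f g"
  "L2_inner Q f (\<lambda>x. a * g x) = a * L2_inner Q f g"
  by (simp_all add: L2_inner_def mult.assoc mult.left_commute)

lemma L2_inner_add:
  assumes "f \<in> L2 Q" "g \<in> L2 Q" "k \<in> L2 Q"
  shows "L2_inner Q (\<lambda>x. f x + g x) k = L2_inner Q f k + L2_inner Q g k"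
    "L2_inner Q k (\<lambda>x. f x + g x) = L2_inner Q k f + L2_inner Q k g"
  using L2_inner_lincomb[OF assms, of 1 1] L2_inner_lincomb_right[OF assms, of 1 1] by simp_all

lemma L2_inner_diff:
  assumes "f \<in> L2 Q" "g \<in> L2 Q" "k \<in> L2 Q"
  shows "L2_inner Q (\<lambda>x. f x - g x) k = L2_inner Q f k - L2_inner Q g k"
    "L2_inner Q k (\<lambda>x. f x - g x) = L2_inner Q k f - L2_inner Q k g"
  using L2_inner_lincomb[OF assms, of 1 "-1"] L2_inner_lincomb_right[OF assms, of 1 "-1"]
  by simp_all

lemma L2_inner_sum:
  assumes "\<And>i. i \<in> A \<Longrightarrow> f i \<in> L2 Q" "k \<in> L2 Q"
  shows "L2_inner Q (\<lambda>x. \<Sum>i\<in>A. c i * f i x) k = (\<Sum>i\<in>A. c i * L2_inner Q (f i) k)"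
  using assms
proof (induction A rule: infinite_finite_induct)
  case (insert i A)
  then show ?case
    using L2_inner_add(1)[of "\<lambda>x. c i * f i x" Q "\<lambda>x. \<Sum>i\<in>A. c i * f i x" k]
    by (simp add: L2_cmult L2_sum)
qed simp_all

lemma L2_inner_sum_right:
  assumes "\<And>i. i \<in> A \<Longrightarrow> f i \<in> L2 Q" "k \<in> L2 Q"
  shows "L2_inner Q k (\<lambda>x. \<Sum>i\<in>A. c i * f i x) = (\<Sum>i\<in>A. c i * L2_inner Q k (f i))"
  using L2_inner_sum[OF assms] by (simp add: L2_inner_commute)

lemma L2_inner_self_ge_0 [simp]: "0 \<le> L2_inner Q f f"
  by (simp add: L2_inner_def)

lemma L2_norm_ge_0 [simp]: "0 \<le> L2_norm Q f"
  by (simp add: L2_norm_def)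

lemma L2_norm_square: "(L2_norm Q f)\<^sup>2 = L2_inner Q f f"
  by (simp add: L2_norm_def)

lemma L2_norm_zero [simp]: "L2_norm Q (\<lambda>x. 0) = 0"
  by (simp add: L2_norm_def)

lemma L2_norm_cmult [simp]: "L2_norm Q (\<lambda>x. a * f x) = \<bar>a\<bar> * L2_norm Q f"
  by (simp add: L2_norm_def real_sqrt_mult flip: mult.assoc)

lemma L2_Cauchy_Schwarz:
  assumes "f \<in> L2 Q" "g \<in> L2 Q"
  shows "\<bar>L2_inner Q f g\<bar> \<le> L2_norm Q f * L2_norm Q g"
  unfolding L2_norm_def
proof (rule discriminant_le)
  fix s t :: real
  have "L2_inner Q (\<lambda>x. s * f x + t * g x) (\<lambda>x. s * f x + t * g x)
      = s\<^sup>2 * L2_inner Q f f + 2 * s * t * L2_inner Q f g + t\<^sup>2 * L2_inner Q g g"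
    using assms
    by (simp add: L2_inner_lincomb L2_inner_lincomb_right L2_lincomb L2_inner_commute[of Q g f]
        power2_eq_square algebra_simps)
  then show "0 \<le> s\<^sup>2 * L2_inner Q f f + 2 * s * t * L2_inner Q f g + t\<^sup>2 * L2_inner Q g g"
    using L2_inner_self_ge_0[of Q "\<lambda>x. s * f x + t * g x"] by simp
qed

lemma L2_norm_triangle:
  assumes "f \<in> L2 Q" "g \<in> L2 Q"
  shows "L2_norm Q (\<lambda>x. f x + g x) \<le> L2_norm Q f + L2_norm Q g"
proof (rule power2_le_imp_le)
  have "(L2_norm Q (\<lambda>x. f x + g x))\<^sup>2 = L2_inner Q f f + 2 * L2_inner Q f g + L2_inner Q g g"
    using assms
    by (simp add: L2_norm_square L2_inner_add L2_add L2_inner_commute[of Q g f])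
  also have "\<dots> \<le> (L2_norm Q f + L2_norm Q g)\<^sup>2"
    using L2_Cauchy_Schwarz[OF assms] by (simp add: power2_sum L2_norm_square)
  finally show "(L2_norm Q (\<lambda>x. f x + g x))\<^sup>2 \<le> (L2_norm Q f + L2_norm Q g)\<^sup>2" .
qed simp

lemma L2_norm_square_add_le:
  assumes "f \<in> L2 Q" "g \<in> L2 Q"
  shows "(L2_norm Q (\<lambda>x. f x + g x))\<^sup>2 \<le> 2 * (L2_norm Q f)\<^sup>2 + 2 * (L2_norm Q g)\<^sup>2"
proof -
  have "(L2_norm Q (\<lambda>x. f x + g x))\<^sup>2 \<le> (L2_norm Q f + L2_norm Q g)\<^sup>2"
    by (intro power_mono L2_norm_triangle assms) simp
  also have "\<dots> \<le> 2 * (L2_norm Q f)\<^sup>2 + 2 * (L2_norm Q g)\<^sup>2"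
    using sum_squares_bound[of "L2_norm Q f" "L2_norm Q g"] by (simp add: power2_sum)
  finally show ?thesis .
qed

lemma L2_norm_sum_le:
  assumes "\<And>i. i \<in> A \<Longrightarrow> f i \<in> L2 Q"
  shows "L2_norm Q (\<lambda>x. \<Sum>i\<in>A. c i * f i x) \<le> (\<Sum>i\<in>A. \<bar>c i\<bar> * L2_norm Q (f i))"
  using assms
proof (induction A rule: infinite_finite_induct)
  case (insert i A)
  then show ?case
    using L2_norm_triangle[of "\<lambda>x. c i * f i x" Q "\<lambda>x. \<Sum>i\<in>A. c i * f i x"]
    by (simp add: L2_cmult L2_sum)
qed simp_all

lemma L2_inner_cong_AE:
  assumes "f \<in> L2 Q" "g \<in> L2 Q" "k \<in> L2 Q" "AE x in lebesgue_on Q. f x = g x"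
  shows "L2_inner Q f k = L2_inner Q g k" "L2_inner Q k f = L2_inner Q k g"
proof -
  show "L2_inner Q f k = L2_inner Q g k"
    unfolding L2_inner_def using assms by (intro integral_cong_AE) (auto simp: L2_def)
  then show "L2_inner Q k f = L2_inner Q k g" by (simp add: L2_inner_commute)
qed

lemma L2_norm_cong_AE:
  assumes "f \<in> L2 Q" "g \<in> L2 Q" "AE x in lebesgue_on Q. f x = g x"
  shows "L2_norm Q f = L2_norm Q g"
  using L2_inner_cong_AE[OF assms(1,2) assms(1) assms(3)] L2_inner_cong_AE[OF assms(1,2) assms(2) assms(3)]
  by (simp add: L2_norm_def)

lemma L2_norm_eq_0_AE:
  assumes "f \<in> L2 Q" "L2_norm Q f = 0"
  shows "AE x in lebesgue_on Q. f x = 0"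
proof -
  have "(\<integral>x. (f x)\<^sup>2 \<partial>lebesgue_on Q) = 0"
    using assms(2) by (simp add: L2_norm_def L2_inner_def power2_eq_square)
  then have "AE x in lebesgue_on Q. (f x)\<^sup>2 = 0"
    using assms(1) by (subst (asm) integral_nonneg_eq_0_iff_AE) (auto simp: L2_def)
  then show ?thesis by simp
qed

lemma L2_inner_cong:
  "(\<And>x. x \<in> Q \<Longrightarrow> f x = f' x) \<Longrightarrow> (\<And>x. x \<in> Q \<Longrightarrow> g x = g' x) \<Longrightarrow> L2_inner Q f g = L2_inner Q f' g'"
  unfolding L2_inner_def by (rule Bochner_Integration.integral_cong) simp_all

lemma D_lmeasurable [simp]: "D \<in> sets lebesgue" "D \<in> lmeasurable"
  by auto

lemma finite_measure_D: "finite_measure (lebesgue_on D)"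
  by (rule finite_measure_lebesgue_on) simp

lemma measure_D [simp]: "measure (lebesgue_on D) D = 1"
  by (simp add: measure_restrict_space)

lemma bounded_L2_D:
  assumes "f \<in> borel_measurable (lebesgue_on D)" "\<And>x. x \<in> D \<Longrightarrow> \<bar>f x\<bar> \<le> B"
  shows "f \<in> L2 D" "L2_norm D f \<le> B"
proof -
  interpret finite_measure "lebesgue_on D" by (rule finite_measure_D)
  have B: "0 \<le> B" using assms(2)[of "1/2"] by auto
  have sq: "(f x)\<^sup>2 \<le> B\<^sup>2" if "x \<in> D" for x
    using assms(2)[OF that] B by (metis abs_of_nonneg abs_le_square_iff)
  have int: "integrable (lebesgue_on D) (\<lambda>x. (f x)\<^sup>2)"
    using assms(1) sq by (intro integrable_const_bound[of _ "B\<^sup>2"]) auto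
  then show "f \<in> L2 D" using assms(1) by (simp add: L2_def)
  have "L2_inner D f f \<le> (\<integral>x. B\<^sup>2 \<partial>lebesgue_on D)"
    unfolding L2_inner_def using int sq
    by (intro integral_mono) (auto simp: power2_eq_square)
  then have "L2_inner D f f \<le> B\<^sup>2" by simp
  then show "L2_norm D f \<le> B"
    unfolding L2_norm_def using B real_le_lsqrt by blast
qed

lemma continuous_L2_D:
  assumes "continuous_on UNIV (f :: real \<Rightarrow> real)"
  shows "f \<in> L2 D"
proof -
  have "bounded (f ` {0..1})"
    using assms by (intro compact_imp_bounded compact_continuous_image) (auto intro: continuous_on_subset)
  then obtain B where B: "\<forall>y\<in>f ` {0..1}. norm y \<le> B"
    unfolding bounded_iff by blast
  have "f \<in> borel_measurable (lebesgue_on D)"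
    using assms by (intro continuous_imp_measurable_on_sets_lebesgue) (auto intro: continuous_on_subset)
  then show ?thesis
    using B by (intro bounded_L2_D(1)[of f B]) auto
qed

section \<open>Smooth functions and test functions\<close>

definition smooth :: "(real \<Rightarrow> real) \<Rightarrow> bool" where
  "smooth f \<longleftrightarrow> (\<forall>k x. (deriv ^^ k) f field_differentiable at x)"

text \<open>Higher derivatives need not be computed: a class of functions that contains a derivative
  of each member contains all iterated derivatives. Sums, products, sines and bumps are handled by
  naming such a class.\<close>

lemma smooth_coinduct:
  assumes "f \<in> F" "\<And>f. f \<in> F \<Longrightarrow> \<exists>f'\<in>F. \<forall>x. (f has_real_derivative f' x) (at x)"
  shows "smooth f"
proof -
  have "(deriv ^^ k) f \<in> F" for k
  proof (induction k)
    case (Suc k)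
    then obtain f' where f': "f' \<in> F" "\<And>x. ((deriv ^^ k) f has_real_derivative f' x) (at x)"
      using assms(2) by blast
    have "deriv ((deriv ^^ k) f) = f'" using f'(2) by (auto intro: DERIV_imp_deriv)
    then show ?case using f'(1) by simp
  qed (simp add: assms(1))
  then show ?thesis
    unfolding smooth_def using assms(2) by (metis field_differentiable_def)
qed

lemma smooth_DERIV: "smooth f \<Longrightarrow> (f has_real_derivative deriv f x) (at x)"
  unfolding smooth_def using field_differentiable_derivI[of f x] by (metis funpow_0)

lemma smooth_deriv: "smooth f \<Longrightarrow> smooth (deriv f)"
  unfolding smooth_def by (metis funpow_Suc_right comp_apply)

lemma smooth_funpow_deriv: "smooth f \<Longrightarrow> smooth ((deriv ^^ k) f)"
  by (induction k) (auto intro: smooth_deriv)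

lemma smooth_DERIV_intro:
  assumes "\<And>x. (f has_real_derivative f' x) (at x)" "smooth f'"
  shows "smooth f"
proof (rule smooth_coinduct[of f "insert f {g. smooth g}"])
  fix g assume "g \<in> insert f {g. smooth g}"
  then show "\<exists>f'\<in>insert f {g. smooth g}. \<forall>x. (g has_real_derivative f' x) (at x)"
    using assms smooth_DERIV smooth_deriv by blast
qed simp

lemma deriv_eqI: "(\<And>x. (f has_real_derivative f' x) (at x)) \<Longrightarrow> deriv f = f'"
  by (auto intro: DERIV_imp_deriv)

lemma smooth_continuous: "smooth f \<Longrightarrow> continuous_on UNIV f"
  by (intro continuous_at_imp_continuous_on ballI DERIV_isCont[OF smooth_DERIV])

lemma smooth_const [simp]: "smooth (\<lambda>x. c)"
  by (rule smooth_coinduct[of _ "range (\<lambda>c x. c)"]) (auto intro: derivative_eq_intros)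

lemma smooth_ident [simp]: "smooth (\<lambda>x. x)"
  by (rule smooth_DERIV_intro[of _ "\<lambda>x. 1"]) (auto intro!: derivative_eq_intros)

lemma smooth_add:
  assumes "smooth f" "smooth g" shows "smooth (\<lambda>x. f x + g x)"
proof (rule smooth_coinduct[of _ "{\<lambda>x. f x + g x |f g. smooth f \<and> smooth g}"])
  fix h assume "h \<in> {\<lambda>x. f x + g x |f g. smooth f \<and> smooth g}"
  then obtain f g where h: "h = (\<lambda>x. f x + g x)" "smooth f" "smooth g" by blast
  have "\<forall>x. (h has_real_derivative deriv f x + deriv g x) (at x)"
    using h by (auto intro!: derivative_eq_intros smooth_DERIV)
  then show "\<exists>f'\<in>{\<lambda>x. f x + g x |f g. smooth f \<and> smooth g}. \<forall>x. (h has_real_derivative f' x) (at x)"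
    using h(2,3)[THEN smooth_deriv]
    by (intro bexI[of _ "\<lambda>x. deriv f x + deriv g x"]) auto
qed (use assms in auto)

lemma smooth_mult:
  assumes "smooth f" "smooth g" shows "smooth (\<lambda>x. f x * g x)"
proof -
  \<comment> \<open>The derivative of one product is a sum of two, so the class has to consist of
    finite sums of products. Below, \<open>a'\<close> and \<open>b'\<close> list the 2n products of
    the derivative: the left factor is differentiated in the first n, the right factor in the
    rest.\<close>
  define F where "F = {\<lambda>x. \<Sum>i<n. a i x * b i x |(n::nat) a b. \<forall>i. smooth (a i) \<and> smooth (b i)}"
  show ?thesis
  proof (rule smooth_coinduct[of _ F])
    show "(\<lambda>x. f x * g x) \<in> F"
      unfolding F_def using assms
      by (intro CollectI exI[of _ "1::nat"] exI[of _ "\<lambda>_::nat. f"] exI[of _ "\<lambda>_::nat. g"]) auto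
  next
    fix h assume "h \<in> F"
    then obtain n :: nat and a b where h0: "h = (\<lambda>x. \<Sum>i<n. a i x * b i x)" "\<forall>i. smooth (a i) \<and> smooth (b i)"
      unfolding F_def by blast
    note h = h0(1) h0(2)[rule_format, THEN conjunct1] h0(2)[rule_format, THEN conjunct2]
    define a' where "a' i = (if i < n then deriv (a i) else a (i - n))" for i
    define b' where "b' i = (if i < n then b i else deriv (b (i - n)))" for i
    have "(\<Sum>i<n. deriv (a i) x * b i x + a i x * deriv (b i) x) = (\<Sum>i<n+n. a' i x * b' i x)" for x
      by (simp add: sum.nat_group[of _ n 2] lessThan_atLeast0 sum.atLeastLessThan_concat[of 0 n "n+n", symmetric]
          sum.shift_bounds_nat_ivl[of _ 0 n n, simplified] a'_def b'_def sum.distrib)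
    moreover have "(h has_real_derivative (\<Sum>i<n. deriv (a i) x * b i x + a i x * deriv (b i) x)) (at x)" for x
      unfolding h using h(2,3) by (auto intro!: derivative_eq_intros smooth_DERIV sum.cong)
    moreover have "(\<lambda>x. \<Sum>i<n+n. a' i x * b' i x) \<in> F"
      unfolding F_def using h(2,3) smooth_deriv
      by (intro CollectI exI[of _ "n+n"] exI[of _ a'] exI[of _ b']) (auto simp: a'_def b'_def)
    ultimately show "\<exists>f'\<in>F. \<forall>x. (h has_real_derivative f' x) (at x)" by (auto intro!: bexI)
  qed
qed

lemma smooth_cmult: "smooth f \<Longrightarrow> smooth (\<lambda>x. c * f x)"
  by (rule smooth_mult) simp_all

lemma smooth_diff: "smooth f \<Longrightarrow> smooth g \<Longrightarrow> smooth (\<lambda>x. f x - g x)"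
  using smooth_add[of f "\<lambda>x. - 1 * g x"] smooth_cmult[of g "-1"] by simp

lemma smooth_lincomb: "smooth f \<Longrightarrow> smooth g \<Longrightarrow> smooth (\<lambda>x. a * f x + b * g x)"
  by (intro smooth_add smooth_cmult)

lemma smooth_power: "smooth f \<Longrightarrow> smooth (\<lambda>x. f x ^ n)"
  by (induction n) (auto intro: smooth_mult)

lemma smooth_sin: "smooth (\<lambda>x. c * sin (a * x))"
proof (rule smooth_coinduct[of _ "range (\<lambda>(c, d) x. c * sin (a * x) + d * cos (a * x))"])
  show "(\<lambda>x. c * sin (a * x)) \<in> range (\<lambda>(c, d) x. c * sin (a * x) + d * cos (a * x))"
    by (rule range_eqI[of _ _ "(c, 0)"]) simp
  fix f assume "f \<in> range (\<lambda>(c, d) x. c * sin (a * x) + d * cos (a * x))"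
  then obtain c d where f: "f = (\<lambda>x. c * sin (a * x) + d * cos (a * x))" by auto
  show "\<exists>f'\<in>range (\<lambda>(c, d) x. c * sin (a * x) + d * cos (a * x)). \<forall>x. (f has_real_derivative f' x) (at x)"
    unfolding f
    by (rule bexI[of _ "\<lambda>x. (- d * a) * sin (a * x) + (c * a) * cos (a * x)"])
      (auto intro!: derivative_eq_intros range_eqI[of _ _ "(- d * a, c * a)"])
qed

lemma test_function_smooth: "test_function \<eta> \<Longrightarrow> smooth \<eta>"
  by (simp add: test_function_def smooth_def)

lemma test_functionE:
  assumes "test_function \<eta>"
  obtains a b where "0 < a" "a < b" "b < 1" "\<And>x. x \<notin> {a..b} \<Longrightarrow> \<eta> x = 0"
proof -
  from assms obtain a b where ab: "0 < a" "b < 1" "\<forall>x. x \<notin> {a..b} \<longrightarrow> \<eta> x = 0"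
    by (auto simp: test_function_def)
  show ?thesis
    \<comment> \<open>The interval in the definition may be empty; enlarging it to contain
      [1/3, 1/2] makes it nondegenerate.\<close>
    by (rule that[of "min a (1/3)" "max b (1/2)"]) (use ab in \<open>auto simp: min_le_iff_disj le_max_iff_disj\<close>)
qed

lemma test_functionI:
  "smooth \<eta> \<Longrightarrow> 0 < a \<Longrightarrow> b < 1 \<Longrightarrow> (\<And>x. x \<notin> {a..b} \<Longrightarrow> \<eta> x = 0) \<Longrightarrow> test_function \<eta>"
  by (auto simp: test_function_def smooth_def)

lemma test_function_mult:
  assumes "smooth f" "test_function \<eta>" shows "test_function (\<lambda>x. f x * \<eta> x)"
proof -
  obtain a b where ab: "0 < a" "b < 1" "\<And>x. x \<notin> {a..b} \<Longrightarrow> \<eta> x = 0"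
    using assms(2) by (rule test_functionE) blast
  show ?thesis
    by (rule test_functionI[OF smooth_mult[OF assms(1) test_function_smooth[OF assms(2)]] ab(1,2)])
      (simp add: ab(3))
qed

lemma test_function_lincomb:
  assumes "test_function f" "test_function g"
  shows "test_function (\<lambda>x. a * f x + b * g x)"
proof -
  obtain a1 b1 where 1: "0 < a1" "b1 < 1" "\<And>x. x \<notin> {a1..b1} \<Longrightarrow> f x = 0"
    using assms(1) by (rule test_functionE) blast
  obtain a2 b2 where 2: "0 < a2" "b2 < 1" "\<And>x. x \<notin> {a2..b2} \<Longrightarrow> g x = 0"
    using assms(2) by (rule test_functionE) blast
  show ?thesis
    using 1 2 assms[THEN test_function_smooth]
    by (intro test_functionI[of _ "min a1 a2" "max b1 b2"] smooth_lincomb)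
      (auto simp: min_le_iff_disj le_max_iff_disj)
qed

lemma DERIV_zero_outside:
  assumes "(f has_real_derivative f') (at x)" "x \<notin> {a..b}" "\<And>x. x \<notin> {a..b} \<Longrightarrow> f x = 0"
  shows "f' = 0"
proof -
  have "((\<lambda>x. 0) has_real_derivative f') (at x)"
  proof (rule has_field_derivative_transform_within_open[OF assms(1)])
    show "open (- {a..b})" by (simp add: open_Compl)
  qed (use assms in auto)
  then show ?thesis by (metis DERIV_const DERIV_unique)
qed

lemma test_function_deriv:
  assumes "test_function \<eta>" shows "test_function (deriv \<eta>)"
proof -
  obtain a b where ab: "0 < a" "b < 1" "\<And>x. x \<notin> {a..b} \<Longrightarrow> \<eta> x = 0"
    using assms by (rule test_functionE) blast
  have "deriv \<eta> x = 0" if "x \<notin> {a..b}" for x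
    using DERIV_zero_outside[OF smooth_DERIV[OF test_function_smooth[OF assms]] that] ab(3) by blast
  then show ?thesis
    by (rule test_functionI[OF smooth_deriv[OF test_function_smooth[OF assms]] ab(1,2)])
qed

lemma test_function_funpow_deriv: "test_function \<eta> \<Longrightarrow> test_function ((deriv ^^ k) \<eta>)"
  by (induction k) (auto intro: test_function_deriv)

section \<open>Bump functions and the approximation of indicators of intervals\<close>

definition bump :: "real \<Rightarrow> real \<Rightarrow> real \<Rightarrow> real \<Rightarrow> real" where
  "bump c a b x = (if a < x \<and> x < b then exp (- c / ((x - a) * (b - x))) else 0)"

lemma DERIV_zero_of_quadratic_bound:
  assumes "\<And>y. \<bar>f y\<bar> \<le> C * (y - x)\<^sup>2"
  shows "(f has_real_derivative 0) (at x)"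
proof -
  have f0: "f x = 0" using assms[of x] by simp
  have "((\<lambda>y. (f y - f x) / (y - x)) \<longlongrightarrow> 0) (at x)"
  proof (rule Lim_null_comparison)
    show "\<forall>\<^sub>F y in at x. norm ((f y - f x) / (y - x)) \<le> C * \<bar>y - x\<bar>"
    proof (intro always_eventually allI)
      fix y
      show "norm ((f y - f x) / (y - x)) \<le> C * \<bar>y - x\<bar>"
      proof (cases "y = x")
        case False
        have "\<bar>f y\<bar> \<le> C * \<bar>y - x\<bar> * \<bar>y - x\<bar>"
          using assms[of y] by (simp add: power2_eq_square mult.assoc flip: abs_mult)
        then show ?thesis using False f0 by (simp add: divide_le_eq)
      qed simp
    qed
    show "((\<lambda>y. C * \<bar>y - x\<bar>) \<longlongrightarrow> 0) (at x)"
      by (auto intro!: tendsto_eq_intros)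
  qed
  then show ?thesis by (simp add: has_field_derivative_iff)
qed

text \<open>Raise \<open>1 + t \<le> exp t\<close> with t = c / (w (m + 1)) to the power m + 1 and
  take reciprocals.\<close>

lemma exp_neg_inverse_le_power:
  assumes "0 < w" "0 < c"
  shows "exp (- c / w) \<le> (real (Suc m) / c * w) ^ Suc m"
proof -
  have "(c / w / real (Suc m)) ^ Suc m \<le> exp (c / w / real (Suc m)) ^ Suc m"
    using assms exp_ge_add_one_self[of "c / w / real (Suc m)"]
    by (intro power_mono) (linarith, simp)
  also have "\<dots> = exp (c / w)"
    by (simp flip: exp_of_nat_mult del: of_nat_Suc power_Suc)
  finally have "1 / exp (c / w) \<le> 1 / (c / w / real (Suc m)) ^ Suc m"
    using assms by (intro divide_left_mono mult_pos_pos) (auto simp del: of_nat_Suc power_Suc)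
  also have "\<dots> = (real (Suc m) / c * w) ^ Suc m"
    using assms by (simp add: power_divide power_mult_distrib field_simps del: of_nat_Suc power_Suc)
  finally show ?thesis by (simp add: exp_minus inverse_eq_divide)
qed

text \<open>The functions p / w^n * exp (- c / w) on (a, b), extended by zero, form a class closed
  under differentiation, where w = (x - a) (b - x). The delicate points are the two ends, where the
  exponential has to beat the pole.\<close>

lemma smooth_bump:
  assumes "a < b" "0 < c"
  shows "smooth (bump c a b)"
proof -
  define w where "w x = (x - a) * (b - x)" for x
  define W :: "real poly" where "W = [:- (a * b), a + b, - 1:]"
  have W: "poly W x = w x" for x by (simp add: W_def w_def algebra_simps)
  define g where "g p n x = (if a < x \<and> x < b then poly p x / w x ^ n * exp (- c / w x) else 0)"
    for p :: "real poly" and n x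
  have w_pos: "0 < w x" if "a < x" "x < b" for x using that by (simp add: w_def)
  have wD: "(w has_real_derivative (a + b - 2 * x)) (at x)" for x
    unfolding w_def by (auto intro!: derivative_eq_intros)
  \<comment> \<open>Product and chain rule over the common denominator w^(n+2);
    \<open>[:a + b, - 2:]\<close> is the derivative of w.\<close>
  define p' where "p' p n = pderiv p * W\<^sup>2 - smult (real n) (p * [:a + b, - 2:] * W) + smult c (p * [:a + b, - 2:])"
    for p and n :: nat
  have p': "poly (p' p n) x = poly (pderiv p) x * (w x)\<^sup>2 - real n * (poly p x * (a + b - 2 * x) * w x)
      + c * (poly p x * (a + b - 2 * x))" for p n x
    by (simp add: p'_def W algebra_simps)
  have bound: "\<exists>C. \<forall>y. \<bar>g p n y\<bar> \<le> C * (w y)\<^sup>2" for p n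
  proof -
    have "bounded (poly p ` {a..b})"
      by (intro compact_imp_bounded compact_continuous_image) (auto intro: continuous_intros)
    then obtain B where "\<forall>z\<in>poly p ` {a..b}. norm z \<le> B"
      unfolding bounded_iff by blast
    then have B: "\<And>y. y \<in> {a..b} \<Longrightarrow> \<bar>poly p y\<bar> \<le> B" by auto
    have B0: "0 \<le> B" using B[of a] assms by force
    \<comment> \<open>Two powers of w more than the denominator has, so that a factor w^2 survives
      in the bound.\<close>
    define K where "K = (real (Suc (Suc n)) / c) ^ Suc (Suc n)"
    have "\<bar>g p n y\<bar> \<le> B * K * (w y)\<^sup>2" for y
    proof (cases "a < y \<and> y < b")
      case True
      have w: "0 < w y" using True w_pos by blast
      have "exp (- c / w y) \<le> K * w y ^ Suc (Suc n)"
        using exp_neg_inverse_le_power[OF w assms(2), of "Suc n"]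
        by (simp only: K_def power_mult_distrib)
      then have "\<bar>g p n y\<bar> \<le> B / w y ^ n * (K * w y ^ Suc (Suc n))"
        using True w B[of y] B0 unfolding g_def
        by (auto simp: abs_mult simp del: power_Suc intro!: mult_mono divide_right_mono)
      also have "\<dots> = B * K * (w y)\<^sup>2"
        using w by (simp add: field_simps power2_eq_square)
      finally show ?thesis .
    next
      case False
      have "0 \<le> K" using assms by (auto simp: K_def)
      then show ?thesis using False B0 by (auto simp: g_def)
    qed
    then show ?thesis by blast
  qed
  have deriv: "(g p n has_real_derivative g (p' p n) (n + 2) x) (at x)" for p n x
  proof -
    consider "a < x" "x < b" | "x < a \<or> x > b" | "x = a \<or> x = b" by linarith
    then show ?thesis
    proof cases
      case 1
      have w: "w x \<noteq> 0" using w_pos[OF 1] by simp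
      define v where "v x = 1 / w x" for x
      have wv: "w x * v x = 1" using w by (simp add: v_def)
      have vD: "(v has_real_derivative - ((a + b - 2 * x) * (v x)\<^sup>2)) (at x)"
        unfolding v_def using w by (auto intro!: derivative_eq_intros wD simp: power2_eq_square field_simps)
      have "((\<lambda>x. poly p x * v x ^ n * exp (- c * v x)) has_real_derivative
          (poly (pderiv p) x * v x ^ n - poly p x * (a + b - 2 * x) * (real n * v x ^ (n - 1) * (v x)\<^sup>2)
            + c * poly p x * (a + b - 2 * x) * (v x ^ n * (v x)\<^sup>2)) * exp (- c * v x)) (at x)"
        by (rule derivative_eq_intros vD poly_DERIV refl)+ (simp add: algebra_simps)
      moreover have "real n * v x ^ (n - 1) * (v x)\<^sup>2 = real n * (w x * v x ^ (n + 2))"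
        using wv by (cases n) (simp_all add: power2_eq_square mult.assoc[symmetric])
      moreover have "v x ^ n = (w x)\<^sup>2 * v x ^ (n + 2)"
      proof -
        have "(w x)\<^sup>2 * v x ^ (n + 2) = (w x * v x)\<^sup>2 * v x ^ n"
          by (simp add: power2_eq_square algebra_simps)
        then show ?thesis using wv by simp
      qed
      moreover have "v x ^ n * (v x)\<^sup>2 = v x ^ (n + 2)" by (simp add: power2_eq_square)
      ultimately have "((\<lambda>x. poly p x * v x ^ n * exp (- c * v x)) has_real_derivative
          (poly (pderiv p) x * ((w x)\<^sup>2 * v x ^ (n + 2)) - poly p x * (a + b - 2 * x) * (real n * (w x * v x ^ (n + 2)))
            + c * poly p x * (a + b - 2 * x) * v x ^ (n + 2)) * exp (- c * v x)) (at x)"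
        by (simp only:)
      moreover have "(poly (pderiv p) x * ((w x)\<^sup>2 * v x ^ (n + 2)) - poly p x * (a + b - 2 * x) * (real n * (w x * v x ^ (n + 2)))
            + c * poly p x * (a + b - 2 * x) * v x ^ (n + 2)) * exp (- c * v x) = g (p' p n) (n + 2) x"
        using 1 by (simp add: g_def p' v_def power_inverse divide_inverse algebra_simps del: power_Suc)
      ultimately have "((\<lambda>x. poly p x * v x ^ n * exp (- c * v x)) has_real_derivative g (p' p n) (n + 2) x) (at x)"
        by simp
      then show ?thesis
        by (rule has_field_derivative_transform_within_open[where S = "{a<..<b}"]) (use 1 in \<open>auto simp: g_def v_def power_inverse divide_inverse\<close>)
    next
      case 2
      have "((\<lambda>x. 0) has_real_derivative 0) (at x)" by simp
      then have "(g p n has_real_derivative 0) (at x)"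
        by (rule has_field_derivative_transform_within_open[where S = "- {a..b}"])
          (use 2 in \<open>auto simp: g_def open_Compl\<close>)
      then show ?thesis using 2 by (auto simp: g_def)
    next
      \<comment> \<open>At an end point w vanishes to first order, so the bound by w^2 is quadratic
        in the distance and forces a zero derivative.\<close>
      case 3
      obtain C where C: "\<And>y. \<bar>g p n y\<bar> \<le> C * (w y)\<^sup>2" using bound by blast
      have "\<bar>g p n y\<bar> \<le> \<bar>C\<bar> * (b - a)\<^sup>2 * (y - x)\<^sup>2" for y
      proof (cases "a < y \<and> y < b")
        case True
        have "\<bar>w y\<bar> \<le> (b - a) * \<bar>y - x\<bar>"
          using 3
        proof
          assume "x = a"
          then have "\<bar>w y\<bar> = \<bar>b - y\<bar> * \<bar>y - x\<bar>" by (simp add: w_def abs_mult)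
          then show ?thesis using True by (auto intro!: mult_right_mono)
        next
          assume "x = b"
          then have "\<bar>w y\<bar> = \<bar>y - a\<bar> * \<bar>y - x\<bar>" by (simp add: w_def abs_mult abs_minus_commute)
          then show ?thesis using True by (auto intro!: mult_right_mono)
        qed
        then have "(w y)\<^sup>2 \<le> ((b - a) * \<bar>y - x\<bar>)\<^sup>2"
          using power_mono[of "\<bar>w y\<bar>" _ 2] by simp
        then have "\<bar>C\<bar> * (w y)\<^sup>2 \<le> \<bar>C\<bar> * (b - a)\<^sup>2 * (y - x)\<^sup>2"
          by (simp add: power_mult_distrib mult.assoc mult_left_mono)
        moreover have "C * (w y)\<^sup>2 \<le> \<bar>C\<bar> * (w y)\<^sup>2" by (intro mult_right_mono) auto
        ultimately show ?thesis using C[of y] by linarith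
      qed (auto simp: g_def)
      then have "(g p n has_real_derivative 0) (at x)" by (rule DERIV_zero_of_quadratic_bound)
      then show ?thesis using 3 by (auto simp: g_def)
    qed
  qed
  show ?thesis
  proof (rule smooth_coinduct[of _ "{g p n |p n. True}"])
    have "bump c a b = g 1 0" by (auto simp: bump_def g_def w_def fun_eq_iff)
    then show "bump c a b \<in> {g p n |p n. True}" by blast
  qed (use deriv in blast)
qed

lemma bump_range: "0 < c \<Longrightarrow> 0 \<le> bump c a b x \<and> bump c a b x \<le> 1"
  by (auto simp: bump_def)

lemma test_function_bump: "0 < a \<Longrightarrow> a < b \<Longrightarrow> b < 1 \<Longrightarrow> 0 < c \<Longrightarrow> test_function (bump c a b)"
  by (rule test_functionI[of _ a b]) (auto intro: smooth_bump simp: bump_def)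

text \<open>The bumps live on the interval shrunk by \<open>d n\<close> at each end and have the
  parameter \<open>d n\<close> in the exponent; as both tend to zero, the values at interior points
  rise to 1. The bounds 0 and 1 are there for dominated convergence.\<close>

lemma indicator_test_function_approx:
  fixes a b :: real
  assumes "0 \<le> a" "a < b" "b \<le> 1"
  obtains \<eta> :: "nat \<Rightarrow> real \<Rightarrow> real" where "\<And>n. test_function (\<eta> n)" "\<And>n x. 0 \<le> \<eta> n x \<and> \<eta> n x \<le> 1"
    "\<And>x. (\<lambda>n. \<eta> n x) \<longlonglongrightarrow> indicator {a<..<b} x"
proof -
  \<comment> \<open>The 3 keeps the shrunk interval nondegenerate for every n, including n =
    0.\<close>
  define d where "d n = (b - a) / real (n + 3)" for n
  have d: "0 < d n" "2 * d n < b - a" for n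
  proof -
    show "0 < d n" using assms by (simp add: d_def)
    have "(b - a) * 2 < (b - a) * real (n + 3)" using assms by (intro mult_strict_left_mono) auto
    then show "2 * d n < b - a" by (simp add: d_def divide_less_eq)
  qed
  have d_lim: "d \<longlonglongrightarrow> 0"
    unfolding d_def using LIMSEQ_ignore_initial_segment[OF lim_const_over_n, of "b - a" 3] by simp
  define \<eta> where "\<eta> n = bump (d n) (a + d n) (b - d n)" for n
  have "(\<lambda>n. \<eta> n x) \<longlonglongrightarrow> indicator {a<..<b} x" for x
  proof (cases "a < x \<and> x < b")
    case True
    have "\<forall>\<^sub>F n in sequentially. d n < min (x - a) (b - x)"
      using True d_lim by (intro order_tendstoD(2)[of d 0]) auto
    then have ev: "\<forall>\<^sub>F n in sequentially. exp (- d n / ((x - (a + d n)) * ((b - d n) - x))) = \<eta> n x"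
      by eventually_elim (auto simp: \<eta>_def bump_def)
    have "(\<lambda>n. exp (- d n / ((x - (a + d n)) * ((b - d n) - x)))) \<longlonglongrightarrow> exp (- 0 / ((x - (a + 0)) * ((b - 0) - x)))"
      using True by (intro tendsto_intros d_lim) auto
    then show ?thesis using True Lim_transform_eventually[OF _ ev] by simp
  next
    case False
    have "\<eta> n x = 0" for n using False d(1)[of n] by (auto simp: \<eta>_def bump_def)
    then show ?thesis using False by auto
  qed
  moreover have "test_function (\<eta> n)" for n
    unfolding \<eta>_def using d[of n] assms by (intro test_function_bump) auto
  ultimately show ?thesis
    using that[of \<eta>] bump_range d(1) by (auto simp: \<eta>_def)
qed

section \<open>Integrals over open intervals and the fundamental lemma of the calculus of
  variations\<close>

lemma integral_lebesgue_on_Ioo_FTC: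
  fixes G g :: "real \<Rightarrow> real"
  assumes "a \<le> b" "\<And>x. x \<in> {a..b} \<Longrightarrow> (G has_real_derivative g x) (at x)" "continuous_on {a..b} g"
  shows "integrable (lebesgue_on {a<..<b}) g" "(\<integral>x. g x \<partial>lebesgue_on {a<..<b}) = G b - G a"
proof -
  have "g absolutely_integrable_on {a..b}"
    using assms(3) absolutely_integrable_continuous_real by blast
  then have abs: "g absolutely_integrable_on {a<..<b}"
    by (rule set_integrable_subset) auto
  then show int: "integrable (lebesgue_on {a<..<b}) g"
    by (simp add: integrable_restrict_space set_integrable_def)
  have "(g has_integral (G b - G a)) {a..b}"
    using assms(1,2)
    by (intro fundamental_theorem_of_calculus)
      (auto simp: has_real_derivative_iff_has_vector_derivative intro: has_vector_derivative_at_within)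
  then have "(g has_integral (G b - G a)) {a<..<b}" by (simp add: has_integral_Icc_iff_Ioo)
  then show "(\<integral>x. g x \<partial>lebesgue_on {a<..<b}) = G b - G a"
    using lebesgue_integral_eq_integral[OF int] by (simp add: integral_unique)
qed

lemma smooth_L2: "smooth f \<Longrightarrow> f \<in> L2 D"
  by (intro continuous_L2_D smooth_continuous)

lemma test_function_L2: "test_function f \<Longrightarrow> f \<in> L2 D"
  by (intro smooth_L2 test_function_smooth)

lemma L2_D_integrable: "f \<in> L2 D \<Longrightarrow> integrable (lebesgue_on D) f"
  using L2_mult_integrable[of f D "\<lambda>x. 1"] smooth_L2[of "\<lambda>x. 1"] by simp

lemma abs_integral_le_L2_norm:
  assumes "f \<in> L2 D" shows "\<bar>\<integral>x. f x \<partial>lebesgue_on D\<bar> \<le> L2_norm D f"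
proof -
  have "L2_norm D (\<lambda>x. 1) = 1" by (simp add: L2_norm_def L2_inner_def)
  then show ?thesis
    using L2_Cauchy_Schwarz[OF assms, of "\<lambda>x. 1"] smooth_L2[of "\<lambda>x. 1"] by (simp add: L2_inner_def)
qed

lemma L2_inner_indicator_eq_0:
  assumes "g \<in> L2 D" "\<And>\<eta>. test_function \<eta> \<Longrightarrow> L2_inner D g \<eta> = 0" "0 \<le> a" "a < b" "b \<le> 1"
  shows "L2_inner D g (indicator {a<..<b}) = 0"
proof -
  obtain \<eta> :: "nat \<Rightarrow> real \<Rightarrow> real" where \<eta>: "\<And>n. test_function (\<eta> n)" "\<And>n x. 0 \<le> \<eta> n x \<and> \<eta> n x \<le> 1"
    "\<And>x. (\<lambda>n. \<eta> n x) \<longlonglongrightarrow> indicator {a<..<b} x"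
    using indicator_test_function_approx[OF assms(3-5)] by metis
  have meas: "\<eta> n \<in> borel_measurable (lebesgue_on D)" "g \<in> borel_measurable (lebesgue_on D)" for n
    using test_function_L2[OF \<eta>(1)] assms(1) by (auto simp: L2_def)
  have "indicat_real {a<..<b} \<in> borel_measurable (lebesgue_on D)"
    using borel_measurable_LIMSEQ_real[OF \<eta>(3) meas(1)] by simp
  then have "(\<lambda>n. L2_inner D g (\<eta> n)) \<longlonglongrightarrow> L2_inner D g (indicator {a<..<b})"
    unfolding L2_inner_def
  proof (intro integral_dominated_convergence[where w = "\<lambda>x. \<bar>g x\<bar>"])
    show "AE x in lebesgue_on D. norm (g x * \<eta> n x) \<le> \<bar>g x\<bar>" for n
      using \<eta>(2) by (intro AE_I2) (auto simp: abs_mult intro!: mult_left_le)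
  qed (use meas L2_D_integrable[OF assms(1)] in \<open>auto intro!: tendsto_intros \<eta>(3)\<close>)
  then show ?thesis using assms(2)[OF \<eta>(1)] by (simp add: LIMSEQ_const_iff)
qed

text \<open>The sets to test with are those where f is positive or negative, but f is only Lebesgue
  measurable and the hypothesis speaks of Borel sets; hence the detour through a Borel function
  \<open>f'\<close> equal to f almost everywhere. The sign s treats both sets at once.\<close>

lemma AE_zero_of_set_integrals:
  fixes f :: "real \<Rightarrow> real"
  assumes "integrable lebesgue f" "\<And>A. A \<in> sets borel \<Longrightarrow> (\<integral>x. indicator A x * f x \<partial>lebesgue) = 0"
  shows "AE x in lebesgue. f x = 0"
proof -
  obtain f' where f': "f' \<in> borel_measurable lborel" "AE x in lborel. f x = f' x"
    using completion_ex_borel_measurable_real[of f lborel] assms(1) by auto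
  have f'm: "f' \<in> borel_measurable lebesgue" using f'(1) by (simp add: measurable_completion)
  have ae: "AE x in lebesgue. f x = f' x" using f'(2) by (rule AE_completion)
  have int: "integrable lebesgue f'"
    using assms(1) f'm ae by (rule integrable_cong_AE_imp)
  have zero: "(\<integral>x. indicator A x * f' x \<partial>lebesgue) = 0" if "A \<in> sets borel" for A
  proof -
    have "(\<integral>x. indicator A x * f x \<partial>lebesgue) = (\<integral>x. indicator A x * f' x \<partial>lebesgue)"
    proof (rule integral_cong_AE)
      have "indicat_real A \<in> borel_measurable lebesgue"
        using that by (intro borel_measurable_indicator) auto
      then show "(\<lambda>x. indicat_real A x * f x) \<in> borel_measurable lebesgue"
        "(\<lambda>x. indicat_real A x * f' x) \<in> borel_measurable lebesgue"
        using f'm assms(1) by auto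
    qed (use ae in auto)
    then show ?thesis using assms(2)[OF that] by simp
  qed
  have sgn: "AE x in lebesgue. s * f' x \<le> 0" for s :: real
  proof -
    define A where "A = {x. s * f' x > 0}"
    have A: "A \<in> sets borel" using f'(1) unfolding A_def by measurable
    have "(\<integral>x. indicator A x * (s * f' x) \<partial>lebesgue) = 0"
      using zero[OF A] by (simp add: mult.left_commute)
    moreover have "integrable lebesgue (\<lambda>x. indicator A x * (s * f' x))"
      using A int integrable_mult_indicator[of A lebesgue "\<lambda>x. s * f' x"] by simp
    moreover have "0 \<le> indicator A x * (s * f' x)" for x by (auto simp: A_def indicator_def)
    ultimately have "AE x in lebesgue. indicator A x * (s * f' x) = 0"
      by (subst (asm) integral_nonneg_eq_0_iff_AE) auto
    then show ?thesis by eventually_elim (auto simp: A_def indicator_def split: if_splits)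
  qed
  show ?thesis using ae sgn[of 1] sgn[of "-1"] by eventually_elim auto
qed

text \<open>Dynkin's argument: integrals of g over intervals vanish because the indicators are
  limits of test functions, and intervals are stable under intersection and generate the Borel
  sets.\<close>

lemma fundamental_lemma_calculus_of_variations:
  assumes g: "g \<in> L2 D" and test: "\<And>\<eta>. test_function \<eta> \<Longrightarrow> L2_inner D g \<eta> = 0"
  shows "AE x in lebesgue_on D. g x = 0"
proof -
  define f where "f x = indicator D x * g x" for x
  have int: "integrable lebesgue f"
    using L2_D_integrable[OF g] by (simp add: f_def[abs_def] integrable_restrict_space)
  have eq: "(\<integral>x. indicator A x * f x \<partial>lebesgue) = L2_inner D g (indicator A)" for A
    by (simp add: f_def[abs_def] L2_inner_def integral_restrict_space mult.left_commute mult.commute)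
  have inda: "integrable lebesgue (\<lambda>x. indicator A x * f x)" if "A \<in> sets borel" for A
    using int that integrable_mult_indicator[of A lebesgue f] by simp
  have Ioo: "(\<integral>x. indicator {a<..<b} x * f x \<partial>lebesgue) = 0" for a b
  proof (cases "max a 0 < min b 1")
    case True
    have "(\<integral>x. indicator {a<..<b} x * f x \<partial>lebesgue) = L2_inner D g (indicator {a<..<b})" by (rule eq)
    also have "\<dots> = L2_inner D g (indicator {max a 0<..<min b 1})"
      by (rule L2_inner_cong) (auto simp: indicator_def)
    also have "\<dots> = 0" using True by (intro L2_inner_indicator_eq_0 g test) auto
    finally show ?thesis .
  next
    case False
    then have "indicator {a<..<b} x * f x = 0" for x by (auto simp: f_def indicator_def)
    then show ?thesis by (simp only: Bochner_Integration.integral_zero)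
  qed
  have UN: "(\<integral>x. f x \<partial>lebesgue) = 0"
  proof -
    have "(\<integral>x. f x \<partial>lebesgue) = (\<integral>x. indicator {0<..<1} x * f x \<partial>lebesgue)"
      by (intro Bochner_Integration.integral_cong) (auto simp: f_def indicator_def)
    then show ?thesis using Ioo by simp
  qed
  have borel: "sets borel = sigma_sets UNIV (range (\<lambda>(a, b). {a<..<b :: real}))"
    by (subst borel_eq_box) (simp add: case_prod_unfold box_real)
  have "(\<integral>x. indicator A x * f x \<partial>lebesgue) = 0" if "A \<in> sets borel" for A
  proof -
    have "Int_stable (range (\<lambda>(a, b). {a<..<b :: real}))"
    proof (rule Int_stableI)
      fix A B assume "A \<in> range (\<lambda>(a, b). {a<..<b :: real})" "B \<in> range (\<lambda>(a, b). {a<..<b :: real})"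
      then obtain a b c d where "A = {a<..<b}" "B = {c<..<d}" by auto
      then have "A \<inter> B = (\<lambda>(a, b). {a<..<b}) (max a c, min b d)" by auto
      then show "A \<inter> B \<in> range (\<lambda>(a, b). {a<..<b :: real})" by blast
    qed
    moreover have "range (\<lambda>(a, b). {a<..<b :: real}) \<subseteq> Pow UNIV" by simp
    moreover have "A \<in> sigma_sets UNIV (range (\<lambda>(a, b). {a<..<b :: real}))"
      using that borel by simp
    ultimately show ?thesis
    proof (induction rule: sigma_sets_induct_disjoint)
      case (basic A) then show ?case using Ioo by auto
    next
      case (compl A)
      then have A: "A \<in> sets borel"
        using borel by simp
      have "(\<integral>x. indicator (UNIV - A) x * f x \<partial>lebesgue) = (\<integral>x. f x - indicator A x * f x \<partial>lebesgue)"
        by (intro Bochner_Integration.integral_cong) (auto simp: indicator_def)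
      then show ?case using compl UN int inda[OF A] by simp
    next
      case (union A)
      have A: "A i \<in> sets borel" for i
        using union(2) borel by auto
      have "(LINT x:(\<Union>i. A i)|lebesgue. f x) = (\<Sum>i. (LINT x:(A i)|lebesgue. f x))"
        using A union(1) inda[of "\<Union>i. A i"]
        by (intro lebesgue_integral_countable_add) (auto simp: disjoint_family_on_def set_integrable_def)
      then show ?case using union(3) by (simp add: set_lebesgue_integral_def)
    qed simp
  qed
  then have "AE x in lebesgue. f x = 0" by (rule AE_zero_of_set_integrals[OF int])
  then show ?thesis by (auto simp: AE_restrict_space_iff f_def)
qed

section \<open>Weak derivatives\<close>

lemma integral_D_deriv:
  assumes "smooth f" shows "(\<integral>x. deriv f x \<partial>lebesgue_on D) = f 1 - f 0"
  using integral_lebesgue_on_Ioo_FTC(2)[of 0 1 f "deriv f"] smooth_DERIV[OF assms]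
    smooth_continuous[OF smooth_deriv[OF assms]] continuous_on_subset by fastforce

lemma test_function_0_1 [simp]:
  assumes "test_function \<eta>" shows "\<eta> 0 = 0" "\<eta> 1 = 0"
  using assms by (auto elim!: test_functionE)

lemma smooth_ibp:
  assumes "smooth f" "test_function \<eta>"
  shows "L2_inner D f (deriv \<eta>) = - L2_inner D (deriv f) \<eta>"
proof -
  note \<eta> = test_function_smooth[OF assms(2)]
  have "((\<lambda>x. f x * \<eta> x) has_real_derivative deriv f x * \<eta> x + f x * deriv \<eta> x) (at x)" for x
    using smooth_DERIV[OF assms(1)] smooth_DERIV[OF \<eta>] by (auto intro!: derivative_eq_intros)
  then have "deriv (\<lambda>x. f x * \<eta> x) = (\<lambda>x. deriv f x * \<eta> x + f x * deriv \<eta> x)" by (rule deriv_eqI)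
  then have "(\<integral>x. deriv f x * \<eta> x + f x * deriv \<eta> x \<partial>lebesgue_on D) = 0"
    using integral_D_deriv[OF smooth_mult[OF assms(1) \<eta>]] assms(2) by simp
  then show ?thesis
    using L2_mult_integrable[of "deriv f" D \<eta>] L2_mult_integrable[of f D "deriv \<eta>"] assms(1) \<eta>
    by (simp add: L2_inner_def smooth_L2 smooth_deriv)
qed

lemma smooth_is_weak_deriv:
  assumes "smooth f" shows "is_weak_deriv k f ((deriv ^^ k) f)"
proof -
  have "L2_inner D f ((deriv ^^ k) \<eta>) = (-1) ^ k * L2_inner D ((deriv ^^ k) f) \<eta>"
    if "test_function \<eta>" for \<eta>
    using that
  proof (induction k arbitrary: \<eta>)
    case (Suc k)
    have "L2_inner D f ((deriv ^^ Suc k) \<eta>) = (-1) ^ k * L2_inner D ((deriv ^^ k) f) (deriv \<eta>)"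
      using Suc.IH[OF test_function_deriv[OF Suc.prems]] by (simp add: funpow_Suc_right del: funpow.simps)
    then show ?case
      using smooth_ibp[OF smooth_funpow_deriv[OF assms] Suc.prems] by simp
  qed simp
  then show ?thesis by (simp add: is_weak_deriv_def smooth_L2 smooth_funpow_deriv assms)
qed

lemma is_weak_deriv_unique:
  assumes "is_weak_deriv k f g" "is_weak_deriv k f g'"
  shows "AE x in lebesgue_on D. g x = g' x"
proof -
  have g: "g \<in> L2 D" "g' \<in> L2 D" using assms by (auto simp: is_weak_deriv_def)
  have "L2_inner D (\<lambda>x. g x - g' x) \<eta> = 0" if "test_function \<eta>" for \<eta>
  proof -
    have "(-1) ^ k * L2_inner D g \<eta> = (-1 :: real) ^ k * L2_inner D g' \<eta>"
      using assms that unfolding is_weak_deriv_def by metis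
    then show ?thesis using that g by (simp add: L2_inner_diff test_function_L2)
  qed
  then have "AE x in lebesgue_on D. g x - g' x = 0"
    by (intro fundamental_lemma_calculus_of_variations L2_diff g)
  then show ?thesis by eventually_elim simp
qed

lemma is_weak_deriv_lincomb:
  assumes "f1 \<in> L2 D" "f2 \<in> L2 D" "is_weak_deriv k f1 g1" "is_weak_deriv k f2 g2"
  shows "is_weak_deriv k (\<lambda>x. a * f1 x + b * f2 x) (\<lambda>x. a * g1 x + b * g2 x)"
proof -
  have g: "g1 \<in> L2 D" "g2 \<in> L2 D" using assms by (auto simp: is_weak_deriv_def)
  show ?thesis
    using assms g unfolding is_weak_deriv_def
    by (auto simp: L2_lincomb L2_inner_lincomb test_function_L2 test_function_funpow_deriv algebra_simps)
qed

lemma is_weak_deriv_weak_deriv: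
  assumes "f \<in> sobolev s" "k \<le> s" shows "is_weak_deriv k f (weak_deriv k f)"
proof -
  have "\<exists>g. is_weak_deriv k f g" using assms by (auto simp: sobolev_def)
  then show ?thesis unfolding weak_deriv_def by (rule someI_ex)
qed

lemma weak_deriv_L2: "f \<in> sobolev s \<Longrightarrow> k \<le> s \<Longrightarrow> weak_deriv k f \<in> L2 D"
  using is_weak_deriv_weak_deriv by (auto simp: is_weak_deriv_def)

lemma sobolev_L2: "f \<in> sobolev s \<Longrightarrow> f \<in> L2 D"
  by (simp add: sobolev_def)

lemma sobolev_mono: "f \<in> sobolev s \<Longrightarrow> t \<le> s \<Longrightarrow> f \<in> sobolev t"
  by (auto simp: sobolev_def)

lemma sobolev_lincomb:
  assumes "f \<in> sobolev s" "g \<in> sobolev s" shows "(\<lambda>x. a * f x + b * g x) \<in> sobolev s"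
  unfolding sobolev_def
proof (intro CollectI conjI allI impI)
  show "(\<lambda>x. a * f x + b * g x) \<in> L2 D" using assms by (intro L2_lincomb sobolev_L2)
  fix k assume k: "k \<le> s"
  show "\<exists>h. is_weak_deriv k (\<lambda>x. a * f x + b * g x) h"
    using is_weak_deriv_lincomb[OF sobolev_L2[OF assms(1)] sobolev_L2[OF assms(2)]
        is_weak_deriv_weak_deriv[OF assms(1) k] is_weak_deriv_weak_deriv[OF assms(2) k]] by blast
qed

lemma sobolev_diff: "f \<in> sobolev s \<Longrightarrow> g \<in> sobolev s \<Longrightarrow> (\<lambda>x. f x - g x) \<in> sobolev s"
  using sobolev_lincomb[of f s g 1 "-1"] by simp

lemma smooth_sobolev: "smooth f \<Longrightarrow> f \<in> sobolev s"
  unfolding sobolev_def using smooth_is_weak_deriv smooth_L2 by blast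

lemma weak_deriv_AE:
  assumes "f \<in> sobolev s" "k \<le> s" "is_weak_deriv k f g"
  shows "AE x in lebesgue_on D. weak_deriv k f x = g x"
  using is_weak_deriv_unique[OF is_weak_deriv_weak_deriv[OF assms(1,2)] assms(3)] .

lemma weak_deriv_smooth_AE: "smooth f \<Longrightarrow> AE x in lebesgue_on D. weak_deriv k f x = (deriv ^^ k) f x"
  using weak_deriv_AE[OF smooth_sobolev order_refl smooth_is_weak_deriv] .

lemma is_weak_deriv_0: "f \<in> L2 D \<Longrightarrow> is_weak_deriv 0 f f"
  by (simp add: is_weak_deriv_def)

lemma weak_deriv_lincomb_AE:
  assumes "f \<in> sobolev s" "g \<in> sobolev s" "k \<le> s"
  shows "AE x in lebesgue_on D. weak_deriv k (\<lambda>x. a * f x + b * g x) x = a * weak_deriv k f x + b * weak_deriv k g x"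
  using assms by (intro weak_deriv_AE[OF sobolev_lincomb[OF assms(1,2)] assms(3)] is_weak_deriv_lincomb
      is_weak_deriv_weak_deriv[OF assms(1,3)] is_weak_deriv_weak_deriv[OF assms(2,3)]) (auto intro: sobolev_L2)

text \<open>\<open>weak_deriv\<close> is a choice of representative and thus linear only almost
  everywhere. Paired with an \<open>L2\<close> function this becomes an exact identity, the form in
  which linearity is used from here on.\<close>

lemma L2_inner_weak_deriv_lincomb:
  assumes "f \<in> sobolev s" "g \<in> sobolev s" "k \<le> s" "u \<in> L2 D"
  shows "L2_inner D (weak_deriv k (\<lambda>x. a * f x + b * g x)) u
      = a * L2_inner D (weak_deriv k f) u + b * L2_inner D (weak_deriv k g) u"
proof -
  have "L2_inner D (weak_deriv k (\<lambda>x. a * f x + b * g x)) u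
      = L2_inner D (\<lambda>x. a * weak_deriv k f x + b * weak_deriv k g x) u"
    using assms
    by (intro L2_inner_cong_AE weak_deriv_lincomb_AE L2_lincomb weak_deriv_L2[OF sobolev_lincomb]
        weak_deriv_L2) auto
  then show ?thesis using assms by (simp add: L2_inner_lincomb weak_deriv_L2)
qed

lemma is_weak_deriv_cong:
  assumes "\<And>x. x \<in> D \<Longrightarrow> f x = f' x"
  shows "is_weak_deriv k f g \<longleftrightarrow> is_weak_deriv k f' g"
proof -
  have "L2_inner D f h = L2_inner D f' h" for h using assms by (intro L2_inner_cong) auto
  then show ?thesis by (simp add: is_weak_deriv_def)
qed

text \<open>Functions that agree on \<open>D\<close> have the same set of weak derivatives, so
  Hilbert choice picks the same element: the equality holds everywhere and not only almost
  everywhere.\<close>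

lemma weak_deriv_cong:
  assumes "\<And>x. x \<in> D \<Longrightarrow> f x = f' x" shows "weak_deriv k f = weak_deriv k f'"
  unfolding weak_deriv_def using is_weak_deriv_cong[OF assms] by presburger

lemma sobolev_norm_ge_0: "0 \<le> sobolev_norm s f"
  by (simp add: sobolev_norm_def sum_nonneg)

lemma weak_deriv_le_sobolev_norm:
  assumes "k \<le> s" shows "L2_norm D (weak_deriv k f) \<le> sobolev_norm s f"
proof -
  have "(L2_norm D (weak_deriv k f))\<^sup>2 \<le> (\<Sum>k\<le>s. (L2_norm D (weak_deriv k f))\<^sup>2)"
    using assms by (intro member_le_sum) auto
  then show ?thesis unfolding sobolev_norm_def using real_le_rsqrt by blast
qed

lemma L2_norm_le_sobolev_norm:
  assumes "f \<in> sobolev s" shows "L2_norm D f \<le> sobolev_norm s f"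
proof -
  have "L2_norm D (weak_deriv 0 f) = L2_norm D f"
    using assms by (intro L2_norm_cong_AE weak_deriv_L2 weak_deriv_AE is_weak_deriv_0) (auto intro: sobolev_L2)
  then show ?thesis using weak_deriv_le_sobolev_norm[of 0 s f] by simp
qed

lemma sobolev_norm_diff_le:
  assumes "f \<in> sobolev s" "g \<in> sobolev s"
  shows "sobolev_norm s (\<lambda>x. f x - g x) \<le> sobolev_norm s f + sobolev_norm s g"
proof -
  have "L2_norm D (weak_deriv k (\<lambda>x. f x - g x)) \<le> L2_norm D (weak_deriv k f) + L2_norm D (weak_deriv k g)"
    if k: "k \<le> s" for k
  proof -
    note w = weak_deriv_L2[OF assms(1) k] weak_deriv_L2[OF assms(2) k]
    have "L2_norm D (weak_deriv k (\<lambda>x. f x - g x)) = L2_norm D (\<lambda>x. weak_deriv k f x + (-1) * weak_deriv k g x)"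
      using weak_deriv_lincomb_AE[OF assms k, of 1 "-1"] w
      by (intro L2_norm_cong_AE weak_deriv_L2[OF sobolev_diff[OF assms] k] L2_add L2_cmult) auto
    also have "\<dots> \<le> L2_norm D (weak_deriv k f) + L2_norm D (\<lambda>x. (-1) * weak_deriv k g x)"
      by (intro L2_norm_triangle L2_cmult w)
    finally show ?thesis by (simp only: L2_norm_cmult abs_minus_cancel abs_one mult_1)
  qed
  then have "sobolev_norm s (\<lambda>x. f x - g x)
      \<le> sqrt (\<Sum>k\<le>s. (L2_norm D (weak_deriv k f) + L2_norm D (weak_deriv k g))\<^sup>2)"
    unfolding sobolev_norm_def by (intro real_sqrt_le_mono sum_mono power_mono) auto
  also have "\<dots> \<le> sobolev_norm s f + sobolev_norm s g"
    using L2_set_triangle_ineq[of "\<lambda>k. L2_norm D (weak_deriv k f)" "\<lambda>k. L2_norm D (weak_deriv k g)" "{..s}"]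
    by (simp add: L2_set_def sobolev_norm_def)
  finally show ?thesis .
qed

lemma sobolev_norm_smooth_le:
  assumes "smooth f" "\<And>k. k \<le> s \<Longrightarrow> L2_norm D ((deriv ^^ k) f) \<le> B"
  shows "sobolev_norm s f \<le> sqrt (real (s + 1)) * B"
proof -
  have B: "0 \<le> B" using assms(2)[of 0] L2_norm_ge_0 order_trans by blast
  have "L2_norm D (weak_deriv k f) \<le> B" if "k \<le> s" for k
  proof -
    have L2: "(deriv ^^ k) f \<in> L2 D" by (intro smooth_L2 smooth_funpow_deriv assms)
    have "L2_norm D (weak_deriv k f) = L2_norm D ((deriv ^^ k) f)"
      using that assms(1)
      by (intro L2_norm_cong_AE weak_deriv_smooth_AE weak_deriv_L2[OF smooth_sobolev order_refl] L2) auto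
    then show ?thesis using assms(2)[OF that] by simp
  qed
  then have "(\<Sum>k\<le>s. (L2_norm D (weak_deriv k f))\<^sup>2) \<le> (\<Sum>k\<le>s. B\<^sup>2)"
    by (intro sum_mono power_mono) auto
  then have "sobolev_norm s f \<le> sqrt (real (s + 1) * B\<^sup>2)"
    unfolding sobolev_norm_def by (intro real_sqrt_le_mono) simp
  then show ?thesis using B by (simp add: real_sqrt_mult)
qed

section \<open>Antiderivatives, zero boundary values and integration by parts\<close>

lemma antiderivative_exists:
  fixes g :: "real \<Rightarrow> real"
  assumes "\<And>x. isCont g x"
  obtains G where "G 0 = 0" "\<And>x. (G has_real_derivative g x) (at x)"
proof -
  obtain F where F: "\<And>x. (F has_vector_derivative g x) (at x)"
    using einterval_antiderivative[of "-\<infinity>" "\<infinity>" g] assms by auto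
  have "((\<lambda>x. F x - F 0) has_real_derivative g x) (at x)" for x
    using F[of x] by (auto intro!: derivative_eq_intros simp: has_real_derivative_iff_has_vector_derivative)
  then show ?thesis using that[of "\<lambda>x. F x - F 0"] by simp
qed

lemma smooth_antiderivative:
  assumes "smooth g"
  obtains G where "smooth G" "G 0 = 0" "deriv G = g"
proof -
  have "isCont g x" for x
    using smooth_continuous[OF assms] by (simp add: continuous_on_eq_continuous_at)
  then obtain G where G: "G 0 = 0" "\<And>x. (G has_real_derivative g x) (at x)"
    using antiderivative_exists by blast
  show ?thesis
    using that[of G] smooth_DERIV_intro[OF G(2) assms] deriv_eqI[OF G(2)] G(1) by simp
qed

text \<open>The antiderivative that starts at 0 vanishes to the left of the support of g. The zero
  mean gives \<open>G 1 = 0\<close>, which makes it vanish to the right as well.\<close>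

lemma test_function_antiderivative:
  assumes "test_function g" "(\<integral>x. g x \<partial>lebesgue_on D) = 0"
  obtains G where "test_function G" "deriv G = g"
proof -
  obtain a b where ab: "0 < a" "a < b" "b < 1" "\<And>x. x \<notin> {a..b} \<Longrightarrow> g x = 0"
    using assms(1) by (rule test_functionE) blast
  obtain G where G: "smooth G" "G 0 = 0" "deriv G = g"
    using smooth_antiderivative[OF test_function_smooth[OF assms(1)]] by blast
  have D: "(G has_real_derivative g x) (at x)" for x using smooth_DERIV[OF G(1)] G(3) by simp
  have cont: "continuous_on A G" for A using smooth_continuous[OF G(1)] continuous_on_subset by blast
  have G1: "G 1 = 0" using integral_D_deriv[OF G(1)] G assms(2) by simp
  have const: "G u = G v" if "u \<le> v" "\<And>x. u < x \<Longrightarrow> x < v \<Longrightarrow> g x = 0" for u v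
  proof (cases "u = v")
    case False
    then show ?thesis
      using that D by (intro DERIV_isconst_end[symmetric] cont) (auto, metis)
  qed simp
  have "G x = 0" if "x \<notin> {a..b}" for x
  proof (cases "x < a")
    case True
    show ?thesis
    proof (cases "x \<le> 0")
      case True
      then have "G x = G 0" using ab by (intro const) auto
      then show ?thesis using G by simp
    next
      case False
      then have "G 0 = G x" using \<open>x < a\<close> by (intro const ab(4)) auto
      then show ?thesis using G by simp
    qed
  next
    case False
    then have xb: "b < x" using that by auto
    show ?thesis
    proof (cases "x \<le> 1")
      case True
      then have "G x = G 1" using ab xb by (intro const ab(4)) auto
      then show ?thesis using G1 by simp
    next
      case False
      then have "G 1 = G x" using ab(3) by (intro const ab(4)) auto
      then show ?thesis using G1 by simp
    qed
  qed
  then have "test_function G" using ab G(1) by (intro test_functionI[of G a b]) auto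
  then show ?thesis using that G(3) by blast
qed

text \<open>Write f x as the integral of its derivative over (0, x) and apply Cauchy-Schwarz with
  the indicator of that interval, whose norm is at most 1.\<close>

lemma smooth_abs_le_L2_norm_deriv:
  assumes "smooth f" "f 0 = 0" "x \<in> D" shows "\<bar>f x\<bar> \<le> L2_norm D (deriv f)"
proof -
  have x: "0 < x" "x < 1" using assms(3) by auto
  have f': "deriv f \<in> L2 D" by (intro smooth_L2 smooth_deriv assms)
  have ind: "indicat_real {0<..<x} \<in> borel_measurable (lebesgue_on D)"
    using x by (intro borel_measurable_indicator) (auto simp: sets_restrict_space_iff)
  have b: "indicat_real {0<..<x} \<in> L2 D" "L2_norm D (indicat_real {0<..<x}) \<le> 1"
    using bounded_L2_D[OF ind, of 1] by (auto simp: indicator_def)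
  have "f x = f x - f 0" using assms by simp
  also have "\<dots> = (\<integral>y. deriv f y \<partial>lebesgue_on {0<..<x})"
    using integral_lebesgue_on_Ioo_FTC(2)[of 0 x f "deriv f"] smooth_DERIV[OF assms(1)]
      smooth_continuous[OF smooth_deriv[OF assms(1)]] x continuous_on_subset by fastforce
  also have "\<dots> = L2_inner D (indicator {0<..<x}) (deriv f)"
    unfolding L2_inner_def using x
    by (simp add: integral_restrict_space) (intro Bochner_Integration.integral_cong, auto simp: indicator_def)
  finally have "\<bar>f x\<bar> \<le> L2_norm D (indicat_real {0<..<x}) * L2_norm D (deriv f)"
    using L2_Cauchy_Schwarz[OF b(1) f'] by simp
  also have "\<dots> \<le> 1 * L2_norm D (deriv f)" by (intro mult_right_mono b) auto
  finally show ?thesis by simp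
qed

lemma smooth_test_function_approx:
  assumes "smooth f" "0 < e"
  obtains \<eta> where "test_function \<eta>" "L2_norm D (\<lambda>x. f x - \<eta> x) < e"
proof -
  obtain \<eta> :: "nat \<Rightarrow> real \<Rightarrow> real" where \<eta>: "\<And>n. test_function (\<eta> n)" "\<And>n x. 0 \<le> \<eta> n x \<and> \<eta> n x \<le> 1"
    "\<And>x. (\<lambda>n. \<eta> n x) \<longlonglongrightarrow> indicator {0<..<1} x"
    using indicator_test_function_approx[of 0 1] by auto
  define g where "g n x = f x * \<eta> n x" for n x
  have g: "test_function (g n)" for n
    unfolding g_def[abs_def] by (intro test_function_mult assms \<eta>)
  have L2: "(\<lambda>x. f x - g n x) \<in> L2 D" "f \<in> L2 D" for n
    by (intro L2_diff smooth_L2[OF assms(1)] test_function_L2[OF g])+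
  have "(\<lambda>n. L2_inner D (\<lambda>x. f x - g n x) (\<lambda>x. f x - g n x)) \<longlonglongrightarrow> L2_inner D (\<lambda>x. 0) (\<lambda>x. 0)"
    unfolding L2_inner_def
  proof (rule integral_dominated_convergence[where w = "\<lambda>x. f x * f x"])
    show "AE x in lebesgue_on D. (\<lambda>n. (f x - g n x) * (f x - g n x)) \<longlonglongrightarrow> 0 * 0"
    proof (intro AE_I2 tendsto_intros)
      fix x assume "x \<in> space (lebesgue_on D)"
      then have "(\<lambda>n. f x - g n x) \<longlonglongrightarrow> f x - f x * 1"
        unfolding g_def using \<eta>(3)[of x] by (intro tendsto_intros) auto
      then show "(\<lambda>n. f x - g n x) \<longlonglongrightarrow> 0" by simp
      then show "(\<lambda>n. f x - g n x) \<longlonglongrightarrow> 0" .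
    qed
    show "AE x in lebesgue_on D. norm ((f x - g n x) * (f x - g n x)) \<le> f x * f x" for n
    proof (intro AE_I2)
      fix x
      have "f x - g n x = f x * (1 - \<eta> n x)" by (simp add: g_def algebra_simps)
      moreover have "\<bar>1 - \<eta> n x\<bar> \<le> 1" using \<eta>(2)[of n x] by auto
      ultimately have "\<bar>f x - g n x\<bar> \<le> \<bar>f x\<bar>" by (simp add: abs_mult mult_left_le)
      then show "norm ((f x - g n x) * (f x - g n x)) \<le> f x * f x"
        by (simp add: abs_mult) (metis abs_ge_zero abs_mult_self_eq mult_mono)
    qed
    have "(\<lambda>x. f x - g n x) \<in> borel_measurable (lebesgue_on D)" for n
      using L2(1)[of n] by (simp add: L2_def)
    then show "(\<lambda>x. (f x - g n x) * (f x - g n x)) \<in> borel_measurable (lebesgue_on D)" for n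
      by (intro borel_measurable_times)
  qed (use L2_mult_integrable[OF L2(2) L2(2)] in auto)
  then have "(\<lambda>n. L2_inner D (\<lambda>x. f x - g n x) (\<lambda>x. f x - g n x)) \<longlonglongrightarrow> 0" by simp
  then have "(\<lambda>n. L2_norm D (\<lambda>x. f x - g n x)) \<longlonglongrightarrow> 0"
    unfolding L2_norm_def using tendsto_real_sqrt by fastforce
  then have "\<forall>\<^sub>F n in sequentially. L2_norm D (\<lambda>x. f x - g n x) < e"
    using assms(2) by (rule order_tendstoD)
  then obtain n where "L2_norm D (\<lambda>x. f x - g n x) < e" by (auto simp: eventually_sequentially)
  then show ?thesis using that g by blast
qed

text \<open>Approximate \<open>f'\<close>, whose mean vanishes, by test functions in \<open>L\<^sup>2(D)\<close>, correct their mean and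
  integrate.\<close>

lemma smooth_sobolev_0_1:
  assumes f: "smooth f" and f0: "f 0 = 0" and f1: "f 1 = 0"
  shows "f \<in> sobolev_0_1"
proof -
  have "\<exists>\<eta>. test_function \<eta> \<and> sobolev_norm 1 (\<lambda>x. f x - \<eta> x) < e" if e: "0 < e" for e
  proof -
    \<comment> \<open>Being at distance less than 1 from the constant 1 forces a positive mean. So
      \<open>g1\<close> can be scaled to a test function \<open>g0\<close> of mean one, the device
      for correcting means.\<close>
    obtain g1 where g1: "test_function g1" "L2_norm D (\<lambda>x. 1 - g1 x) < 1"
      using smooth_test_function_approx[of "\<lambda>x. 1" 1] by auto
    define m where "m = (\<integral>x. g1 x \<partial>lebesgue_on D)"
    have "\<bar>\<integral>x. 1 - g1 x \<partial>lebesgue_on D\<bar> < 1"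
      using abs_integral_le_L2_norm[OF L2_diff[OF smooth_L2[OF smooth_const[of 1]] test_function_L2[OF g1(1)]]] g1(2)
      by simp
    then have "\<bar>1 - m\<bar> < 1"
      using L2_D_integrable[OF test_function_L2[OF g1(1)]] L2_D_integrable[OF smooth_L2[OF smooth_const[of 1]]]
      by (simp add: m_def)
    then have m: "0 < m" by auto
    define g0 where "g0 x = (1 / m) * g1 x + 0 * g1 x" for x
    have g0: "test_function g0" unfolding g0_def[abs_def] by (intro test_function_lincomb g1)
    have g0_int: "(\<integral>x. g0 x \<partial>lebesgue_on D) = 1" using m by (simp add: g0_def m_def)
    \<comment> \<open>Correcting the mean costs the factor 1 plus the norm of \<open>g0\<close>. The
      2 pays for the step from the derivative to the full norm, the function being bounded by its
      derivative.\<close>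
    define K where "K = 2 * (1 + L2_norm D g0)"
    have K: "0 < K" using L2_norm_ge_0[of D g0] by (simp add: K_def add_pos_nonneg)
    obtain g where g: "test_function g" "L2_norm D (\<lambda>x. deriv f x - g x) < e / K"
      using smooth_test_function_approx[OF smooth_deriv[OF f], of "e / K"] e K by auto
    define mg where "mg = (\<integral>x. g x \<partial>lebesgue_on D)"
    have f'L2: "deriv f \<in> L2 D" by (intro smooth_L2 smooth_deriv f)
    have "(\<integral>x. deriv f x - g x \<partial>lebesgue_on D) = - mg"
      using L2_D_integrable[OF f'L2] L2_D_integrable[OF test_function_L2[OF g(1)]] integral_D_deriv[OF f] f0 f1
      by (simp add: mg_def)
    then have mg: "\<bar>mg\<bar> \<le> L2_norm D (\<lambda>x. deriv f x - g x)"
      using abs_integral_le_L2_norm[OF L2_diff[OF f'L2 test_function_L2[OF g(1)]]] by simp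
    have tf: "test_function (\<lambda>x. 1 * g x + (- mg) * g0 x)" by (intro test_function_lincomb g g0)
    have "(\<integral>x. 1 * g x + (- mg) * g0 x \<partial>lebesgue_on D) = 0"
      using L2_D_integrable[OF test_function_L2[OF g0]] L2_D_integrable[OF test_function_L2[OF g(1)]] g0_int
      by (simp add: mg_def)
    then obtain \<eta> where \<eta>: "test_function \<eta>" "deriv \<eta> = (\<lambda>x. 1 * g x + (- mg) * g0 x)"
      using test_function_antiderivative[OF tf] by blast
    define u where "u x = f x - \<eta> x" for x
    have u: "smooth u" unfolding u_def[abs_def] by (intro smooth_diff f test_function_smooth \<eta>)
    have u': "deriv u = (\<lambda>x. (deriv f x - g x) + mg * g0 x)"
    proof (rule deriv_eqI)
      fix x
      have "(u has_real_derivative deriv f x - deriv \<eta> x) (at x)"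
        unfolding u_def[abs_def] by (intro derivative_intros smooth_DERIV f test_function_smooth \<eta>)
      then show "(u has_real_derivative (deriv f x - g x) + mg * g0 x) (at x)" by (simp add: \<eta> algebra_simps)
    qed
    have "L2_norm D (deriv u) \<le> L2_norm D (\<lambda>x. deriv f x - g x) + \<bar>mg\<bar> * L2_norm D g0"
      unfolding u' using L2_norm_triangle[of "\<lambda>x. deriv f x - g x" D "\<lambda>x. mg * g0 x"] f'L2 g(1) g0
      by (simp add: L2_diff L2_cmult test_function_L2)
    also have "\<dots> \<le> L2_norm D (\<lambda>x. deriv f x - g x) + L2_norm D (\<lambda>x. deriv f x - g x) * L2_norm D g0"
      by (intro add_left_mono mult_right_mono mg) simp
    also have "\<dots> = L2_norm D (\<lambda>x. deriv f x - g x) * (K / 2)" by (simp add: K_def algebra_simps)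
    also have "\<dots> < e / K * (K / 2)" using K by (intro mult_strict_right_mono g) auto
    also have "\<dots> = e / 2" using K by simp
    finally have du: "L2_norm D (deriv u) < e / 2" .
    have "u \<in> borel_measurable (lebesgue_on D)" using smooth_L2[OF u] by (simp add: L2_def)
    then have "L2_norm D u \<le> L2_norm D (deriv u)"
      using smooth_abs_le_L2_norm_deriv[OF u] f0 \<eta>(1) by (intro bounded_L2_D) (auto simp: u_def)
    moreover have "L2_norm D (weak_deriv 0 u) = L2_norm D u" "L2_norm D (weak_deriv 1 u) = L2_norm D (deriv u)"
      using weak_deriv_smooth_AE[OF u, of 0] weak_deriv_smooth_AE[OF u, of 1] smooth_L2[OF u]
        smooth_L2[OF smooth_deriv[OF u]] weak_deriv_L2[OF smooth_sobolev[OF u] order_refl]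
      by (auto intro!: L2_norm_cong_AE)
    ultimately have "(\<Sum>k\<le>1. (L2_norm D (weak_deriv k u))\<^sup>2) \<le> (L2_norm D (deriv u))\<^sup>2 + (L2_norm D (deriv u))\<^sup>2"
      by (simp add: power_mono)
    also have "\<dots> \<le> (2 * L2_norm D (deriv u))\<^sup>2" by (simp add: power_mult_distrib)
    finally have "sobolev_norm 1 u \<le> 2 * L2_norm D (deriv u)"
      unfolding sobolev_norm_def by (intro real_le_lsqrt) auto
    then have "sobolev_norm 1 u < e" using du by simp
    then show ?thesis using \<eta>(1) by (auto simp: u_def[abs_def])
  qed
  then show ?thesis unfolding sobolev_0_1_def using smooth_sobolev[OF f] by blast
qed

text \<open>For a test function g this follows from the definition of weak derivatives. Both sides
  are continuous in g for the H^1 norm, and \<open>sobolev_0_1\<close> is the closure of the test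
  functions in that norm.\<close>

lemma weak_ibp:
  assumes f: "f \<in> sobolev 2" and g: "g \<in> sobolev_0_1"
  shows "L2_inner D (weak_deriv 2 f) g = - L2_inner D (weak_deriv 1 f) (weak_deriv 1 g)"
proof -
  define d where "d = \<bar>L2_inner D (weak_deriv 2 f) g + L2_inner D (weak_deriv 1 f) (weak_deriv 1 g)\<bar>"
  have w: "weak_deriv 2 f \<in> L2 D" "weak_deriv 1 f \<in> L2 D" using f by (auto intro: weak_deriv_L2)
  have gs: "g \<in> sobolev 1" using g by (simp add: sobolev_0_1_def)
  define B where "B = L2_norm D (weak_deriv 2 f) + L2_norm D (weak_deriv 1 f)"
  have le: "d \<le> B * e" if e: "0 < e" for e
  proof -
    obtain \<eta> where \<eta>: "test_function \<eta>" "sobolev_norm 1 (\<lambda>x. g x - \<eta> x) < e"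
      using g e unfolding sobolev_0_1_def by blast
    note s\<eta> = test_function_smooth[OF \<eta>(1)]
    have \<eta>s: "\<eta> \<in> sobolev 1" by (intro smooth_sobolev s\<eta>)
    define u where "u x = g x - \<eta> x" for x
    have u: "u \<in> sobolev 1" unfolding u_def[abs_def] by (intro sobolev_diff gs \<eta>s)
    have "(deriv ^^ 2) \<eta> = (deriv ^^ 1) (deriv \<eta>)" by (simp add: numeral_2_eq_2)
    then have "L2_inner D (weak_deriv 2 f) \<eta> = L2_inner D f ((deriv ^^ 1) (deriv \<eta>))"
      using is_weak_deriv_weak_deriv[OF f, of 2] \<eta>(1) by (auto simp: is_weak_deriv_def)
    also have "\<dots> = - L2_inner D (weak_deriv 1 f) (deriv \<eta>)"
      using is_weak_deriv_weak_deriv[OF f, of 1] test_function_deriv[OF \<eta>(1)] by (auto simp: is_weak_deriv_def)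
    also have "L2_inner D (weak_deriv 1 f) (deriv \<eta>) = L2_inner D (weak_deriv 1 f) (weak_deriv 1 \<eta>)"
    proof (rule L2_inner_cong_AE(2))
      show "AE x in lebesgue_on D. deriv \<eta> x = weak_deriv 1 \<eta> x"
        using weak_deriv_smooth_AE[OF s\<eta>, of 1] by (simp add: eq_commute)
    qed (use w weak_deriv_L2[OF \<eta>s] smooth_L2[OF smooth_deriv[OF s\<eta>]] in auto)
    finally have test: "L2_inner D (weak_deriv 2 f) \<eta> = - L2_inner D (weak_deriv 1 f) (weak_deriv 1 \<eta>)" .
    have 1: "L2_inner D (weak_deriv 2 f) u = L2_inner D (weak_deriv 2 f) g - L2_inner D (weak_deriv 2 f) \<eta>"
      unfolding u_def[abs_def] using w gs test_function_L2[OF \<eta>(1)] by (intro L2_inner_diff) (auto intro: sobolev_L2)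
    have 2: "L2_inner D (weak_deriv 1 f) (weak_deriv 1 u)
        = L2_inner D (weak_deriv 1 f) (weak_deriv 1 g) - L2_inner D (weak_deriv 1 f) (weak_deriv 1 \<eta>)"
      using L2_inner_weak_deriv_lincomb[OF gs \<eta>s order_refl w(2), of 1 "-1"]
      by (simp add: u_def[abs_def] L2_inner_commute)
    have n: "L2_norm D u \<le> e" "L2_norm D (weak_deriv 1 u) \<le> e"
      using L2_norm_le_sobolev_norm[OF u] weak_deriv_le_sobolev_norm[of 1 1 u] \<eta>(2)
      by (auto simp: u_def[abs_def])
    have "\<bar>L2_inner D (weak_deriv 2 f) u\<bar> \<le> L2_norm D (weak_deriv 2 f) * e"
      using L2_Cauchy_Schwarz[OF w(1) sobolev_L2[OF u]] mult_left_mono[OF n(1) L2_norm_ge_0[of D "weak_deriv 2 f"]]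
      by linarith
    moreover have "\<bar>L2_inner D (weak_deriv 1 f) (weak_deriv 1 u)\<bar> \<le> L2_norm D (weak_deriv 1 f) * e"
      using L2_Cauchy_Schwarz[OF w(2) weak_deriv_L2[OF u order_refl]]
        mult_left_mono[OF n(2) L2_norm_ge_0[of D "weak_deriv 1 f"]]
      by linarith
    ultimately show ?thesis unfolding d_def B_def distrib_right using 1 2 test by linarith
  qed
  have "d \<le> 0"
  proof (rule field_le_epsilon)
    fix e :: real assume e: "0 < e"
    have "0 \<le> B" by (simp add: B_def)
    then have "B * (e / (B + 1)) \<le> e" using e by (simp add: divide_le_eq mult.commute)
    then show "d \<le> 0 + e" using le[of "e / (B + 1)"] e \<open>0 \<le> B\<close> by simp
  qed
  then show ?thesis by (simp add: d_def)
qed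

lemma weak_laplacian_symmetric:
  assumes "f \<in> sobolev 2" "f \<in> sobolev_0_1" "g \<in> sobolev 2" "g \<in> sobolev_0_1"
  shows "L2_inner D (weak_deriv 2 f) g = L2_inner D f (weak_deriv 2 g)"
  using weak_ibp[OF assms(1,4)] weak_ibp[OF assms(3,2)] by (simp add: L2_inner_commute)

section \<open>The finite element space\<close>

text \<open>Seen on X alone, S has dimension at most the number of points. A further point y calls
  for a further function only if some element of S vanishes on X but not at y; that element then
  corrects the value at y without disturbing X.\<close>

lemma finite_evaluation_spanning:
  fixes S :: "(real \<Rightarrow> real) set"
  assumes lin: "\<And>f g a b. f \<in> S \<Longrightarrow> g \<in> S \<Longrightarrow> (\<lambda>x. a * f x + b * g x) \<in> S"
    and "finite X" and zero: "(\<lambda>x. 0) \<in> S"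
  shows "\<exists>n b. (\<forall>i<n. b i \<in> S) \<and> (\<forall>f\<in>S. \<exists>c. \<forall>x\<in>X. f x = (\<Sum>i<(n::nat). c i * b i x))"
  using assms(2)
proof induction
  case empty
  show ?case by (intro exI[of _ 0]) simp
next
  case (insert y X)
  then obtain n b where b: "\<And>i. i < n \<Longrightarrow> b i \<in> S"
    "\<And>f. f \<in> S \<Longrightarrow> \<exists>c. \<forall>x\<in>X. f x = (\<Sum>i<(n::nat). c i * b i x)"
    by blast
  have sumS: "(\<lambda>x. \<Sum>i<m. c i * b i x) \<in> S" if "m \<le> n" for c m
    using that
  proof (induction m)
    case 0 then show ?case by (simp add: zero)
  next
    case (Suc m)
    then show ?case using lin[of "\<lambda>x. \<Sum>i<m. c i * b i x" "b m" 1 "c m"] b(1)[of m] by simp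
  qed
  show ?case
  proof (cases "\<forall>g\<in>S. (\<forall>x\<in>X. g x = 0) \<longrightarrow> g y = 0")
    case True
    have "\<exists>c. \<forall>x\<in>insert y X. f x = (\<Sum>i<n. c i * b i x)" if f: "f \<in> S" for f
    proof -
      obtain c where c: "\<forall>x\<in>X. f x = (\<Sum>i<n. c i * b i x)" using b(2)[OF f] by blast
      have "(\<lambda>x. 1 * f x + (-1) * (\<Sum>i<n. c i * b i x)) \<in> S" using f sumS by (intro lin) auto
      then have "f y = (\<Sum>i<n. c i * b i y)" using True c by fastforce
      then show ?thesis using c by auto
    qed
    then show ?thesis using b(1) by blast
  next
    case False
    then obtain g where g: "g \<in> S" "\<And>x. x \<in> X \<Longrightarrow> g x = 0" "g y \<noteq> 0" by blast
    define b' where "b' = b(n := g)"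
    have "\<exists>c. \<forall>x\<in>insert y X. f x = (\<Sum>i<Suc n. c i * b' i x)" if f: "f \<in> S" for f
    proof -
      obtain c where c: "\<forall>x\<in>X. f x = (\<Sum>i<n. c i * b i x)" using b(2)[OF f] by blast
      define c' where "c' = c(n := (f y - (\<Sum>i<n. c i * b i y)) / g y)"
      have "(\<Sum>i<Suc n. c' i * b' i x) = (\<Sum>i<n. c i * b i x) + (f y - (\<Sum>i<n. c i * b i y)) / g y * g x" for x
        by (simp add: b'_def c'_def)
      then show ?thesis using c g by (intro exI[of _ c']) auto
    qed
    moreover have "\<forall>i<Suc n. b' i \<in> S" using b(1) g(1) by (auto simp: b'_def less_Suc_eq)
    ultimately show ?thesis by blast
  qed
qed

lemma partition_covers:
  fixes z :: "nat \<Rightarrow> real"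
  assumes "z 0 \<le> x" "x \<le> z J" "0 < J"
  shows "\<exists>j<J. x \<in> {z j..z (Suc j)}"
  using assms(2,3)
proof (induction J)
  case (Suc J)
  show ?case
  proof (cases "x \<le> z J \<and> 0 < J")
    case True
    then show ?thesis using Suc.IH by (meson less_SucI)
  next
    case False
    then show ?thesis using Suc.prems assms(1) by (intro exI[of _ J]) (cases "J = 0", auto)
  qed
qed simp

lemma fe_spaceD:
  assumes "fe_space r h S"
  shows "f \<in> S \<Longrightarrow> f \<in> sobolev 2" "f \<in> S \<Longrightarrow> f \<in> sobolev_0_1" "(\<lambda>x. 0) \<in> S"
    "f \<in> S \<Longrightarrow> g \<in> S \<Longrightarrow> (\<lambda>x. a * f x + b * g x) \<in> S"
  using assms by (auto simp: fe_space_def)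

lemma fe_space_L2: "fe_space r h S \<Longrightarrow> f \<in> S \<Longrightarrow> f \<in> L2 D"
  using fe_spaceD(1) sobolev_L2 by blast

lemma fe_space_cmult: "fe_space r h S \<Longrightarrow> f \<in> S \<Longrightarrow> (\<lambda>x. a * f x) \<in> S"
  using fe_spaceD(4)[of r h S f f a 0] by simp

lemma fe_space_add: "fe_space r h S \<Longrightarrow> f \<in> S \<Longrightarrow> g \<in> S \<Longrightarrow> (\<lambda>x. f x + g x) \<in> S"
  using fe_spaceD(4)[of r h S f g 1 1] by simp

lemma fe_space_diff: "fe_space r h S \<Longrightarrow> f \<in> S \<Longrightarrow> g \<in> S \<Longrightarrow> (\<lambda>x. f x - g x) \<in> S"
  using fe_spaceD(4)[of r h S f g 1 "-1"] by simp

lemma fe_space_sum: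
  assumes "fe_space r h S" "\<And>i. i \<in> A \<Longrightarrow> f i \<in> S"
  shows "(\<lambda>x. \<Sum>i\<in>A. c i * f i x) \<in> S"
  using assms(2)
  by (induction A rule: infinite_finite_induct)
    (auto intro!: fe_space_add[OF assms(1)] fe_space_cmult[OF assms(1)] fe_spaceD(3)[OF assms(1)])

lemma fe_space_mesh:
  assumes "fe_space r h S" shows "0 < h" "h \<le> 1"
proof -
  obtain J z where J: "J \<ge> 1" "z 0 = 0" "z J = 1" "\<And>j. j < J \<Longrightarrow> z j < z (Suc j)"
    "h = Max ((\<lambda>j. z (Suc j) - z j) ` {..<J})"
    using assms by (auto simp: fe_space_def)
  have inc: "z i \<le> z j" if "i \<le> j" "j \<le> J" for i j
    using that
  proof (induction j rule: dec_induct)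
    case (step j)
    then show ?case using J(4)[of j] by simp
  qed simp
  have "z (Suc j) - z j \<le> 1" if "j < J" for j
    using inc[of 0 j] inc[of "Suc j" J] that J(2,3) by auto
  moreover have ne: "(\<lambda>j. z (Suc j) - z j) ` {..<J} \<noteq> {}"
    using J(1) by (simp add: lessThan_empty_iff)
  ultimately show "h \<le> 1" by (subst J(5), subst Max_le_iff) auto
  have "0 < z (Suc 0) - z 0" using J(1,4) by simp
  then show "0 < h" using J(1) ne by (subst J(5), subst Max_gr_iff) auto
qed

text \<open>Elements of S are functions on the whole line, and \<open>fe_space\<close> restricts
  their values on the cells only. So S itself may be infinite-dimensional, and spanning is claimed
  on \<open>D\<close>, where nodal values determine a piecewise polynomial.\<close>

lemma fe_space_spanning:
  assumes fe: "fe_space r h S"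
  obtains n :: nat and b where "\<And>i. i < n \<Longrightarrow> b i \<in> S"
    "\<And>f. f \<in> S \<Longrightarrow> \<exists>c. \<forall>x\<in>D. f x = (\<Sum>i<n. c i * b i x)"
proof -
  obtain J z where J: "J \<ge> 1" "z 0 = 0" "z J = 1" "\<And>j. j < J \<Longrightarrow> z j < z (Suc j)"
    "\<And>f. f \<in> S \<Longrightarrow> piecewise_poly r J z f"
    using fe by (auto simp: fe_space_def)
  \<comment> \<open>These are r + 1 distinct nodes in each cell, enough to determine a polynomial of
    degree at most r.\<close>
  define pt where "pt j i = z j + (z (Suc j) - z j) * (real i / real (Suc r))" for j i
  define X where "X = (\<lambda>(j, i). pt j i) ` ({..<J} \<times> {..r})"
  have "finite X" by (simp add: X_def)
  then obtain n b where b: "\<And>i. i < n \<Longrightarrow> b i \<in> S"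
    "\<And>f. f \<in> S \<Longrightarrow> \<exists>c. \<forall>x\<in>X. f x = (\<Sum>i<(n::nat). c i * b i x)"
    using finite_evaluation_spanning[OF fe_spaceD(4)[OF fe] _ fe_spaceD(3)[OF fe], of X] by metis
  have vanish: "f x = 0" if f: "f \<in> S" and fX: "\<And>x. x \<in> X \<Longrightarrow> f x = 0" and x: "x \<in> D" for f x
  proof -
    obtain j where j: "j < J" "x \<in> {z j..z (Suc j)}"
      using partition_covers[of z x J] x J by auto
    obtain p where p: "degree p \<le> r" "\<And>y. y \<in> {z j..z (Suc j)} \<Longrightarrow> f y = poly p y"
      using J(5)[OF f] j(1) by (auto simp: piecewise_poly_def)
    have "p = 0"
    proof (rule ccontr)
      assume "p \<noteq> 0"
      have "poly p (pt j i) = 0" if "i \<le> r" for i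
      proof -
        have "pt j i \<in> {z j..z (Suc j)}"
        proof -
          have "0 \<le> real i / real (Suc r)" "real i / real (Suc r) \<le> 1" using that by (auto simp: divide_le_eq)
          then have "0 \<le> (z (Suc j) - z j) * (real i / real (Suc r))"
            "(z (Suc j) - z j) * (real i / real (Suc r)) \<le> z (Suc j) - z j"
            using J(4)[OF j(1)] by (auto intro!: mult_left_le simp del: times_divide_eq_right)
          then show ?thesis unfolding pt_def by simp
        qed
        moreover have "pt j i \<in> X" using that j(1) by (auto simp: X_def)
        ultimately show ?thesis using p(2) fX by fastforce
      qed
      then have "pt j ` {..r} \<subseteq> {x. poly p x = 0}" by auto
      then have "card (pt j ` {..r}) \<le> card {x. poly p x = 0}"
        by (intro card_mono poly_roots_finite \<open>p \<noteq> 0\<close>)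
      moreover have "inj_on (pt j) {..r}"
        using J(4)[OF j(1)] by (auto simp: inj_on_def pt_def divide_right_mono)
      ultimately show False
        using card_poly_roots_bound[OF \<open>p \<noteq> 0\<close>] p(1) by (simp add: card_image)
    qed
    then show ?thesis using p(2) j(2) by simp
  qed
  show ?thesis
  proof (rule that[of n b])
    fix f assume f: "f \<in> S"
    then obtain c where c: "\<forall>x\<in>X. f x = (\<Sum>i<n. c i * b i x)" using b(2) by blast
    have "(\<lambda>x. f x - (\<Sum>i<n. c i * b i x)) \<in> S"
      using b(1) by (intro fe_space_diff[OF fe f] fe_space_sum[OF fe]) auto
    then have "f x - (\<Sum>i<n. c i * b i x) = 0" if "x \<in> D" for x
      by (rule vanish) (use c that in auto)
    then show "\<exists>c. \<forall>x\<in>D. f x = (\<Sum>i<n. c i * b i x)" by (intro exI[of _ c]) auto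
  qed (use b in blast)
qed

section \<open>Riesz representation in finite dimension\<close>

lemma linear_functional_sum:
  fixes S :: "(real \<Rightarrow> real) set" and L :: "(real \<Rightarrow> real) \<Rightarrow> real"
  assumes lin: "\<And>f g a b. f \<in> S \<Longrightarrow> g \<in> S \<Longrightarrow> (\<lambda>x. a * f x + b * g x) \<in> S"
    and L: "\<And>f g a b. f \<in> S \<Longrightarrow> g \<in> S \<Longrightarrow> L (\<lambda>x. a * f x + b * g x) = a * L f + b * L g"
    and zero: "(\<lambda>x. 0) \<in> S" and b: "\<And>i. i < (n :: nat) \<Longrightarrow> b i \<in> S"
  shows "(\<lambda>x. \<Sum>i<n. c i * b i x) \<in> S \<and> L (\<lambda>x. \<Sum>i<n. c i * b i x) = (\<Sum>i<n. c i * L (b i))"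
  using b
proof (induction n)
  case 0
  then show ?case using zero L[OF zero zero, of 0 0] by simp
next
  case (Suc n)
  then show ?case
    using lin[of "\<lambda>x. \<Sum>i<n. c i * b i x" "b n" 1 "c n"] L[of "\<lambda>x. \<Sum>i<n. c i * b i x" "b n" 1 "c n"]
    by simp
qed

text \<open>Gram--Schmidt for a positive semidefinite form.\<close>

lemma riesz_on_span:
  fixes S :: "(real \<Rightarrow> real) set" and A :: "(real \<Rightarrow> real) \<Rightarrow> (real \<Rightarrow> real) \<Rightarrow> real"
  assumes lin: "\<And>f g a b. f \<in> S \<Longrightarrow> g \<in> S \<Longrightarrow> (\<lambda>x. a * f x + b * g x) \<in> S"
    and zero: "(\<lambda>x. 0) \<in> S"
    and A: "\<And>f g u a b. f \<in> S \<Longrightarrow> g \<in> S \<Longrightarrow> u \<in> S \<Longrightarrow> A (\<lambda>x. a * f x + b * g x) u = a * A f u + b * A g u"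
    and sym: "\<And>f g. f \<in> S \<Longrightarrow> g \<in> S \<Longrightarrow> A f g = A g f"
    and pos: "\<And>f. f \<in> S \<Longrightarrow> 0 \<le> A f f"
    and L: "\<And>f g a b. f \<in> S \<Longrightarrow> g \<in> S \<Longrightarrow> L (\<lambda>x. a * f x + b * g x) = a * L f + b * L g"
    and null: "\<And>f. f \<in> S \<Longrightarrow> A f f = 0 \<Longrightarrow> L f = (0 :: real)"
    and b: "\<And>i. i < (n :: nat) \<Longrightarrow> b i \<in> S"
  shows "\<exists>c. \<forall>j<n. A (\<lambda>x. \<Sum>i<n. c i * b i x) (b j) = L (b j)"
  using b L null
proof (induction n arbitrary: L)
  case (Suc n)
  have CS: "\<bar>A f g\<bar> \<le> sqrt (A f f) * sqrt (A g g)" if "f \<in> S" "g \<in> S" for f g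
  proof (rule discriminant_le)
    fix s t :: real
    let ?u = "\<lambda>x. s * f x + t * g x"
    have u: "?u \<in> S" by (intro lin that)
    have "A ?u ?u = s * A f ?u + t * A g ?u" by (intro A that u)
    also have "A f ?u = s * A f f + t * A g f" using A[OF that(1,2,1)] sym[OF that(1) u] by simp
    also have "A g ?u = s * A f g + t * A g g" using A[OF that(1,2,2)] sym[OF that(2) u] by simp
    finally show "0 \<le> s\<^sup>2 * A f f + 2 * s * t * A f g + t\<^sup>2 * A g g"
      using pos[OF u] sym[OF that] by (simp add: power2_eq_square algebra_simps)
  qed
  have bS: "\<And>i. i < n \<Longrightarrow> b i \<in> S" "b n \<in> S" using Suc.prems(1) by auto
  let ?s = "\<lambda>c x. \<Sum>i<n. c i * b i x"
  have sS: "?s c \<in> S" for c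
    using linear_functional_sum[of S "\<lambda>_. 0" n b c] lin zero bS by auto
  have Asum: "A u (?s c) = (\<Sum>i<n. c i * A u (b i))" if "u \<in> S" for u c
  proof -
    have "A u (?s c) = A (?s c) u" using sym[OF that sS] .
    also have "\<dots> = (\<Sum>i<n. c i * A (b i) u)"
      using linear_functional_sum[of S "\<lambda>f. A f u" n b c] lin zero bS A that by auto
    also have "\<dots> = (\<Sum>i<n. c i * A u (b i))" using sym that bS by (intro sum.cong) auto
    finally show ?thesis .
  qed
  have Lsum: "L (?s c) = (\<Sum>i<n. c i * L (b i))" for c
    using linear_functional_sum[of S L n b c] lin zero bS Suc.prems(2) by auto
  obtain c where c: "\<And>j. j < n \<Longrightarrow> A (?s c) (b j) = L (b j)"
  proof -
    have "\<exists>c. \<forall>j<n. A (?s c) (b j) = L (b j)"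
    proof (rule Suc.IH)
      fix f g a b' assume "f \<in> S" "g \<in> S"
      then show "L (\<lambda>x. a * f x + b' * g x) = a * L f + b' * L g" by (rule Suc.prems(2))
    next
      fix f assume "f \<in> S" "A f f = 0"
      then show "L f = 0" by (rule Suc.prems(3))
    qed (rule bS(1))
    then show ?thesis using that by blast
  qed
  \<comment> \<open>The projection of \<open>b n\<close> onto the earlier functions, obtained from
    the induction hypothesis for the functional \<open>A (b n)\<close>; this is why the induction
    generalises over \<open>L\<close>. Cauchy-Schwarz supplies the null condition.\<close>
  obtain d where d: "\<And>j. j < n \<Longrightarrow> A (?s d) (b j) = A (b n) (b j)"
  proof -
    have "\<exists>d. \<forall>j<n. A (?s d) (b j) = A (b n) (b j)"
    proof (rule Suc.IH[OF bS(1)])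
      fix f g a b' assume fg: "f \<in> S" "g \<in> S"
      show "A (b n) (\<lambda>x. a * f x + b' * g x) = a * A (b n) f + b' * A (b n) g"
        using A[OF fg bS(2), of a b'] sym[OF bS(2) lin[OF fg, of a b']] sym[OF bS(2) fg(1)] sym[OF bS(2) fg(2)]
        by simp
    next
      fix f assume "f \<in> S" "A f f = 0"
      then show "A (b n) f = 0" using CS[OF bS(2)] by fastforce
    qed
    then show ?thesis using that by blast
  qed
  \<comment> \<open>The component of \<open>b n\<close> orthogonal to the earlier functions. Moving
    along it does not spoil the equations already solved.\<close>
  define e where "e x = 1 * b n x + (-1) * ?s d x" for x
  have eS: "e \<in> S" unfolding e_def[abs_def] by (intro lin bS sS)
  have ebj: "A e (b j) = 0" if "j < n" for j
    using A[OF bS(2) sS bS(1)[OF that], of 1 "-1" d] d[OF that] by (simp add: e_def[abs_def])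
  have es: "A e (?s k) = 0" for k using Asum[OF eS] ebj by simp
  have Le: "L e = L (b n) - L (?s d)"
    unfolding e_def[abs_def] using Suc.prems(2)[OF bS(2) sS, of 1 "-1" d] by simp
  \<comment> \<open>If \<open>A e e\<close> vanishes, then so does \<open>L e\<close> by the null
    condition, and any coefficient would do.\<close>
  define t where "t = (if A e e = 0 then 0 else L e / A e e)"
  have t: "t * A e e = L e" using Suc.prems(3)[OF eS] by (simp add: t_def)
  define u where "u x = 1 * ?s c x + t * e x" for x
  have uS: "u \<in> S" unfolding u_def[abs_def] by (intro lin sS eS)
  have Au: "A u v = A (?s c) v + t * A e v" if "v \<in> S" for v
    unfolding u_def[abs_def] using A[OF sS eS that, of 1 c t] by simp
  have uj: "A u (b j) = L (b j)" if "j < n" for j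
    using Au[OF bS(1)[OF that]] ebj[OF that] c[OF that] by simp
  have "A u (b n) = A u e + A u (?s d)"
  proof -
    have "b n = (\<lambda>x. 1 * e x + 1 * ?s d x)" by (simp add: e_def)
    then have "A (b n) u = A (\<lambda>x. 1 * e x + 1 * ?s d x) u" by (rule arg_cong)
    then show ?thesis
      using A[OF eS sS uS, of 1 1 d] sym[OF uS bS(2)] sym[OF uS eS] sym[OF uS sS, of d] by linarith
  qed
  also have "A u (?s d) = L (?s d)" unfolding Asum[OF uS] Lsum using uj by simp
  also have "A u e = L e"
    using Au[OF eS] es[of c] sym[OF eS sS] t by simp
  also have "L e + L (?s d) = L (b n)" using Le by simp
  finally have un: "A u (b n) = L (b n)" .
  define c' where "c' i = (if i = n then t else c i - t * d i)" for i
  have "(\<Sum>i<Suc n. c' i * b i x) = u x" for x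
  proof -
    have "(\<Sum>i<n. c' i * b i x) = (\<Sum>i<n. c i * b i x - t * (d i * b i x))"
      by (intro sum.cong) (auto simp: c'_def algebra_simps)
    then show ?thesis
      by (simp add: c'_def u_def e_def sum_subtractf sum_distrib_left sum_negf algebra_simps)
  qed
  then have "(\<lambda>x. \<Sum>i<Suc n. c' i * b i x) = u" by auto
  then show ?case using uj un by (intro exI[of _ c']) (auto simp: less_Suc_eq)
qed simp

text \<open>A member of S equals a combination of the spanning functions on \<open>D\<close> only;
  the two congruence hypotheses make \<open>A\<close> and \<open>L\<close> blind to values
  elsewhere.\<close>

lemma fe_space_riesz:
  assumes fe: "fe_space r h S"
    and A: "\<And>f g u a b. f \<in> S \<Longrightarrow> g \<in> S \<Longrightarrow> u \<in> S \<Longrightarrow> A (\<lambda>x. a * f x + b * g x) u = a * A f u + b * A g u"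
    and sym: "\<And>f g. f \<in> S \<Longrightarrow> g \<in> S \<Longrightarrow> A f g = A g f"
    and pos: "\<And>f. f \<in> S \<Longrightarrow> 0 \<le> A f f"
    and L: "\<And>f g a b. f \<in> S \<Longrightarrow> g \<in> S \<Longrightarrow> L (\<lambda>x. a * f x + b * g x) = a * L f + b * L g"
    and null: "\<And>f. f \<in> S \<Longrightarrow> A f f = 0 \<Longrightarrow> L f = (0 :: real)"
    and A_cong: "\<And>f g u. f \<in> S \<Longrightarrow> g \<in> S \<Longrightarrow> u \<in> S \<Longrightarrow> (\<And>x. x \<in> D \<Longrightarrow> f x = g x) \<Longrightarrow> A f u = A g u"
    and L_cong: "\<And>f g. f \<in> S \<Longrightarrow> g \<in> S \<Longrightarrow> (\<And>x. x \<in> D \<Longrightarrow> f x = g x) \<Longrightarrow> L f = L g"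
  obtains u where "u \<in> S" "\<And>f. f \<in> S \<Longrightarrow> A u f = L f"
proof -
  obtain n :: nat and b where b: "\<And>i. i < n \<Longrightarrow> b i \<in> S"
    "\<And>f. f \<in> S \<Longrightarrow> \<exists>c. \<forall>x\<in>D. f x = (\<Sum>i<n. c i * b i x)"
    using fe_space_spanning[OF fe] by blast
  note lin = fe_spaceD(4)[OF fe] note zero = fe_spaceD(3)[OF fe]
  obtain c where c: "\<And>j. j < n \<Longrightarrow> A (\<lambda>x. \<Sum>i<n. c i * b i x) (b j) = L (b j)"
    using riesz_on_span[of S A L n b, OF lin zero A sym pos L null b(1)] by blast
  define u where "u x = (\<Sum>i<n. c i * b i x)" for x
  have sS: "(\<lambda>x. \<Sum>i<n. d i * b i x) \<in> S" for d using b(1) by (intro fe_space_sum[OF fe]) auto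
  have uS: "u \<in> S" unfolding u_def[abs_def] by (rule sS)
  have "A u f = L f" if f: "f \<in> S" for f
  proof -
    obtain d where d: "\<And>x. x \<in> D \<Longrightarrow> f x = (\<Sum>i<n. d i * b i x)" using b(2)[OF f] by blast
    have "A u f = A f u" using sym[OF uS f] .
    also have "\<dots> = A (\<lambda>x. \<Sum>i<n. d i * b i x) u" by (intro A_cong f sS uS d)
    also have "\<dots> = (\<Sum>i<n. d i * A (b i) u)"
      using linear_functional_sum[of S "\<lambda>f. A f u" n b d] lin zero b(1) A uS by auto
    also have "\<dots> = (\<Sum>i<n. d i * L (b i))"
      using c sym[OF uS b(1)] by (intro sum.cong) (auto simp: u_def[abs_def])
    also have "\<dots> = L (\<lambda>x. \<Sum>i<n. d i * b i x)"
      using linear_functional_sum[of S L n b d] lin zero b(1) L by auto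
    also have "\<dots> = L f" using d by (intro L_cong f sS) auto
    finally show ?thesis .
  qed
  then show ?thesis using that uS by blast
qed

section \<open>The bending form, Ritz projection and duality\<close>

definition bending :: "(real \<Rightarrow> real) \<Rightarrow> (real \<Rightarrow> real) \<Rightarrow> real" where
  "bending f g = L2_inner D (weak_deriv 2 f) (weak_deriv 2 g)"

lemma bending_commute: "bending f g = bending g f"
  by (simp add: bending_def L2_inner_commute)

lemma bending_lincomb:
  assumes "f \<in> sobolev 2" "g \<in> sobolev 2" "u \<in> sobolev 2"
  shows "bending (\<lambda>x. a * f x + b * g x) u = a * bending f u + b * bending g u"
  unfolding bending_def using assms by (intro L2_inner_weak_deriv_lincomb weak_deriv_L2) auto

lemma bending_lincomb_right:
  assumes "f \<in> sobolev 2" "g \<in> sobolev 2" "u \<in> sobolev 2"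
  shows "bending u (\<lambda>x. a * f x + b * g x) = a * bending u f + b * bending u g"
  using bending_lincomb[OF assms] by (simp add: bending_commute)

lemma bending_diff:
  assumes "f \<in> sobolev 2" "g \<in> sobolev 2" "u \<in> sobolev 2"
  shows "bending (\<lambda>x. f x - g x) u = bending f u - bending g u"
    "bending u (\<lambda>x. f x - g x) = bending u f - bending u g"
  using bending_lincomb[OF assms, of 1 "-1"] bending_lincomb_right[OF assms, of 1 "-1"] by simp_all

lemma bending_Cauchy_Schwarz:
  assumes "f \<in> sobolev 2" "g \<in> sobolev 2"
  shows "\<bar>bending f g\<bar> \<le> L2_norm D (weak_deriv 2 f) * L2_norm D (weak_deriv 2 g)"
  unfolding bending_def using assms by (intro L2_Cauchy_Schwarz weak_deriv_L2) auto

lemma bending_self: "bending f f = (L2_norm D (weak_deriv 2 f))\<^sup>2"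
  by (simp add: bending_def L2_norm_square)

lemma bending_cong:
  "(\<And>x. x \<in> D \<Longrightarrow> f x = g x) \<Longrightarrow> bending f u = bending g u"
  using weak_deriv_cong[of f g 2] by (simp add: bending_def)

text \<open>Existence rests on Cauchy-Schwarz: the functional \<open>bending v\<close> vanishes
  wherever the form degenerates on S.\<close>

lemma fe_space_ritz:
  assumes fe: "fe_space r h S" and v: "v \<in> sobolev 2"
  obtains w where "w \<in> S" "\<And>\<zeta>. \<zeta> \<in> S \<Longrightarrow> bending w \<zeta> = bending v \<zeta>"
proof -
  note s = fe_spaceD(1)[OF fe]
  show ?thesis
  proof (rule fe_space_riesz[OF fe, of bending "bending v"])
    fix f assume f: "f \<in> S" "bending f f = 0"
    then show "bending v f = 0" using bending_Cauchy_Schwarz[OF v s[OF f(1)]] by (simp add: bending_self)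
  next
    fix f g assume "f \<in> S" "g \<in> S" "\<And>x. x \<in> D \<Longrightarrow> f x = g x"
    then show "bending v f = bending v g" using bending_cong[of f g v] by (simp add: bending_commute)
  next
    fix f g u :: "real \<Rightarrow> real" assume "\<And>x. x \<in> D \<Longrightarrow> f x = g x"
    then show "bending f u = bending g u" by (rule bending_cong)
  qed (use that v s in \<open>auto simp: bending_lincomb bending_lincomb_right bending_commute bending_self\<close>)
qed

text \<open>The infimum need not be attained, so a slack \<delta> is granted; the users of the lemma
  let it tend to zero.\<close>

lemma approximation_propertyE:
  assumes fe: "fe_space r h S" and ap: "approximation_property r C h S" and s: "s \<in> {3..r+1}"
    and v: "v \<in> sobolev (s + 1)" "v \<in> sobolev_0_1" and \<delta>: "0 < \<delta>"
  obtains \<zeta> where "\<zeta> \<in> S"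
    "L2_norm D (weak_deriv 2 (\<lambda>x. v x - \<zeta> x)) \<le> C * h ^ (s - 2) * sobolev_norm s v + \<delta>"
proof -
  have "(INF \<zeta>\<in>S. sobolev_norm 2 (\<lambda>x. v x - \<zeta> x)) \<le> C * h ^ (s - 2) * sobolev_norm s v"
    using ap s v by (auto simp: approximation_property_def)
  then have "(INF \<zeta>\<in>S. sobolev_norm 2 (\<lambda>x. v x - \<zeta> x)) < C * h ^ (s - 2) * sobolev_norm s v + \<delta>"
    using \<delta> by linarith
  then obtain \<zeta> where \<zeta>: "\<zeta> \<in> S" "sobolev_norm 2 (\<lambda>x. v x - \<zeta> x) < C * h ^ (s - 2) * sobolev_norm s v + \<delta>"
    using fe_spaceD(3)[OF fe] by (subst (asm) cINF_less_iff) (auto intro!: bdd_belowI2[of _ 0] sobolev_norm_ge_0)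
  then show ?thesis
    using that weak_deriv_le_sobolev_norm[of 2 2 "\<lambda>x. v x - \<zeta> x"] by fastforce
qed

text \<open>Cea's argument: the error \<open>w - v\<close> is orthogonal to S for
  \<open>bending\<close>, so its square equals its pairing with \<open>\<zeta> - v\<close> for every
  \<zeta> in S. The form is symmetric and semidefinite, hence the constant 1.\<close>

lemma fe_space_best_approximation:
  assumes fe: "fe_space r h S" and ap: "approximation_property r C h S" and s: "s \<in> {3..r+1}"
    and v: "v \<in> sobolev (s + 1)" "v \<in> sobolev_0_1"
    and w: "w \<in> S" "\<And>\<zeta>. \<zeta> \<in> S \<Longrightarrow> bending w \<zeta> = bending v \<zeta>"
  shows "L2_norm D (weak_deriv 2 (\<lambda>x. w x - v x)) \<le> C * h ^ (s - 2) * sobolev_norm s v"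
proof (rule field_le_epsilon)
  fix \<delta> :: real assume "0 < \<delta>"
  then obtain \<zeta> where \<zeta>: "\<zeta> \<in> S"
    "L2_norm D (weak_deriv 2 (\<lambda>x. v x - \<zeta> x)) \<le> C * h ^ (s - 2) * sobolev_norm s v + \<delta>"
    using approximation_propertyE[OF fe ap s v] by blast
  have v2: "v \<in> sobolev 2" using s by (intro sobolev_mono[OF v(1)]) auto
  note s2 = fe_spaceD(1)[OF fe]
  define \<rho> where "\<rho> x = w x - v x" for x
  have \<rho>: "\<rho> \<in> sobolev 2" unfolding \<rho>_def[abs_def] by (intro sobolev_diff s2 w v2)
  have orth: "bending \<rho> \<zeta>' = 0" if "\<zeta>' \<in> S" for \<zeta>'
    unfolding \<rho>_def[abs_def] using w(2)[OF that] bending_diff(1)[OF s2[OF w(1)] v2 s2[OF that]] by simp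
  define N where "N = L2_norm D (weak_deriv 2 \<rho>)"
  have "N\<^sup>2 = bending \<rho> w - bending \<rho> v"
    unfolding N_def bending_self[symmetric] using bending_diff(2)[OF s2[OF w(1)] v2 \<rho>] by (simp add: \<rho>_def[abs_def])
  also have "\<dots> = - bending \<rho> (\<lambda>x. v x - \<zeta> x)"
    using bending_diff(2)[OF v2 s2[OF \<zeta>(1)] \<rho>] orth[OF \<zeta>(1)] orth[OF w(1)] by simp
  also have "\<dots> \<le> N * L2_norm D (weak_deriv 2 (\<lambda>x. v x - \<zeta> x))"
    using bending_Cauchy_Schwarz[OF \<rho> sobolev_diff[OF v2 s2[OF \<zeta>(1)]]] by (simp add: N_def)
  finally have "N * N \<le> N * L2_norm D (weak_deriv 2 (\<lambda>x. v x - \<zeta> x))" by (simp add: power2_eq_square)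
  moreover have "0 \<le> N" by (simp add: N_def)
  ultimately have "N \<le> L2_norm D (weak_deriv 2 (\<lambda>x. v x - \<zeta> x))"
    by (cases "N = 0") simp_all
  then show "L2_norm D (weak_deriv 2 (\<lambda>x. w x - v x)) \<le> C * h ^ (s - 2) * sobolev_norm s v + \<delta>"
    using \<zeta>(2) by (simp add: N_def \<rho>_def[abs_def])
qed

text \<open>Four integrations from 0 give the right fourth derivative and the conditions at 0; a
  cubic then repairs those at 1. With B the norm of \<eta>, the worst of the derivative bounds is 1
  + 1/2 + 7/6 = 8/3 times B, for the first derivative, hence the 3.\<close>

lemma biharmonic_dual:
  assumes "test_function \<eta>"
  obtains v where "smooth v" "v 0 = 0" "v 1 = 0" "(deriv ^^ 2) v 0 = 0" "(deriv ^^ 2) v 1 = 0"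
    "(deriv ^^ 4) v = \<eta>" "\<And>k. k \<le> 4 \<Longrightarrow> L2_norm D ((deriv ^^ k) v) \<le> 3 * L2_norm D \<eta>"
proof -
  define B where "B = L2_norm D \<eta>"
  have anti: "\<exists>G. smooth G \<and> G 0 = 0 \<and> deriv G = g" if "smooth g" for g
    using smooth_antiderivative[OF that] by blast
  obtain a1 where a1: "smooth a1" "a1 0 = 0" "deriv a1 = \<eta>"
    using anti test_function_smooth[OF assms] by blast
  obtain a2 where a2: "smooth a2" "a2 0 = 0" "deriv a2 = a1" using anti a1(1) by blast
  obtain a3 where a3: "smooth a3" "a3 0 = 0" "deriv a3 = a2" using anti a2(1) by blast
  obtain a4 where a4: "smooth a4" "a4 0 = 0" "deriv a4 = a3" using anti a3(1) by blast
  have B0: "0 \<le> B" by (simp add: B_def)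
  \<comment> \<open>The bound on \<open>D\<close> is carried to the closed interval by continuity
    because values at 1 enter p and q.\<close>
  have step: "\<forall>x\<in>{0..1}. \<bar>g x\<bar> \<le> B"
    if g: "smooth g" "g 0 = 0" and le: "L2_norm D (deriv g) \<le> B" for g
  proof -
    have D: "\<bar>g x\<bar> \<le> B" if "x \<in> D" for x using smooth_abs_le_L2_norm_deriv[OF g that] le by simp
    have "closure D \<subseteq> {x. \<bar>g x\<bar> \<le> B}"
      using smooth_continuous[OF g(1)] D
      by (intro closure_minimal closed_Collect_le continuous_intros) auto
    then show ?thesis by auto
  qed
  have norm_le: "L2_norm D g \<le> c" if "smooth g" "\<forall>x\<in>{0..1}. \<bar>g x\<bar> \<le> c" for g c
    using that smooth_L2[OF that(1)] by (intro bounded_L2_D) (auto simp: L2_def)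
  have b1: "\<forall>x\<in>{0..1}. \<bar>a1 x\<bar> \<le> B" by (rule step) (use a1 in \<open>auto simp: B_def\<close>)
  have b2: "\<forall>x\<in>{0..1}. \<bar>a2 x\<bar> \<le> B" by (rule step) (use a2 norm_le[OF a1(1) b1] in auto)
  have b3: "\<forall>x\<in>{0..1}. \<bar>a3 x\<bar> \<le> B" by (rule step) (use a3 norm_le[OF a2(1) b2] in auto)
  have b4: "\<forall>x\<in>{0..1}. \<bar>a4 x\<bar> \<le> B" by (rule step) (use a4 norm_le[OF a3(1) b3] in auto)
  \<comment> \<open>First p makes the second derivative vanish at 1, then q makes v vanish there.
    Subtracting only x^3 and x leaves both conditions at 0 intact.\<close>
  define p where "p = a2 1"
  define q where "q = a4 1 - p / 6"
  have pq: "\<bar>p\<bar> \<le> B" "\<bar>q\<bar> \<le> 7 / 6 * B" 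
  proof -
    show p: "\<bar>p\<bar> \<le> B" using b2 by (simp add: p_def)
    have "\<bar>a4 1\<bar> \<le> B" using b4 by simp
    then show "\<bar>q\<bar> \<le> 7 / 6 * B" using p unfolding q_def by linarith
  qed
  define v where "v x = a4 x - p / 6 * x ^ 3 - q * x" for x
  define v1 where "v1 x = a3 x - p / 2 * x\<^sup>2 - q" for x
  define v2 where "v2 x = a2 x - p * x" for x
  define v3 where "v3 x = a1 x - p" for x
  have d: "deriv v = v1" "deriv v1 = v2" "deriv v2 = v3" "deriv v3 = \<eta>"
    unfolding v_def[abs_def] v1_def[abs_def] v2_def[abs_def] v3_def[abs_def]
    using smooth_DERIV[OF a4(1)] smooth_DERIV[OF a3(1)] smooth_DERIV[OF a2(1)] smooth_DERIV[OF a1(1)]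
    by (auto intro!: deriv_eqI derivative_eq_intros simp: a1 a2 a3 a4 power2_eq_square)
  have dk: "(deriv ^^ 1) v = v1" "(deriv ^^ 2) v = v2" "(deriv ^^ 3) v = v3" "(deriv ^^ 4) v = \<eta>"
    using d by (simp_all add: eval_nat_numeral)
  have sv: "smooth v"
    unfolding v_def[abs_def] by (intro smooth_diff smooth_cmult smooth_power a4 smooth_ident)
  show ?thesis
  proof (rule that[OF sv])
    show "v 0 = 0" "v 1 = 0" "(deriv ^^ 2) v 0 = 0" "(deriv ^^ 2) v 1 = 0"
      by (auto simp: dk v_def v2_def a2 a4 p_def q_def)
    fix k :: nat assume "k \<le> 4"
    then consider "k = 0" | "k = 1" | "k = 2" | "k = 3" | "k = 4" by linarith
    then show "L2_norm D ((deriv ^^ k) v) \<le> 3 * L2_norm D \<eta>"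
    proof cases
      case 5
      then show ?thesis using dk(4) L2_norm_ge_0[of D \<eta>] by simp
    next
      case 1
      have "\<bar>v x\<bar> \<le> 3 * B" if "x \<in> {0..1}" for x
      proof -
        have "\<bar>p / 6 * x ^ 3\<bar> \<le> B / 6" "\<bar>q * x\<bar> \<le> 7 / 6 * B"
          using that pq B0 mult_mono[of "\<bar>p\<bar>" B "\<bar>x ^ 3\<bar>" 1] mult_mono[of "\<bar>q\<bar>" "7 / 6 * B" "\<bar>x\<bar>" 1]
          by (auto simp: abs_mult power_le_one)
        then show ?thesis using b4[rule_format, OF that] B0 pq unfolding v_def by linarith
      qed
      then show ?thesis using 1 norm_le[OF sv, of "3 * B"] by (simp add: B_def)
    next
      case 2
      have "\<bar>v1 x\<bar> \<le> 3 * B" if "x \<in> {0..1}" for x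
      proof -
        have "\<bar>p / 2 * x\<^sup>2\<bar> \<le> B / 2"
          using that pq B0 mult_mono[of "\<bar>p\<bar>" B "\<bar>x\<^sup>2\<bar>" 1]
          by (auto simp: abs_mult power_le_one)
        then show ?thesis using b3[rule_format, OF that] B0 pq unfolding v1_def by linarith
      qed
      then show ?thesis using 2 dk norm_le[OF smooth_funpow_deriv[OF sv, of 1], of "3 * B"] by (simp add: B_def)
    next
      case 3
      have "\<bar>v2 x\<bar> \<le> 3 * B" if "x \<in> {0..1}" for x
      proof -
        have "\<bar>p * x\<bar> \<le> B"
          using that pq B0 mult_mono[of "\<bar>p\<bar>" B "\<bar>x\<bar>" 1] by (auto simp: abs_mult)
        then show ?thesis using b2[rule_format, OF that] B0 pq unfolding v2_def by linarith
      qed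
      then show ?thesis using 3 dk norm_le[OF smooth_funpow_deriv[OF sv, of 2], of "3 * B"] by (simp add: B_def)
    next
      case 4
      have "\<bar>v3 x\<bar> \<le> 3 * B" if "x \<in> {0..1}" for x
        using b1[rule_format, OF that] B0 pq unfolding v3_def by linarith
      then show ?thesis using 4 dk norm_le[OF smooth_funpow_deriv[OF sv, of 3], of "3 * B"] by (simp add: B_def)
    qed
  qed (use dk in auto)
qed

text \<open>The Aubin--Nitsche duality argument, run with test functions close to \<open>\<rho>\<close>.\<close>

lemma fe_space_duality:
  assumes fe: "fe_space r h S" and ap: "approximation_property r C h S" and r: "r = 2 \<or> r = 3" and C: "0 < C"
    and \<rho>: "\<rho> \<in> sobolev 2" "\<rho> \<in> sobolev_0_1" "\<And>\<zeta>. \<zeta> \<in> S \<Longrightarrow> bending \<rho> \<zeta> = 0"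
  shows "L2_norm D \<rho> \<le> 9 * C * h ^ (r - 1) * L2_norm D (weak_deriv 2 \<rho>)"
proof -
  define N where "N = L2_norm D (weak_deriv 2 \<rho>)"
  define K where "K = 9 * C * h ^ (r - 1) * N"
  have N0: "0 \<le> N" by (simp add: N_def)
  have h: "0 < h" using fe_space_mesh[OF fe] by simp
  have K0: "0 \<le> K" using C h N0 by (simp add: K_def)
  have test: "L2_inner D \<rho> \<eta> \<le> K * L2_norm D \<eta>" if \<eta>: "test_function \<eta>" for \<eta>
  proof -
    obtain v where v: "smooth v" "v 0 = 0" "v 1 = 0" "(deriv ^^ 2) v 0 = 0" "(deriv ^^ 2) v 1 = 0"
      "(deriv ^^ 4) v = \<eta>" "\<And>k. k \<le> 4 \<Longrightarrow> L2_norm D ((deriv ^^ k) v) \<le> 3 * L2_norm D \<eta>"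
      using biharmonic_dual[OF \<eta>] by blast
    \<comment> \<open>As z and \<rho> have zero boundary values, the second derivative moves from z
      to \<rho>, and the pairing of \<rho> with \<eta> becomes
      \<open>bending \<rho> v\<close>.\<close>
    define z where "z = (deriv ^^ 2) v"
    have z: "smooth z" "z \<in> sobolev_0_1"
      using v by (auto simp: z_def intro!: smooth_sobolev_0_1 smooth_funpow_deriv)
    have "(deriv ^^ 2) z = (deriv ^^ 4) v" by (simp add: z_def eval_nat_numeral)
    then have z\<eta>: "AE x in lebesgue_on D. weak_deriv 2 z x = \<eta> x"
      using weak_deriv_smooth_AE[OF z(1), of 2] v(6) by simp
    have v2: "v \<in> sobolev 2" "v \<in> sobolev_0_1" by (auto intro!: smooth_sobolev smooth_sobolev_0_1 v)
    note L = sobolev_L2[OF \<rho>(1)] weak_deriv_L2[OF \<rho>(1) order_refl] weak_deriv_L2[OF v2(1) order_refl]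
      smooth_L2[OF z(1)] test_function_L2[OF \<eta>] weak_deriv_L2[OF smooth_sobolev[OF z(1)] order_refl, of 2]
    have "L2_inner D \<rho> \<eta> = L2_inner D \<rho> (weak_deriv 2 z)"
      using L z\<eta> by (intro L2_inner_cong_AE(2)) (auto simp: eq_commute)
    also have "\<dots> = L2_inner D (weak_deriv 2 \<rho>) z"
      using weak_laplacian_symmetric[OF \<rho>(1,2) smooth_sobolev[OF z(1)] z(2)] by simp
    also have "\<dots> = bending \<rho> v"
      unfolding bending_def using L weak_deriv_smooth_AE[OF v(1), of 2]
      by (intro L2_inner_cong_AE(2)) (auto simp: z_def eq_commute)
    finally have eq: "L2_inner D \<rho> \<eta> = bending \<rho> v" .
    \<comment> \<open>The inner 3 is the constant of the dual solution; the outer one bounds the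
      root of r + 2, the number of derivatives in the norm.\<close>
    have sn: "sobolev_norm (r + 1) v \<le> 3 * (3 * L2_norm D \<eta>)"
    proof -
      have "sobolev_norm (r + 1) v \<le> sqrt (real (r + 1 + 1)) * (3 * L2_norm D \<eta>)"
        using r by (intro sobolev_norm_smooth_le v) auto
      moreover have "sqrt (real (r + 1 + 1)) \<le> 3" using r by (intro real_le_lsqrt) auto
      ultimately show ?thesis using L2_norm_ge_0[of D \<eta>] mult_right_mono[of "sqrt (real (r + 1 + 1))" 3 "3 * L2_norm D \<eta>"]
        by linarith
    qed
    have "bending \<rho> v \<le> K * L2_norm D \<eta> + N * \<delta>" if \<delta>: "0 < \<delta>" for \<delta>
    proof -
      \<comment> \<open>The highest order available; it yields the factor h^(r-1).\<close>
      have "r + 1 \<in> {3..r + 1}" using r by auto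
      then obtain \<zeta> where \<zeta>: "\<zeta> \<in> S"
        "L2_norm D (weak_deriv 2 (\<lambda>x. v x - \<zeta> x)) \<le> C * h ^ (r + 1 - 2) * sobolev_norm (r + 1) v + \<delta>"
        by (rule approximation_propertyE[OF fe ap _ smooth_sobolev[OF v(1)] v2(2) \<delta>])
      note \<zeta>s = fe_spaceD(1)[OF fe \<zeta>(1)]
      have "bending \<rho> v = bending \<rho> (\<lambda>x. v x - \<zeta> x)"
        using bending_diff(2)[OF v2(1) \<zeta>s \<rho>(1)] \<rho>(3)[OF \<zeta>(1)] by simp
      also have "\<dots> \<le> N * L2_norm D (weak_deriv 2 (\<lambda>x. v x - \<zeta> x))"
        using bending_Cauchy_Schwarz[OF \<rho>(1) sobolev_diff[OF v2(1) \<zeta>s]] by (simp add: N_def)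
      also have "\<dots> \<le> N * (C * h ^ (r + 1 - 2) * (9 * L2_norm D \<eta>) + \<delta>)"
      proof (intro mult_left_mono N0)
        have "C * h ^ (r + 1 - 2) * sobolev_norm (r + 1) v \<le> C * h ^ (r + 1 - 2) * (9 * L2_norm D \<eta>)"
          using sn C h by (intro mult_left_mono) auto
        then show "L2_norm D (weak_deriv 2 (\<lambda>x. v x - \<zeta> x)) \<le> C * h ^ (r + 1 - 2) * (9 * L2_norm D \<eta>) + \<delta>"
          using \<zeta>(2) by linarith
      qed
      also have "r + 1 - 2 = r - 1" by simp
      finally show ?thesis by (simp add: K_def algebra_simps)
    qed
    note bound = this
    have "bending \<rho> v \<le> K * L2_norm D \<eta>"
    proof (rule field_le_epsilon)
      fix e :: real assume e: "0 < e"
      have "N * (e / (N + 1)) \<le> e" using e N0 by (simp add: divide_le_eq mult.commute)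
      then show "bending \<rho> v \<le> K * L2_norm D \<eta> + e" using bound[of "e / (N + 1)"] e N0 by simp
    qed
    then show ?thesis using eq by simp
  qed
  \<comment> \<open>The dual problem was solved for test functions only, so taking \<eta> = \<rho>
    is replaced by taking test functions close to \<rho>, which exist because \<rho> lies in
    \<open>sobolev_0_1\<close>.\<close>
  define R where "R = L2_norm D \<rho>"
  have R0: "0 \<le> R" by (simp add: R_def)
  have "R\<^sup>2 \<le> K * R"
  proof (rule field_le_epsilon)
    fix e :: real assume e: "0 < e"
    define d where "d = e / (R + K + 1)"
    have d: "0 < d" using e R0 K0 by (simp add: d_def)
    obtain \<eta> where \<eta>: "test_function \<eta>" "sobolev_norm 1 (\<lambda>x. \<rho> x - \<eta> x) < d"
      using \<rho>(2) d unfolding sobolev_0_1_def by blast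
    note L = sobolev_L2[OF \<rho>(1)] test_function_L2[OF \<eta>(1)]
    have \<eta>s: "(\<lambda>x. \<rho> x - \<eta> x) \<in> sobolev 1"
      by (intro sobolev_diff sobolev_mono[OF \<rho>(1)] smooth_sobolev test_function_smooth \<eta>) simp
    have dn: "L2_norm D (\<lambda>x. \<rho> x - \<eta> x) \<le> d" using L2_norm_le_sobolev_norm[OF \<eta>s] \<eta>(2) by simp
    have "R\<^sup>2 = L2_inner D \<rho> (\<lambda>x. \<rho> x - \<eta> x) + L2_inner D \<rho> \<eta>"
      using L by (simp add: R_def L2_norm_square L2_inner_diff)
    moreover have "L2_inner D \<rho> (\<lambda>x. \<rho> x - \<eta> x) \<le> R * d"
      using L2_Cauchy_Schwarz[OF L(1) L2_diff[OF L]] mult_left_mono[OF dn R0] by (simp add: R_def)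
    moreover have "L2_norm D \<eta> \<le> R + d"
    proof -
      have "L2_norm D \<eta> = L2_norm D (\<lambda>x. \<rho> x + (-1) * (\<rho> x - \<eta> x))" by simp
      also have "\<dots> \<le> R + L2_norm D (\<lambda>x. (-1) * (\<rho> x - \<eta> x))"
        unfolding R_def using L by (intro L2_norm_triangle L2_cmult L2_diff)
      also have "L2_norm D (\<lambda>x. (-1) * (\<rho> x - \<eta> x)) = L2_norm D (\<lambda>x. \<rho> x - \<eta> x)"
        by (subst L2_norm_cmult) simp
      finally show ?thesis using dn by simp
    qed
    ultimately have "R\<^sup>2 \<le> R * d + K * (R + d)"
      using test[OF \<eta>(1)] mult_left_mono[of "L2_norm D \<eta>" "R + d" K] K0 by linarith
    also have "\<dots> = K * R + (R + K) * d" by (simp add: algebra_simps)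
    also have "(R + K) * d \<le> e" using e R0 K0 by (simp add: d_def divide_le_eq)
    finally show "R\<^sup>2 \<le> K * R + e" by simp
  qed
  then have "R \<le> K" using R0 K0 by (cases "R = 0") (auto simp: power2_eq_square)
  then show ?thesis by (simp add: R_def K_def N_def)
qed

section \<open>The energy estimate for the scheme\<close>

lemma L2_inner_weak_deriv_sum:
  assumes "\<And>i. i \<in> A \<Longrightarrow> f i \<in> sobolev s" "k \<le> s" "u \<in> L2 D"
  shows "L2_inner D (weak_deriv k (\<lambda>x. \<Sum>i\<in>A. c i * f i x)) u = (\<Sum>i\<in>A. c i * L2_inner D (weak_deriv k (f i)) u)
    \<and> (\<lambda>x. \<Sum>i\<in>A. c i * f i x) \<in> sobolev s"
  using assms(1)
proof (induction A rule: infinite_finite_induct)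
  case (insert i A)
  then show ?case
    using L2_inner_weak_deriv_lincomb[of "f i" s "\<lambda>x. \<Sum>i\<in>A. c i * f i x" k u "c i" 1] assms(2,3)
      sobolev_lincomb[of "f i" s "\<lambda>x. \<Sum>i\<in>A. c i * f i x" "c i" 1] by simp
next
  case empty
  have "L2_inner D (weak_deriv k (\<lambda>x. 0 * 0 + 0 * 0)) u = 0"
    using L2_inner_weak_deriv_lincomb[OF smooth_sobolev smooth_sobolev assms(2,3), of "\<lambda>x. 0" "\<lambda>x. 0" 0 0] by simp
  then show ?case by (simp add: smooth_sobolev)
next
  case (infinite A)
  have "L2_inner D (weak_deriv k (\<lambda>x. 0 * 0 + 0 * 0)) u = 0"
    using L2_inner_weak_deriv_lincomb[OF smooth_sobolev smooth_sobolev assms(2,3), of "\<lambda>x. 0" "\<lambda>x. 0" 0 0] by simp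
  then show ?case using infinite by (simp add: smooth_sobolev)
qed

lemma bending_sum:
  assumes "\<And>i. i \<in> A \<Longrightarrow> f i \<in> sobolev 2" "u \<in> sobolev 2"
  shows "bending (\<lambda>x. \<Sum>i\<in>A. c i * f i x) u = (\<Sum>i\<in>A. c i * bending (f i) u)"
  unfolding bending_def using L2_inner_weak_deriv_sum[of A f 2 2 "weak_deriv 2 u" c] assms
  by (simp add: weak_deriv_L2)

text \<open>Only strictly earlier values stand on the right, since the \<mu> term of the scheme is
  explicit. So the step size need not be small.\<close>

lemma discrete_gronwall:
  fixes A :: "nat \<Rightarrow> real"
  assumes "\<And>m. m \<le> M \<Longrightarrow> A m \<le> K + k * (\<Sum>n<m. A n)" "0 \<le> k" "0 \<le> K" "m \<le> M"
  shows "A m \<le> K * exp (k * real m)"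
proof -
  have "A m \<le> K * (1 + k) ^ m \<and> K + k * (\<Sum>n<m. A n) \<le> K * (1 + k) ^ m"
    using assms(4)
  proof (induction m)
    case (Suc m)
    then have IH: "A m \<le> K * (1 + k) ^ m" "K + k * (\<Sum>n<m. A n) \<le> K * (1 + k) ^ m" by auto
    have "K + k * (\<Sum>n<Suc m. A n) = (K + k * (\<Sum>n<m. A n)) + k * A m" by (simp add: algebra_simps)
    also have "\<dots> \<le> K * (1 + k) ^ m + k * (K * (1 + k) ^ m)"
      using IH assms(2) by (intro add_mono mult_left_mono)
    also have "\<dots> = K * (1 + k) ^ Suc m" by (simp add: algebra_simps)
    finally show ?case using assms(1)[OF Suc.prems] by linarith
  qed (use assms(1)[of 0] in simp)
  then have "A m \<le> K * (1 + k) ^ m" ..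
  also have "\<dots> \<le> K * exp k ^ m"
    using assms(2,3) by (intro mult_left_mono power_mono) auto
  finally show ?thesis by (simp add: exp_of_nat_mult[symmetric] mult.commute)
qed

text \<open>Young's inequality is weighted so that each of the two products with t consumes t^2 / 4;
  half of the t^2 on the left survives.\<close>

lemma energy_step:
  fixes t B B' \<phi> F \<mu> d :: real
  assumes "0 \<le> d" "t\<^sup>2 * d + (B\<^sup>2 - B'\<^sup>2) / 2 \<le> d * F + d * (\<phi> * t) + d * (\<bar>\<mu>\<bar> * B' * t)"
  shows "d * t\<^sup>2 + B\<^sup>2 \<le> B'\<^sup>2 + 2 * (d * F) + 2 * (d * \<phi>\<^sup>2) + 2 * \<mu>\<^sup>2 * (d * B'\<^sup>2)"
proof -
  have "\<phi> * t \<le> \<phi>\<^sup>2 + t\<^sup>2 / 4"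
    using zero_le_power2[of "\<phi> - t / 2"] by (simp add: power2_diff power_divide)
  moreover have "(\<bar>\<mu>\<bar> * B') * t \<le> \<mu>\<^sup>2 * B'\<^sup>2 + t\<^sup>2 / 4"
    using zero_le_power2[of "\<bar>\<mu>\<bar> * B' - t / 2"] by (simp add: power2_diff power_divide power_mult_distrib)
  ultimately have "\<phi> * t + (\<bar>\<mu>\<bar> * B') * t \<le> \<phi>\<^sup>2 + \<mu>\<^sup>2 * B'\<^sup>2 + t\<^sup>2 / 2" by linarith
  then have "d * (\<phi> * t + (\<bar>\<mu>\<bar> * B') * t) \<le> d * (\<phi>\<^sup>2 + \<mu>\<^sup>2 * B'\<^sup>2 + t\<^sup>2 / 2)"
    using assms(1) by (rule mult_left_mono)
  moreover have "d * (\<phi>\<^sup>2 + \<mu>\<^sup>2 * B'\<^sup>2 + t\<^sup>2 / 2) = d * \<phi>\<^sup>2 + \<mu>\<^sup>2 * (d * B'\<^sup>2) + (d * t\<^sup>2) / 2"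
    "d * (\<phi> * t + (\<bar>\<mu>\<bar> * B') * t) = d * (\<phi> * t) + d * (\<bar>\<mu>\<bar> * B' * t)" "t\<^sup>2 * d = d * t\<^sup>2"
    by (simp_all add: algebra_simps)
  ultimately have "d * (\<phi> * t) + d * (\<bar>\<mu>\<bar> * B' * t) \<le> d * \<phi>\<^sup>2 + \<mu>\<^sup>2 * (d * B'\<^sup>2) + (d * t\<^sup>2) / 2"
    "d * t\<^sup>2 + (B\<^sup>2 - B'\<^sup>2) / 2 \<le> d * F + (d * (\<phi> * t) + d * (\<bar>\<mu>\<bar> * B' * t))"
    using assms(2) by (simp_all only: add.assoc)
  then show ?thesis by argo
qed

text \<open>The scheme is used in the form summed over the time steps, so that testing with the solution
  itself controls it in \<open>L\<^sup>2\<close>.\<close>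

lemma energy_estimate:
  fixes \<theta> :: "nat \<Rightarrow> real \<Rightarrow> real"
  assumes fe: "fe_space r h S" and d: "0 < d" "real M * d \<le> T"
    and \<theta>: "\<And>n. \<theta> n \<in> S" and \<Theta>: "\<And>n. \<Theta> n = (\<lambda>x. \<Sum>j\<in>{1..n}. d * \<theta> j x)"
    and eq: "\<And>n \<zeta>. n \<in> {1..M} \<Longrightarrow> \<zeta> \<in> S \<Longrightarrow>
      L2_inner D (\<theta> n) \<zeta> + bending (\<Theta> n) \<zeta> + \<mu> * L2_inner D (weak_deriv 2 (\<Theta> (n - 1))) \<zeta> = L2_inner D e \<zeta> + f n \<zeta>"
    and e: "e \<in> L2 D" "0 \<le> \<beta>" "\<And>\<zeta>. \<zeta> \<in> S \<Longrightarrow> \<bar>L2_inner D e \<zeta>\<bar> \<le> \<beta> * L2_norm D (weak_deriv 2 \<zeta>)"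
    and f: "\<And>n \<zeta>. n \<in> {1..M} \<Longrightarrow> \<zeta> \<in> S \<Longrightarrow> \<bar>f n \<zeta>\<bar> \<le> \<phi> n * L2_norm D \<zeta>"
  shows "(\<Sum>n\<in>{1..M}. d * (L2_norm D (\<theta> n))\<^sup>2)
    \<le> 2 * (\<beta>\<^sup>2 + (\<Sum>n\<in>{1..M}. d * (\<phi> n)\<^sup>2)) * exp (4 * \<mu>\<^sup>2 * T)"
proof -
  define t where "t n = L2_norm D (\<theta> n)" for n
  define B where "B n = L2_norm D (weak_deriv 2 (\<Theta> n))" for n
  note s2 = fe_spaceD(1)[OF fe]
  have \<Theta>S: "\<Theta> n \<in> S" for n unfolding \<Theta> by (intro fe_space_sum[OF fe] \<theta>)
  have \<Theta>0: "\<Theta> 0 = (\<lambda>x. 0)" by (simp add: \<Theta>)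
  have "bending (\<lambda>x. 0 * 0 + 0 * 0) (\<lambda>x. 0) = 0"
    using bending_lincomb[OF smooth_sobolev smooth_sobolev smooth_sobolev, of "\<lambda>x. 0" "\<lambda>x. 0" "\<lambda>x. 0" 0 0] by simp
  then have B0: "B 0 = 0" using bending_self[of "\<Theta> 0"] by (simp add: B_def \<Theta>0)
  have step: "d * (t n)\<^sup>2 + (B n)\<^sup>2 \<le> (B (n - 1))\<^sup>2 + 2 * (d * L2_inner D e (\<theta> n)) + 2 * (d * (\<phi> n)\<^sup>2)
      + 2 * \<mu>\<^sup>2 * (d * (B (n - 1))\<^sup>2)" if n: "n \<in> {1..M}" for n
  proof (rule energy_step)
    show "0 \<le> d" using d by simp
    have \<Theta>n: "\<Theta> n = (\<lambda>x. 1 * \<Theta> (n - 1) x + d * \<theta> n x)"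
      using n by (cases n) (simp_all add: \<Theta>)
    \<comment> \<open>Since d times \<open>\<theta> n\<close> is the increment of \<Theta>, this
      product dominates half the increment of (B n)^2.\<close>
    have "d * bending (\<Theta> n) (\<theta> n) = bending (\<Theta> n) (\<Theta> n) - bending (\<Theta> n) (\<Theta> (n - 1))"
      using bending_lincomb_right[OF s2[OF \<Theta>S[of "n - 1"]] s2[OF \<theta>[of n]] s2[OF \<Theta>S[of n]], of 1 d] \<Theta>n by simp
    moreover have "bending (\<Theta> n) (\<Theta> (n - 1)) \<le> B n * B (n - 1)"
      using bending_Cauchy_Schwarz[OF s2[OF \<Theta>S] s2[OF \<Theta>S], of n "n - 1"] by (simp add: B_def)
    moreover have "B n * B (n - 1) \<le> ((B n)\<^sup>2 + (B (n - 1))\<^sup>2) / 2"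
      using sum_squares_bound[of "B n" "B (n - 1)"] by simp
    moreover have "bending (\<Theta> n) (\<Theta> n) = (B n)\<^sup>2" by (simp add: bending_self B_def)
    ultimately have 1: "((B n)\<^sup>2 - (B (n - 1))\<^sup>2) / 2 \<le> d * bending (\<Theta> n) (\<theta> n)"
      by (simp add: field_simps)
    have 2: "(t n)\<^sup>2 + bending (\<Theta> n) (\<theta> n)
        = L2_inner D e (\<theta> n) + f n (\<theta> n) - \<mu> * L2_inner D (weak_deriv 2 (\<Theta> (n - 1))) (\<theta> n)"
      using eq[OF n \<theta>[of n]] by (simp add: t_def L2_norm_square)
    have "\<bar>L2_inner D (weak_deriv 2 (\<Theta> (n - 1))) (\<theta> n)\<bar> \<le> B (n - 1) * t n"
      unfolding B_def t_def
      by (intro L2_Cauchy_Schwarz weak_deriv_L2[OF s2[OF \<Theta>S]] fe_space_L2[OF fe \<theta>]) simp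
    then have "\<bar>\<mu> * L2_inner D (weak_deriv 2 (\<Theta> (n - 1))) (\<theta> n)\<bar> \<le> \<bar>\<mu>\<bar> * (B (n - 1) * t n)"
      unfolding abs_mult by (intro mult_left_mono) auto
    moreover have "f n (\<theta> n) \<le> \<phi> n * t n" using f[OF n \<theta>] by (simp add: t_def abs_le_iff)
    ultimately have "(t n)\<^sup>2 + bending (\<Theta> n) (\<theta> n) \<le> L2_inner D e (\<theta> n) + \<phi> n * t n + \<bar>\<mu>\<bar> * (B (n - 1) * t n)"
      using 2 by linarith
    then have "d * ((t n)\<^sup>2 + bending (\<Theta> n) (\<theta> n)) \<le> d * (L2_inner D e (\<theta> n) + \<phi> n * t n + \<bar>\<mu>\<bar> * (B (n - 1) * t n))"
      using d by (intro mult_left_mono) auto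
    moreover have "d * ((t n)\<^sup>2 + bending (\<Theta> n) (\<theta> n)) = (t n)\<^sup>2 * d + d * bending (\<Theta> n) (\<theta> n)"
      "d * (L2_inner D e (\<theta> n) + \<phi> n * t n + \<bar>\<mu>\<bar> * (B (n - 1) * t n))
        = d * L2_inner D e (\<theta> n) + d * (\<phi> n * t n) + d * (\<bar>\<mu>\<bar> * B (n - 1) * t n)"
      by (simp_all add: algebra_simps)
    ultimately show "(t n)\<^sup>2 * d + ((B n)\<^sup>2 - (B (n - 1))\<^sup>2) / 2
        \<le> d * L2_inner D e (\<theta> n) + d * (\<phi> n * t n) + d * (\<bar>\<mu>\<bar> * B (n - 1) * t n)"
      using 1 by linarith
  qed
  define P where "P = (\<Sum>n\<in>{1..M}. d * (\<phi> n)\<^sup>2)"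
  \<comment> \<open>Twice what stays on the left once half of (B m)^2 has absorbed the contribution
    of e.\<close>
  define A where "A m = 2 * (\<Sum>n\<in>{1..m}. d * (t n)\<^sup>2) + (B m)\<^sup>2" for m
  have sum: "(\<Sum>n\<in>{1..m}. d * (t n)\<^sup>2) + (B m)\<^sup>2 \<le> 2 * (\<Sum>n\<in>{1..m}. d * L2_inner D e (\<theta> n))
      + 2 * (\<Sum>n\<in>{1..m}. d * (\<phi> n)\<^sup>2) + 2 * \<mu>\<^sup>2 * d * (\<Sum>n<m. (B n)\<^sup>2)" if "m \<le> M" for m
    using that
  proof (induction m)
    case (Suc m)
    then show ?case using step[of "Suc m"] by (simp add: algebra_simps)
  qed (simp add: B0)
  have "A m \<le> 4 * (\<beta>\<^sup>2 + P) + 4 * \<mu>\<^sup>2 * d * (\<Sum>n<m. A n)" if m: "m \<le> M" for m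
  proof -
    \<comment> \<open>The datum e is the same in every step, so the sum collapses to e tested with
      \<open>\<Theta> m\<close>. This is what allows e to be measured through \<beta>, against
      second derivatives.\<close>
    have "(\<Sum>n\<in>{1..m}. d * L2_inner D e (\<theta> n)) = L2_inner D e (\<Theta> m)"
      unfolding \<Theta> by (intro L2_inner_sum_right[symmetric] fe_space_L2[OF fe \<theta>] e)
    also have "\<dots> \<le> \<beta> * B m" using e(3)[OF \<Theta>S[of m]] by (simp add: B_def abs_le_iff)
    also have "\<dots> \<le> \<beta>\<^sup>2 + (B m)\<^sup>2 / 4"
      using zero_le_power2[of "\<beta> - B m / 2"] by (simp add: power2_diff power_divide)
    finally have 1: "(\<Sum>n\<in>{1..m}. d * L2_inner D e (\<theta> n)) \<le> \<beta>\<^sup>2 + (B m)\<^sup>2 / 4" .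
    have 2: "(\<Sum>n\<in>{1..m}. d * (\<phi> n)\<^sup>2) \<le> P"
      unfolding P_def using m d by (intro sum_mono2) auto
    have "(B n)\<^sup>2 \<le> A n" for n unfolding A_def using d by (auto intro!: sum_nonneg)
    then have "2 * \<mu>\<^sup>2 * d * (\<Sum>n<m. (B n)\<^sup>2) \<le> 2 * \<mu>\<^sup>2 * d * (\<Sum>n<m. A n)"
      using d by (intro mult_left_mono sum_mono) auto
    then have "(\<Sum>n\<in>{1..m}. d * (t n)\<^sup>2) + (B m)\<^sup>2 \<le> 2 * (\<beta>\<^sup>2 + (B m)\<^sup>2 / 4) + 2 * P + 2 * \<mu>\<^sup>2 * d * (\<Sum>n<m. A n)"
      using sum[OF m] 1 2 by argo
    then show ?thesis unfolding A_def by (simp add: algebra_simps)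
  qed
  moreover have "0 \<le> P" unfolding P_def using d by (intro sum_nonneg) auto
  ultimately have "A M \<le> 4 * (\<beta>\<^sup>2 + P) * exp (4 * \<mu>\<^sup>2 * d * real M)"
    using d by (intro discrete_gronwall[of M A]) auto
  also have "\<dots> \<le> 4 * (\<beta>\<^sup>2 + P) * exp (4 * \<mu>\<^sup>2 * T)"
  proof (intro mult_left_mono)
    have "\<mu>\<^sup>2 * (real M * d) \<le> \<mu>\<^sup>2 * T" using d by (intro mult_left_mono) auto
    then show "exp (4 * \<mu>\<^sup>2 * d * real M) \<le> exp (4 * \<mu>\<^sup>2 * T)" by (simp add: ac_simps)
  qed (use \<open>0 \<le> P\<close> in auto)
  finally have "A M \<le> 4 * (\<beta>\<^sup>2 + P) * exp (4 * \<mu>\<^sup>2 * T)" .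
  then have "2 * (\<Sum>n\<in>{1..M}. d * (t n)\<^sup>2) \<le> 4 * (\<beta>\<^sup>2 + P) * exp (4 * \<mu>\<^sup>2 * T)"
    unfolding A_def using zero_le_power2[of "B M"] by linarith
  then have "(\<Sum>n\<in>{1..M}. d * (t n)\<^sup>2) \<le> 2 * ((\<beta>\<^sup>2 + P) * exp (4 * \<mu>\<^sup>2 * T))"
    unfolding mult.assoc[of 4] by argo
  then show ?thesis by (simp only: t_def P_def mult.assoc)
qed

text \<open>The scheme, again summed over the time steps, when the data \<open>e\<close> enters in the first step only.\<close>

definition impulse_response :: "real \<Rightarrow> real \<Rightarrow> (real \<Rightarrow> real) set \<Rightarrow> (real \<Rightarrow> real) \<Rightarrow> (nat \<Rightarrow> real \<Rightarrow> real) \<Rightarrow> bool" where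
  "impulse_response d \<mu> S e V \<longleftrightarrow> V 0 = (\<lambda>x. 0) \<and> (\<forall>n. V n \<in> S) \<and>
     (\<forall>n\<ge>1. \<forall>\<zeta>\<in>S. L2_inner D (V n) \<zeta> + bending (\<lambda>x. \<Sum>j\<in>{1..n}. d * V j x) \<zeta>
       + \<mu> * L2_inner D (weak_deriv 2 (\<lambda>x. \<Sum>j\<in>{1..n-1}. d * V j x)) \<zeta> = L2_inner D e \<zeta>)"

lemma impulse_response_exists:
  assumes fe: "fe_space r h S" and d: "0 < d" and e: "e \<in> L2 D"
  obtains V where "impulse_response d \<mu> S e V"
proof -
  note s2 = fe_spaceD(1)[OF fe] note L2 = fe_space_L2[OF fe]
  \<comment> \<open>Here z is the weighted sum up to the previous step. Moving it to the right
    leaves the form \<open>L2_inner\<close> plus d times \<open>bending\<close> for the new value,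
    and the choice turns the solution into a function of z for the recursion.\<close>
  define sol where "sol z = (SOME u. u \<in> S \<and> (\<forall>\<zeta>\<in>S. L2_inner D u \<zeta> + d * bending u \<zeta>
    = L2_inner D e \<zeta> - bending z \<zeta> - \<mu> * L2_inner D (weak_deriv 2 z) \<zeta>))" for z
  have sol: "sol z \<in> S \<and> (\<forall>\<zeta>\<in>S. L2_inner D (sol z) \<zeta> + d * bending (sol z) \<zeta>
    = L2_inner D e \<zeta> - bending z \<zeta> - \<mu> * L2_inner D (weak_deriv 2 z) \<zeta>)" if z: "z \<in> S" for z
  proof -
    note wz = weak_deriv_L2[OF s2[OF z] order_refl]
    let ?A = "\<lambda>u \<zeta>. L2_inner D u \<zeta> + d * bending u \<zeta>"
    let ?L = "\<lambda>\<zeta>. L2_inner D e \<zeta> - bending z \<zeta> - \<mu> * L2_inner D (weak_deriv 2 z) \<zeta>"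
    have A_lin: "?A (\<lambda>x. a * f x + b * g x) u = a * ?A f u + b * ?A g u"
      if "f \<in> S" "g \<in> S" "u \<in> S" for f g u a b
      using that by (simp add: L2_inner_lincomb L2 bending_lincomb s2) (simp add: algebra_simps)
    have L_lin: "?L (\<lambda>x. a * f x + b * g x) = a * ?L f + b * ?L g" if "f \<in> S" "g \<in> S" for f g a b
      using that z e wz
      by (simp add: L2_inner_lincomb_right L2 bending_lincomb_right s2) (simp add: algebra_simps)
    have A_pos: "0 \<le> ?A f f" for f using d by (simp add: bending_self)
    have null: "?L f = 0" if f: "f \<in> S" "?A f f = 0" for f
    proof -
      have "0 \<le> L2_inner D f f" "0 \<le> d * bending f f" using d by (simp_all add: bending_self)
      then have "L2_inner D f f = 0" "d * bending f f = 0" using f(2) by linarith+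
      then have n: "L2_norm D f = 0" "L2_norm D (weak_deriv 2 f) = 0"
        using d by (simp_all add: L2_norm_def bending_def)
      show "?L f = 0"
        using L2_Cauchy_Schwarz[OF e L2[OF f(1)]] L2_Cauchy_Schwarz[OF wz L2[OF f(1)]]
          bending_Cauchy_Schwarz[OF s2[OF z] s2[OF f(1)]] n by simp
    qed
    have A_cong: "?A f u = ?A g u" if "\<And>x. x \<in> D \<Longrightarrow> f x = g x" for f g u
      using L2_inner_cong[of D f g u u] bending_cong[of f g u] that by simp
    have L_cong: "?L f = ?L g" if "\<And>x. x \<in> D \<Longrightarrow> f x = g x" for f g
      using L2_inner_cong[of D e e f g] L2_inner_cong[of D "weak_deriv 2 z" "weak_deriv 2 z" f g]
        bending_cong[of f g z] that by (simp add: bending_commute)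
    have sym: "?A f g = ?A g f" for f g by (simp add: L2_inner_commute bending_commute)
    obtain u where "u \<in> S" "\<And>f. f \<in> S \<Longrightarrow> ?A u f = ?L f"
      by (rule fe_space_riesz[of r h S ?A ?L, OF fe A_lin sym A_pos L_lin null A_cong L_cong]) blast+
    then have "\<exists>u. u \<in> S \<and> (\<forall>\<zeta>\<in>S. ?A u \<zeta> = ?L \<zeta>)" by blast
    then show ?thesis unfolding sol_def by (rule someI_ex)
  qed
  \<comment> \<open>The recursion runs over the weighted sums because the summed scheme sees earlier
    values of \<open>V\<close> only through them.\<close>
  define Z where "Z = rec_nat (\<lambda>x. 0 :: real) (\<lambda>n z x. z x + d * sol z x)"
  have Z: "Z 0 = (\<lambda>x. 0)" "Z (Suc n) = (\<lambda>x. Z n x + d * sol (Z n) x)" for n by (simp_all add: Z_def)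
  have ZS: "Z n \<in> S" for n
  proof (induction n)
    case (Suc n)
    then show ?case unfolding Z(2) by (intro fe_space_add[OF fe] fe_space_cmult[OF fe]) (use sol in auto)
  qed (simp add: Z fe_spaceD(3)[OF fe])
  define V where "V n = (if n = 0 then (\<lambda>x. 0) else sol (Z (n - 1)))" for n
  have Zsum: "Z n = (\<lambda>x. \<Sum>j\<in>{1..n}. d * V j x)" for n
    by (induction n) (simp_all add: Z V_def fun_eq_iff)
  have "impulse_response d \<mu> S e V"
    unfolding impulse_response_def
  proof (intro conjI allI impI ballI)
    fix n :: nat and \<zeta> assume n: "1 \<le> n" and \<zeta>: "\<zeta> \<in> S"
    then obtain k where k: "n = Suc k" by (cases n) auto
    have "bending (Z n) \<zeta> = bending (Z k) \<zeta> + d * bending (V n) \<zeta>"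
      using bending_lincomb[OF s2[OF ZS[of k]] s2[OF conjunct1[OF sol[OF ZS[of k]]]] s2[OF \<zeta>], of 1 d]
      by (simp add: k Z V_def)
    then show "L2_inner D (V n) \<zeta> + bending (\<lambda>x. \<Sum>j\<in>{1..n}. d * V j x) \<zeta>
       + \<mu> * L2_inner D (weak_deriv 2 (\<lambda>x. \<Sum>j\<in>{1..n-1}. d * V j x)) \<zeta> = L2_inner D e \<zeta>"
      using bspec[OF conjunct2[OF sol[OF ZS[of k]]] \<zeta>] unfolding Zsum[symmetric] by (simp add: k V_def)
  qed (use sol ZS fe_spaceD(3)[OF fe] in \<open>auto simp: V_def\<close>)
  then show ?thesis by (rule that)
qed

section \<open>Error bounds for a single mode\<close>

lemma lam_ge: "1 \<le> i \<Longrightarrow> real i \<le> lam i" "1 \<le> i \<Longrightarrow> 1 \<le> lam i"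
proof -
  assume i: "1 \<le> i"
  have "real i * 1 \<le> real i * pi" using pi_gt3 by (intro mult_left_mono) auto
  then show "real i \<le> lam i" by (simp add: lam_def)
  then show "1 \<le> lam i" using i by linarith
qed

lemma funpow_deriv_sin:
  "(deriv ^^ k) (\<lambda>x. c * sin (a * x)) = (\<lambda>x :: real. c * a ^ k * sin (a * x + real k * (pi / 2)))"
proof (induction k)
  case (Suc k)
  have "deriv (\<lambda>x. c * a ^ k * sin (a * x + real k * (pi / 2)))
      = (\<lambda>x. c * a ^ Suc k * sin (a * x + real (Suc k) * (pi / 2)))"
  proof (rule deriv_eqI)
    fix x
    have "sin (a * x + real (Suc k) * (pi / 2)) = sin ((a * x + real k * (pi / 2)) + pi / 2)"
      by (simp add: algebra_simps add_divide_distrib)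
    also have "\<dots> = cos (a * x + real k * (pi / 2))" by (simp add: sin_add)
    finally show "((\<lambda>x. c * a ^ k * sin (a * x + real k * (pi / 2))) has_real_derivative
        c * a ^ Suc k * sin (a * x + real (Suc k) * (pi / 2))) (at x)"
      by (auto intro!: derivative_eq_intros)
  qed
  then show ?case by (simp add: Suc.IH)
qed simp

lemma smooth_eps: "smooth (eps i)"
  unfolding eps_def[abs_def] by (rule smooth_sin)

lemma eps_0_1 [simp]: "eps i 0 = 0" "eps i 1 = 0"
  by (simp_all add: eps_def lam_def sin_npi)

lemma eps_sobolev: "eps i \<in> sobolev s" "eps i \<in> sobolev_0_1" "eps i \<in> L2 D"
  by (simp_all add: smooth_eps smooth_sobolev smooth_sobolev_0_1 smooth_L2)

text \<open>Bounded through the maximum, which costs a factor sqrt 2 compared with the exact norm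
  and affects only constants.\<close>

lemma L2_norm_funpow_deriv_eps: "L2_norm D ((deriv ^^ k) (eps i)) \<le> sqrt 2 * lam i ^ k"
proof (rule bounded_L2_D(2))
  show "(deriv ^^ k) (eps i) \<in> borel_measurable (lebesgue_on D)"
    using smooth_L2[OF smooth_funpow_deriv[OF smooth_eps]] by (simp add: L2_def)
  fix x
  have "lam i \<ge> 0" by (simp add: lam_def)
  then show "\<bar>(deriv ^^ k) (eps i) x\<bar> \<le> sqrt 2 * lam i ^ k"
    unfolding eps_def[abs_def] funpow_deriv_sin by (simp add: abs_mult mult_left_le)
qed

lemma L2_norm_eps: "L2_norm D (eps i) \<le> sqrt 2"
  using L2_norm_funpow_deriv_eps[of 0 i] by simp

lemma sobolev_norm_eps: assumes "1 \<le> i" shows "sobolev_norm 3 (eps i) \<le> 4 * lam i ^ 3"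
proof -
  have "sobolev_norm 3 (eps i) \<le> sqrt (real (3 + 1)) * (sqrt 2 * lam i ^ 3)"
  proof (rule sobolev_norm_smooth_le[OF smooth_eps])
    fix k :: nat assume "k \<le> 3"
    then have "lam i ^ k \<le> lam i ^ 3" using lam_ge[OF assms] by (intro power_increasing) auto
    then have "sqrt 2 * lam i ^ k \<le> sqrt 2 * lam i ^ 3" by simp
    then show "L2_norm D ((deriv ^^ k) (eps i)) \<le> sqrt 2 * lam i ^ 3"
      using L2_norm_funpow_deriv_eps[of k i] by linarith
  qed
  also have "\<dots> = (2 * sqrt 2) * lam i ^ 3" by simp
  also have "\<dots> \<le> 4 * lam i ^ 3"
  proof (rule mult_right_mono)
    have "sqrt 2 \<le> 2" by (rule real_le_lsqrt) auto
    then show "2 * sqrt 2 \<le> 4" by simp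
  qed (use lam_ge[OF assms] in simp)
  finally show ?thesis .
qed

lemma eps_weak_deriv_2:
  assumes "u \<in> L2 D"
  shows "L2_inner D (weak_deriv 2 (eps i)) u = - (lam i)\<^sup>2 * L2_inner D (eps i) u"
proof -
  have "(deriv ^^ 2) (eps i) = (\<lambda>x. - (lam i)\<^sup>2 * eps i x)"
    unfolding eps_def[abs_def] funpow_deriv_sin by (simp add: fun_eq_iff)
  then have "AE x in lebesgue_on D. weak_deriv 2 (eps i) x = - (lam i)\<^sup>2 * eps i x"
    using weak_deriv_smooth_AE[OF smooth_eps[of i], of 2] by simp
  then have "L2_inner D (weak_deriv 2 (eps i)) u = L2_inner D (\<lambda>x. - (lam i)\<^sup>2 * eps i x) u"
    by (intro L2_inner_cong_AE weak_deriv_L2[OF eps_sobolev(1) order_refl] L2_cmult eps_sobolev assms)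
  then show ?thesis by (simp only: L2_inner_cmult)
qed

lemma eps_inner_weak_deriv:
  assumes "u \<in> sobolev 2" "u \<in> sobolev_0_1"
  shows "L2_inner D (eps i) (weak_deriv 2 u) = - (lam i)\<^sup>2 * L2_inner D (eps i) u"
  using weak_laplacian_symmetric[OF eps_sobolev(1,2) assms, of i] eps_weak_deriv_2[OF sobolev_L2[OF assms(1)], of i]
  by simp

text \<open>One second derivative acts on \<open>eps i\<close> directly; the other is moved over
  from u, whose boundary values remove the boundary terms.\<close>

lemma bending_eps:
  assumes "u \<in> sobolev 2" "u \<in> sobolev_0_1"
  shows "bending (eps i) u = (lam i) ^ 4 * L2_inner D (eps i) u"
  unfolding bending_def eps_weak_deriv_2[OF weak_deriv_L2[OF assms(1) order_refl]] eps_inner_weak_deriv[OF assms]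
  by simp

text \<open>\<open>y\<close> is the amplitude of the \<open>i\<close>-th mode of the exact solution and \<open>q n\<close> below its mean over the
  \<open>n\<close>-th time step.\<close>

locale mode =
  fixes \<mu> T :: real and i M :: nat and y Y G :: "real \<Rightarrow> real"
  assumes T: "0 < T" and i: "1 \<le> i" and M: "1 \<le> M"
    and y: "y = (\<lambda>t. exp (- ((lam i)\<^sup>2 * ((lam i)\<^sup>2 - \<mu>) * t)))"
    and Y: "\<And>t. (Y has_real_derivative y t) (at t)" "Y 0 = 0"
    and G: "\<And>t. (G has_real_derivative (y t)\<^sup>2) (at t)" "G 0 = 0"
begin

abbreviation "l \<equiv> lam i"
definition "\<kappa> = l\<^sup>2 * (l\<^sup>2 - \<mu>)"
definition "E = exp (\<mu>\<^sup>2 * T / 2)"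
definition "d = T / real M"
definition "\<tau> n = real n * d"
definition "q n = (Y (\<tau> n) - Y (\<tau> (n - 1))) / d"

lemma l1: "1 \<le> l" using lam_ge i by blast

lemma d: "0 < d" using T M by (simp add: d_def)

lemma \<tau>_0 [simp]: "\<tau> 0 = 0" by (simp add: \<tau>_def)

lemma \<tau>_M: "\<tau> M = T" using M by (simp add: \<tau>_def d_def)

lemma \<tau>_Suc: "\<tau> (Suc n) = \<tau> n + d" by (simp add: \<tau>_def algebra_simps)

lemma \<tau>_nonneg [simp]: "0 \<le> \<tau> n" using d by (simp add: \<tau>_def)

lemma \<tau>_step: "1 \<le> n \<Longrightarrow> \<tau> n = \<tau> (n - 1) + d"
  using \<tau>_Suc[of "n - 1"] by simp

lemma \<tau>_le: "n \<le> M \<Longrightarrow> \<tau> n \<le> T"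
proof -
  assume "n \<le> M"
  then have "\<tau> n \<le> \<tau> M" using d by (simp add: \<tau>_def)
  then show ?thesis by (simp only: \<tau>_M)
qed

lemma y_pos: "0 < y t" by (simp add: y)

lemma Y_mono: "s \<le> t \<Longrightarrow> Y s \<le> Y t"
  using Y(1) y_pos by (intro DERIV_nonneg_imp_nondecreasing[of s t Y]) (auto intro!: exI less_imp_le)

lemma G_mono: "s \<le> t \<Longrightarrow> G s \<le> G t"
  using G(1) by (intro DERIV_nonneg_imp_nondecreasing[of s t G]) (auto intro!: exI)

lemma Y_nonneg: "0 \<le> t \<Longrightarrow> 0 \<le> Y t" using Y_mono[of 0 t] Y(2) by simp

text \<open>The equation \<open>y' = - \<kappa> y\<close> integrated from 0: the exact counterpart
  of the summed scheme.\<close>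

lemma y_Y: "y t = 1 - \<kappa> * Y t"
proof -
  have "(y has_real_derivative y t * (- \<kappa>)) (at t)" for t
    unfolding y by (auto intro!: derivative_eq_intros simp: \<kappa>_def)
  then have "((\<lambda>t. y t + \<kappa> * Y t) has_real_derivative 0) (at t)" for t
    by (auto intro!: derivative_eq_intros Y)
  then have "y t + \<kappa> * Y t = y 0 + \<kappa> * Y 0"
    using DERIV_isconst_all[of "\<lambda>t. y t + \<kappa> * Y t" t 0] by blast
  then show ?thesis using Y(2) by (simp add: y)
qed

lemma \<kappa>_abs: "\<bar>\<kappa>\<bar> + \<bar>\<mu>\<bar> * l\<^sup>2 \<le> (1 + 2 * \<bar>\<mu>\<bar>) * l ^ 4"
proof -
  have "l\<^sup>2 \<le> l ^ 4" using l1 by (intro power_increasing) auto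
  then have 1: "\<bar>\<mu>\<bar> * l\<^sup>2 \<le> \<bar>\<mu>\<bar> * l ^ 4" by (intro mult_left_mono) auto
  have "\<kappa> = l ^ 4 - \<mu> * l\<^sup>2" by (simp add: \<kappa>_def algebra_simps flip: power_add)
  then have "\<bar>\<kappa>\<bar> \<le> \<bar>l ^ 4\<bar> + \<bar>\<mu> * l\<^sup>2\<bar>" by linarith
  then have "\<bar>\<kappa>\<bar> \<le> l ^ 4 + \<bar>\<mu>\<bar> * l\<^sup>2" by (simp add: abs_mult)
  then show ?thesis using 1 by (simp add: algebra_simps)
qed

text \<open>The rate \<kappa> is negative for modes with l^2 < \<mu>, so it cannot be used alone.
  From (l^2 - \<mu>)^2 >= 0 one gets \<kappa> >= l^4 / 2 - \<mu>^2 / 2, and the second part costs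
  the factor \<open>E\<close> on [0, T].\<close>

lemma y_le: assumes "0 \<le> t" "t \<le> T" shows "y t \<le> E * exp (- (l ^ 4 / 2) * t)"
proof -
  have "l ^ 4 / 2 - \<mu>\<^sup>2 / 2 \<le> \<kappa>"
    using zero_le_power2[of "l\<^sup>2 - \<mu>"] by (simp add: \<kappa>_def power2_diff algebra_simps flip: power_add power_mult)
  then have "(l ^ 4 / 2 - \<mu>\<^sup>2 / 2) * t \<le> \<kappa> * t" using assms by (intro mult_right_mono)
  moreover have "\<mu>\<^sup>2 * t \<le> \<mu>\<^sup>2 * T" using assms by (intro mult_left_mono) auto
  ultimately have "- (\<kappa> * t) \<le> \<mu>\<^sup>2 * T / 2 + (- (l ^ 4 / 2) * t)" by (simp add: algebra_simps)
  then show ?thesis unfolding y E_def \<kappa>_def by (simp flip: exp_add)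
qed

lemma E_pos: "0 < E" by (simp add: E_def)

text \<open>Replaces the comparison of integrals, since \<open>Y\<close> and \<open>G\<close> are
  given as antiderivatives normalised at 0.\<close>

lemma le_of_derivative_le:
  fixes f g :: "real \<Rightarrow> real"
  assumes "\<And>s. (f has_real_derivative f' s) (at s)" "\<And>s. (g has_real_derivative g' s) (at s)"
    "\<And>s. 0 \<le> s \<Longrightarrow> s \<le> t \<Longrightarrow> f' s \<le> g' s" "f 0 = 0" "g 0 = 0" "0 \<le> t"
  shows "f t \<le> g t"
proof -
  have "g 0 - f 0 \<le> g t - f t"
    using assms(3) by (intro DERIV_nonneg_imp_nondecreasing[of 0 t "\<lambda>s. g s - f s"] assms(6))
      (auto intro!: exI derivative_intros assms(1,2))
  then show ?thesis using assms by simp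
qed

lemma Y_le: assumes "0 \<le> t" "t \<le> T" shows "Y t \<le> 2 * E / l ^ 4"
proof -
  define c where "c = l ^ 4 / 2"
  have c: "0 < c" using l1 by (simp add: c_def)
  have "Y t \<le> E / c * (1 - exp (- c * t))"
  proof (rule le_of_derivative_le[OF Y(1)])
    fix s
    show "((\<lambda>t. E / c * (1 - exp (- c * t))) has_real_derivative E * exp (- c * s)) (at s)"
      using c by (auto intro!: derivative_eq_intros)
    assume "0 \<le> s" "s \<le> t" then show "y s \<le> E * exp (- c * s)" using y_le[of s] assms by (simp add: c_def)
  qed (use Y assms in auto)
  also have "\<dots> \<le> E / c * 1" using E_pos c by (intro mult_left_mono) auto
  finally show ?thesis by (simp add: c_def mult.commute)
qed

lemma G_le: assumes "0 \<le> t" "t \<le> T" shows "G t \<le> E\<^sup>2 / l ^ 4"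
proof -
  define c where "c = l ^ 4"
  have c: "0 < c" using l1 by (simp add: c_def)
  have "G t \<le> E\<^sup>2 / c * (1 - exp (- c * t))"
  proof (rule le_of_derivative_le[OF G(1)])
    fix s
    show "((\<lambda>t. E\<^sup>2 / c * (1 - exp (- c * t))) has_real_derivative E\<^sup>2 * exp (- c * s)) (at s)"
      using c by (auto intro!: derivative_eq_intros)
    assume "0 \<le> s" "s \<le> t"
    then have "(y s)\<^sup>2 \<le> (E * exp (- (c / 2) * s))\<^sup>2"
      using y_le[of s] assms y_pos[of s] by (intro power_mono) (auto simp: c_def)
    also have "\<dots> = E\<^sup>2 * exp (- c * s)"
      by (simp add: power_mult_distrib flip: exp_double)
    finally show "(y s)\<^sup>2 \<le> E\<^sup>2 * exp (- c * s)" .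
  qed (use G assms in auto)
  also have "\<dots> \<le> E\<^sup>2 / c * 1" using E_pos c by (intro mult_left_mono) auto
  finally show ?thesis by (simp add: c_def)
qed

lemma q_nonneg: "0 \<le> q n"
  using Y_mono[of "\<tau> (n - 1)" "\<tau> n"] d by (simp add: q_def \<tau>_def mult_right_mono)

lemma Y_diff: "Y (\<tau> n) - Y (\<tau> (n - 1)) = d * q n"
  using d by (simp add: q_def)

lemma Y_sum: "Y (\<tau> n) = (\<Sum>j\<in>{1..n}. d * q j)"
proof (induction n)
  case (Suc n)
  then show ?case using Y_diff[of "Suc n"] by simp
qed (simp add: Y)

text \<open>Cauchy-Schwarz for the integral of y over [a, b], in terms of antiderivatives: with p
  the mean of y, the nonnegative derivative (y - p)^2 is integrated.\<close>

lemma mean_square_le: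
  assumes "a \<le> b" shows "(Y b - Y a)\<^sup>2 \<le> (b - a) * (G b - G a)"
proof (cases "a = b")
  case False
  define p where "p = (Y b - Y a) / (b - a)"
  have "G a - 2 * p * Y a + p\<^sup>2 * a \<le> G b - 2 * p * Y b + p\<^sup>2 * b"
  proof (rule DERIV_nonneg_imp_nondecreasing[OF assms])
    fix x
    have "((\<lambda>x. G x - 2 * p * Y x + p\<^sup>2 * x) has_real_derivative (y x)\<^sup>2 - 2 * p * y x + p\<^sup>2) (at x)"
      by (auto intro!: derivative_eq_intros G Y)
    moreover have "(y x)\<^sup>2 - 2 * p * y x + p\<^sup>2 = (y x - p)\<^sup>2" by (simp add: power2_diff)
    ultimately show "\<exists>z. ((\<lambda>x. G x - 2 * p * Y x + p\<^sup>2 * x) has_real_derivative z) (at x) \<and> 0 \<le> z"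
      by auto
  qed
  then have "2 * p * (Y b - Y a) - p\<^sup>2 * (b - a) \<le> G b - G a" by (simp add: algebra_simps)
  moreover have "p * (b - a) = Y b - Y a" using False assms by (simp add: p_def)
  then have "2 * p * (Y b - Y a) - p\<^sup>2 * (b - a) = p * (Y b - Y a)"
    by (simp add: power2_eq_square algebra_simps flip: \<open>p * (b - a) = Y b - Y a\<close>)
  ultimately have "(b - a) * (p * (Y b - Y a)) \<le> (b - a) * (G b - G a)"
    using assms by (intro mult_left_mono) auto
  moreover have "(b - a) * (p * (Y b - Y a)) = (p * (b - a)) * (Y b - Y a)" by (simp add: ac_simps)
  ultimately show ?thesis
    unfolding \<open>p * (b - a) = Y b - Y a\<close> by (simp add: power2_eq_square)
qed simp

lemma q_square_sum: assumes "m \<le> M" shows "(\<Sum>n\<in>{1..m}. d * (q n)\<^sup>2) \<le> E\<^sup>2 / l ^ 4"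
proof -
  have "d * (q n)\<^sup>2 \<le> G (\<tau> n) - G (\<tau> (n - 1))" if n: "1 \<le> n" for n
  proof -
    have "(d * q n)\<^sup>2 \<le> d * (G (\<tau> n) - G (\<tau> (n - 1)))"
      using mean_square_le[of "\<tau> (n - 1)" "\<tau> n"] \<tau>_step[OF n] d by (simp flip: Y_diff)
    then have "d * (d * (q n)\<^sup>2) \<le> d * (G (\<tau> n) - G (\<tau> (n - 1)))" by (simp add: power2_eq_square ac_simps)
    then show ?thesis using d by simp
  qed
  then have "(\<Sum>n\<in>{1..m}. d * (q n)\<^sup>2) \<le> (\<Sum>n\<in>{1..m}. G (\<tau> n) - G (\<tau> (n - 1)))"
    by (intro sum_mono) auto
  also have "\<dots> = G (\<tau> m)" by (induction m) (simp_all add: G)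
  also have "\<dots> \<le> E\<^sup>2 / l ^ 4" using \<tau>_le[OF assms] by (intro G_le) auto
  finally show ?thesis .
qed

text \<open>The mean \<open>q n\<close> is a value of y within the step, and differences of y are
  \<kappa> times differences of \<open>Y\<close>. The bound involves \<open>q n\<close> itself and
  not a maximum of y, so that its squares can be summed by \<open>q_square_sum\<close>.\<close>

lemma oscillation:
  assumes n: "1 \<le> n" and t: "\<tau> (n - 1) \<le> t" "t \<le> \<tau> n"
  shows "\<bar>y t - q n\<bar> \<le> \<bar>\<kappa>\<bar> * (d * q n)"
proof -
  have "\<tau> (n - 1) < \<tau> n" using \<tau>_step[OF n] d by simp
  then obtain s where s: "\<tau> (n - 1) < s" "s < \<tau> n" "Y (\<tau> n) - Y (\<tau> (n - 1)) = (\<tau> n - \<tau> (n - 1)) * y s"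
    using MVT2[of "\<tau> (n - 1)" "\<tau> n" Y y] Y(1) by blast
  then have "d * q n = d * y s" using \<tau>_step[OF n] Y_diff[of n] by simp
  then have qs: "q n = y s" using d by simp
  have "\<bar>Y s - Y t\<bar> \<le> d * q n"
    unfolding Y_diff[symmetric] using Y_mono[of "\<tau> (n - 1)" s] Y_mono[of s "\<tau> n"]
      Y_mono[of "\<tau> (n - 1)" t] Y_mono[of t "\<tau> n"] s t by linarith
  moreover have "y t - q n = \<kappa> * (Y s - Y t)" unfolding qs y_Y by (simp add: algebra_simps)
  ultimately show ?thesis by (simp add: abs_mult mult_left_mono)
qed

text \<open>The residual of the means q in the summed scheme. The \<mu> term appears because the
  scheme takes the second-order term one step earlier, where \<open>Y\<close> is smaller by d times
  \<open>q n\<close>.\<close>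

lemma oscillation_end:
  assumes n: "1 \<le> n"
  shows "\<bar>y (\<tau> n) - q n - \<mu> * l\<^sup>2 * (d * q n)\<bar> \<le> (1 + 2 * \<bar>\<mu>\<bar>) * l ^ 4 * (d * q n)"
proof -
  have "\<bar>y (\<tau> n) - q n - \<mu> * l\<^sup>2 * (d * q n)\<bar> \<le> \<bar>\<kappa>\<bar> * (d * q n) + \<bar>\<mu>\<bar> * l\<^sup>2 * (d * q n)"
    using oscillation[OF n, of "\<tau> n"] \<tau>_step[OF n] d q_nonneg[of n]
    by (auto simp: abs_mult intro!: order_trans[OF abs_triangle_ineq4] add_mono)
  also have "\<dots> = (\<bar>\<kappa>\<bar> + \<bar>\<mu>\<bar> * l\<^sup>2) * (d * q n)" by (simp add: algebra_simps)
  also have "\<dots> \<le> (1 + 2 * \<bar>\<mu>\<bar>) * l ^ 4 * (d * q n)"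
    using \<kappa>_abs d q_nonneg[of n] by (intro mult_right_mono) auto
  finally show ?thesis .
qed

text \<open>As \<open>eps i\<close> is an eigenfunction, pairing it with \<zeta> gains l^-2 against
  the second derivative of \<zeta>; so \<beta> in the energy estimate is sqrt 2 / l^2. The 12 is 2 *
  4 for the response plus 4 for the exact means.\<close>

lemma response_stability:
  assumes fe: "fe_space r h S" and V: "impulse_response d \<mu> S (eps i) V"
  shows "(\<Sum>n\<in>{1..M}. d * (L2_norm D (\<lambda>x. V n x - q n * eps i x))\<^sup>2) \<le> 12 * exp (4 * \<mu>\<^sup>2 * T) / l ^ 4"
proof -
  have VS: "V n \<in> S" for n using V by (simp add: impulse_response_def)
  have \<beta>: "\<bar>L2_inner D (eps i) \<zeta>\<bar> \<le> (sqrt 2 / l\<^sup>2) * L2_norm D (weak_deriv 2 \<zeta>)" if \<zeta>: "\<zeta> \<in> S" for \<zeta>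
  proof -
    have "l\<^sup>2 * \<bar>L2_inner D (eps i) \<zeta>\<bar> = \<bar>L2_inner D (eps i) (weak_deriv 2 \<zeta>)\<bar>"
      using eps_inner_weak_deriv[OF fe_spaceD(1,2)[OF fe \<zeta>], of i] by (simp add: abs_mult)
    also have "\<dots> \<le> L2_norm D (eps i) * L2_norm D (weak_deriv 2 \<zeta>)"
      by (intro L2_Cauchy_Schwarz eps_sobolev weak_deriv_L2[OF fe_spaceD(1)[OF fe \<zeta>] order_refl])
    also have "\<dots> \<le> sqrt 2 * L2_norm D (weak_deriv 2 \<zeta>)"
      by (intro mult_right_mono L2_norm_eps) simp
    finally show ?thesis using l1 by (simp add: field_simps)
  qed
  have "(\<Sum>n\<in>{1..M}. d * (L2_norm D (V n))\<^sup>2)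
      \<le> 2 * ((sqrt 2 / l\<^sup>2)\<^sup>2 + (\<Sum>n\<in>{1..M}. d * 0\<^sup>2)) * exp (4 * \<mu>\<^sup>2 * T)"
    using V VS \<beta> d \<tau>_M
    by (intro energy_estimate[OF fe d, of M T V "\<lambda>n x. \<Sum>j\<in>{1..n}. d * V j x" \<mu> "eps i" "\<lambda>n \<zeta>. 0"])
      (auto simp: impulse_response_def \<tau>_def eps_sobolev)
  also have "\<dots> = 4 * exp (4 * \<mu>\<^sup>2 * T) / l ^ 4"
    by (simp add: power_divide flip: power_mult)
  finally have 1: "(\<Sum>n\<in>{1..M}. d * (L2_norm D (V n))\<^sup>2) \<le> 4 * exp (4 * \<mu>\<^sup>2 * T) / l ^ 4" .
  have "d * (L2_norm D (\<lambda>x. V n x - q n * eps i x))\<^sup>2 \<le> 2 * (d * (L2_norm D (V n))\<^sup>2) + 4 * (d * (q n)\<^sup>2)" for n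
  proof -
    have "(L2_norm D (\<lambda>x. V n x + (- q n) * eps i x))\<^sup>2
        \<le> 2 * (L2_norm D (V n))\<^sup>2 + 2 * (L2_norm D (\<lambda>x. (- q n) * eps i x))\<^sup>2"
      by (intro L2_norm_square_add_le L2_cmult eps_sobolev fe_space_L2[OF fe VS])
    also have "(L2_norm D (\<lambda>x. (- q n) * eps i x))\<^sup>2 = (q n)\<^sup>2 * (L2_norm D (eps i))\<^sup>2"
      by (subst L2_norm_cmult) (simp add: power_mult_distrib)
    also have "\<dots> \<le> (q n)\<^sup>2 * (sqrt 2)\<^sup>2"
      by (intro mult_left_mono power_mono L2_norm_eps) auto
    finally have "(L2_norm D (\<lambda>x. V n x - q n * eps i x))\<^sup>2 \<le> 2 * (L2_norm D (V n))\<^sup>2 + 4 * (q n)\<^sup>2" by simp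
    then have "d * (L2_norm D (\<lambda>x. V n x - q n * eps i x))\<^sup>2 \<le> d * (2 * (L2_norm D (V n))\<^sup>2 + 4 * (q n)\<^sup>2)"
      using d by (intro mult_left_mono) auto
    then show ?thesis by (simp add: algebra_simps)
  qed
  then have "(\<Sum>n\<in>{1..M}. d * (L2_norm D (\<lambda>x. V n x - q n * eps i x))\<^sup>2)
      \<le> (\<Sum>n\<in>{1..M}. 2 * (d * (L2_norm D (V n))\<^sup>2) + 4 * (d * (q n)\<^sup>2))" by (intro sum_mono)
  also have "\<dots> = 2 * (\<Sum>n\<in>{1..M}. d * (L2_norm D (V n))\<^sup>2) + 4 * (\<Sum>n\<in>{1..M}. d * (q n)\<^sup>2)"
    by (simp only: sum.distrib sum_distrib_left)
  also have "\<dots> \<le> 2 * (4 * exp (4 * \<mu>\<^sup>2 * T) / l ^ 4) + 4 * (E\<^sup>2 / l ^ 4)"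
    using 1 q_square_sum[of M] by linarith
  also have "E\<^sup>2 \<le> exp (4 * \<mu>\<^sup>2 * T)"
    using T by (simp add: E_def flip: exp_double)
  then have "2 * (4 * exp (4 * \<mu>\<^sup>2 * T) / l ^ 4) + 4 * (E\<^sup>2 / l ^ 4)
      \<le> 2 * (4 * exp (4 * \<mu>\<^sup>2 * T) / l ^ 4) + 4 * (exp (4 * \<mu>\<^sup>2 * T) / l ^ 4)"
    using l1 by (intro add_left_mono mult_left_mono divide_right_mono) auto
  finally show ?thesis by (simp add: add_divide_distrib[symmetric])
qed

end

text \<open>The constant of \<open>response_convergence\<close>. The first summand, 2592 = 2 * 36^2,
  is the Ritz error of the exact means; the second is the energy estimate, with one summand in the
  bracket for the time residual, for the Ritz error and for its second derivative.\<close>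

definition mode_const :: "real \<Rightarrow> real \<Rightarrow> real \<Rightarrow> real" where
  "mode_const T \<mu> C = 2592 * C ^ 4 * exp (4 * \<mu>\<^sup>2 * T) + 12 * (exp (4 * \<mu>\<^sup>2 * T))\<^sup>2 *
     (2 * (1 + 2 * \<bar>\<mu>\<bar>)\<^sup>2 + 1296 * C ^ 4 + 64 * T * \<mu>\<^sup>2 * C\<^sup>2)"

lemma power2_sum3_le: "(a + b + c :: real)\<^sup>2 \<le> 3 * (a\<^sup>2 + b\<^sup>2 + c\<^sup>2)"
  using sum_squares_bound[of a b] sum_squares_bound[of a c] sum_squares_bound[of b c]
  by (simp add: power2_eq_square algebra_simps)

context mode
begin

lemma E_square_le: "E\<^sup>2 \<le> exp (4 * \<mu>\<^sup>2 * T)"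
  using T by (simp add: E_def flip: exp_double)

text \<open>By the choice of the Ritz projection w, the bending term produces no error for \<theta>.
  What remains is f: the time residual g, the projection error \<rho>, and the second derivative of
  \<rho>, which enters through the \<mu> term.\<close>

lemma response_convergence:
  assumes fe: "fe_space r h S" and ap: "approximation_property r C h S" and r: "r = 2 \<or> r = 3" and C: "0 < C"
    and V: "impulse_response d \<mu> S (eps i) V"
  shows "(\<Sum>n\<in>{1..M}. d * (L2_norm D (\<lambda>x. V n x - q n * eps i x))\<^sup>2)
    \<le> mode_const T \<mu> C / l ^ 4 * (d\<^sup>2 * l ^ 8 + h ^ (2 * r) * l ^ 6 + h\<^sup>2 * l\<^sup>2)"
proof -
  note s2 = fe_spaceD(1)[OF fe] note s01 = fe_spaceD(2)[OF fe] note L2 = fe_space_L2[OF fe]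
  have h: "0 < h" using fe_space_mesh[OF fe] by simp
  have VS: "V n \<in> S" for n using V by (simp add: impulse_response_def)
  obtain w where w: "w \<in> S" "\<And>\<zeta>. \<zeta> \<in> S \<Longrightarrow> bending w \<zeta> = bending (eps i) \<zeta>"
    using fe_space_ritz[OF fe eps_sobolev(1)] by blast
  define \<rho> where "\<rho> x = w x - eps i x" for x
  have w_eq: "w = (\<lambda>x. 1 * eps i x + 1 * \<rho> x)" by (simp add: \<rho>_def)
  have \<rho>2: "\<rho> \<in> sobolev 2" unfolding \<rho>_def[abs_def] by (intro sobolev_diff s2 w eps_sobolev)
  have \<rho>01: "\<rho> \<in> sobolev_0_1"
    unfolding sobolev_0_1_def
  proof (intro CollectI conjI allI impI sobolev_mono[OF \<rho>2])
    fix e :: real assume e: "0 < e"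
    have half: "\<exists>\<eta>. test_function \<eta> \<and> sobolev_norm 1 (\<lambda>x. f x - \<eta> x) < e / 2" if "f \<in> sobolev_0_1" for f
      using that e half_gt_zero[OF e] unfolding sobolev_0_1_def by blast
    obtain \<eta>1 where 1: "test_function \<eta>1" "sobolev_norm 1 (\<lambda>x. w x - \<eta>1 x) < e / 2"
      using half[OF s01[OF w(1)]] by blast
    obtain \<eta>2 where 2: "test_function \<eta>2" "sobolev_norm 1 (\<lambda>x. eps i x - \<eta>2 x) < e / 2"
      using half[OF eps_sobolev(2)] by blast
    define \<eta> where "\<eta> x = 1 * \<eta>1 x + (-1) * \<eta>2 x" for x
    have \<eta>: "test_function \<eta>" unfolding \<eta>_def[abs_def] by (intro test_function_lincomb 1 2)
    have "sobolev_norm 1 (\<lambda>x. \<rho> x - \<eta> x)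
        = sobolev_norm 1 (\<lambda>x. (w x - \<eta>1 x) - (eps i x - \<eta>2 x))"
      by (simp add: \<rho>_def \<eta>_def algebra_simps)
    also have "\<dots> \<le> sobolev_norm 1 (\<lambda>x. w x - \<eta>1 x) + sobolev_norm 1 (\<lambda>x. eps i x - \<eta>2 x)"
      by (intro sobolev_norm_diff_le sobolev_diff sobolev_mono[OF s2[OF w(1)]] eps_sobolev smooth_sobolev
          test_function_smooth 1 2) simp
    finally have "sobolev_norm 1 (\<lambda>x. \<rho> x - \<eta> x) < e" using 1 2 by simp
    then show "\<exists>\<eta>. test_function \<eta> \<and> sobolev_norm 1 (\<lambda>x. \<rho> x - \<eta> x) < e" using \<eta> by blast
  qed simp
  \<comment> \<open>Bounds for the second derivative and for the values of \<rho>. Order s = 3 with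
    the norm bound 4 l^3 of \<open>eps i\<close> gives a2; duality multiplies it by 9 C h^(r-1),
    which is a0.\<close>
  define a2 where "a2 = 4 * C * h * l ^ 3"
  define a0 where "a0 = 36 * C\<^sup>2 * h ^ r * l ^ 3"
  define n2 where "n2 = L2_norm D (weak_deriv 2 \<rho>)"
  define n0 where "n0 = L2_norm D \<rho>"
  have n_nonneg: "0 \<le> n0" "0 \<le> n2" by (simp_all add: n0_def n2_def)
  have "n2 \<le> C * h ^ (3 - 2) * sobolev_norm 3 (eps i)"
    unfolding n2_def \<rho>_def[abs_def] using r
    by (intro fe_space_best_approximation[OF fe ap _ eps_sobolev(1,2) w]) auto
  also have "\<dots> \<le> C * h ^ (3 - 2) * (4 * l ^ 3)"
    using C h by (intro mult_left_mono sobolev_norm_eps i) auto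
  finally have n2: "n2 \<le> a2" by (simp add: a2_def ac_simps)
  have "bending \<rho> \<zeta> = 0" if "\<zeta> \<in> S" for \<zeta>
    unfolding \<rho>_def[abs_def] using w(2)[OF that] bending_diff(1)[OF s2[OF w(1)] eps_sobolev(1) s2[OF that]] by simp
  then have "n0 \<le> 9 * C * h ^ (r - 1) * n2"
    unfolding n0_def n2_def by (intro fe_space_duality[OF fe ap r C \<rho>2 \<rho>01])
  also have "\<dots> \<le> 9 * C * h ^ (r - 1) * a2" using C h n2 by (intro mult_left_mono) auto
  also have "\<dots> = a0" using r by (auto simp: a0_def a2_def power2_eq_square power3_eq_cube)
  finally have n0: "n0 \<le> a0" .
  define g where "g n = y (\<tau> n) - q n - \<mu> * l\<^sup>2 * (d * q n)" for n
  define \<theta> where "\<theta> n x = 1 * V n x + (- q n) * w x" for n x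
  define \<Theta> where "\<Theta> n x = (\<Sum>j\<in>{1..n}. d * \<theta> j x)" for n x
  define Z where "Z n x = (\<Sum>j\<in>{1..n}. d * V j x)" for n x
  have \<theta>S: "\<theta> n \<in> S" for n unfolding \<theta>_def[abs_def] by (intro fe_spaceD(4)[OF fe] VS w)
  have ZS: "Z n \<in> S" for n unfolding Z_def[abs_def] by (intro fe_space_sum[OF fe] VS)
  have \<Theta>_eq: "\<Theta> n = (\<lambda>x. 1 * Z n x + (- Y (\<tau> n)) * w x)" for n
    by (simp add: \<Theta>_def Z_def \<theta>_def Y_sum fun_eq_iff algebra_simps sum.distrib sum_subtractf sum_distrib_left)
  define f where "f n \<zeta> = g n * L2_inner D (eps i) \<zeta> - q n * L2_inner D \<rho> \<zeta>
    - \<mu> * Y (\<tau> (n - 1)) * L2_inner D (weak_deriv 2 \<rho>) \<zeta>" for n \<zeta>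
  have eq: "L2_inner D (\<theta> n) \<zeta> + bending (\<Theta> n) \<zeta> + \<mu> * L2_inner D (weak_deriv 2 (\<Theta> (n - 1))) \<zeta>
      = L2_inner D (\<lambda>x. 0) \<zeta> + f n \<zeta>" if n: "n \<in> {1..M}" and \<zeta>: "\<zeta> \<in> S" for n \<zeta>
  proof -
    define e where "e = L2_inner D (eps i) \<zeta>"
    define rr where "rr = L2_inner D \<rho> \<zeta>"
    define r2 where "r2 = L2_inner D (weak_deriv 2 \<rho>) \<zeta>"
    have w0: "L2_inner D w \<zeta> = e + rr"
      unfolding e_def rr_def
      by (subst w_eq, subst L2_inner_lincomb) (simp_all add: eps_sobolev sobolev_L2[OF \<rho>2] L2[OF \<zeta>])
    have w2: "L2_inner D (weak_deriv 2 w) \<zeta> = - l\<^sup>2 * e + r2"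
      unfolding e_def r2_def eps_weak_deriv_2[OF L2[OF \<zeta>], symmetric]
      by (subst w_eq, subst L2_inner_weak_deriv_lincomb[where s = 2]) (simp_all add: eps_sobolev \<rho>2 L2[OF \<zeta>])
    have wb: "bending w \<zeta> = l ^ 4 * e"
      using w(2)[OF \<zeta>] bending_eps[OF s2[OF \<zeta>] s01[OF \<zeta>], of i] by (simp add: e_def)
    have V_eq: "L2_inner D (V n) \<zeta> + bending (Z n) \<zeta> + \<mu> * L2_inner D (weak_deriv 2 (Z (n - 1))) \<zeta> = e"
      using V n \<zeta> by (simp add: impulse_response_def Z_def[abs_def] e_def)
    have 1: "L2_inner D (\<theta> n) \<zeta> = L2_inner D (V n) \<zeta> - q n * (e + rr)"
      unfolding \<theta>_def[abs_def] L2_inner_lincomb[OF L2[OF VS] L2[OF w(1)] L2[OF \<zeta>]] w0 by simp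
    have 2: "bending (\<Theta> n) \<zeta> = bending (Z n) \<zeta> - Y (\<tau> n) * (l ^ 4 * e)"
      unfolding \<Theta>_eq bending_lincomb[OF s2[OF ZS] s2[OF w(1)] s2[OF \<zeta>]] wb by simp
    have 3: "L2_inner D (weak_deriv 2 (\<Theta> (n - 1))) \<zeta>
        = L2_inner D (weak_deriv 2 (Z (n - 1))) \<zeta> - Y (\<tau> (n - 1)) * (- l\<^sup>2 * e + r2)"
      unfolding \<Theta>_eq L2_inner_weak_deriv_lincomb[OF s2[OF ZS] s2[OF w(1)] order_refl L2[OF \<zeta>]] w2 by simp
    have Yn: "Y (\<tau> (n - 1)) = Y (\<tau> n) - d * q n" using Y_diff[of n] by simp
    \<comment> \<open>Splitting \<kappa> into l^4 and - \<mu> l^2 shows g as the residual of the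
      means, with the lower-order term at step n - 1 as in the scheme.\<close>
    have "g n = 1 - \<kappa> * Y (\<tau> n) - q n - \<mu> * l\<^sup>2 * (d * q n)" by (simp add: g_def y_Y)
    also have "\<dots> = 1 - q n - Y (\<tau> n) * l ^ 4 + \<mu> * l\<^sup>2 * (Y (\<tau> n) - d * q n)"
      by (simp add: \<kappa>_def algebra_simps flip: power_add)
    finally have gn: "g n = 1 - q n - Y (\<tau> n) * l ^ 4 + \<mu> * l\<^sup>2 * Y (\<tau> (n - 1))" by (simp only: Yn)
    show ?thesis
      unfolding 1 2 3 f_def gn e_def[symmetric] rr_def[symmetric] r2_def[symmetric] L2_inner_zero
      using V_eq by (simp add: algebra_simps)
  qed
  define \<phi> where "\<phi> n = sqrt 2 * \<bar>g n\<bar> + q n * n0 + \<bar>\<mu>\<bar> * Y (\<tau> (n - 1)) * n2" for n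
  have f: "\<bar>f n \<zeta>\<bar> \<le> \<phi> n * L2_norm D \<zeta>" if n: "n \<in> {1..M}" and \<zeta>: "\<zeta> \<in> S" for n \<zeta>
  proof -
    define z where "z = L2_norm D \<zeta>"
    have z: "0 \<le> z" by (simp add: z_def)
    have "\<bar>L2_inner D (eps i) \<zeta>\<bar> \<le> L2_norm D (eps i) * z"
      unfolding z_def by (intro L2_Cauchy_Schwarz eps_sobolev L2 \<zeta>)
    also have "\<dots> \<le> sqrt 2 * z" by (intro mult_right_mono L2_norm_eps z)
    finally have 1: "\<bar>g n * L2_inner D (eps i) \<zeta>\<bar> \<le> \<bar>g n\<bar> * (sqrt 2 * z)"
      unfolding abs_mult by (intro mult_left_mono) auto
    have "\<bar>L2_inner D \<rho> \<zeta>\<bar> \<le> n0 * z"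
      unfolding z_def n0_def by (intro L2_Cauchy_Schwarz sobolev_L2[OF \<rho>2] L2 \<zeta>)
    then have 2: "\<bar>q n * L2_inner D \<rho> \<zeta>\<bar> \<le> q n * (n0 * z)"
      using q_nonneg[of n] by (simp add: abs_mult mult_left_mono)
    have "\<bar>L2_inner D (weak_deriv 2 \<rho>) \<zeta>\<bar> \<le> n2 * z"
      unfolding z_def n2_def by (intro L2_Cauchy_Schwarz weak_deriv_L2[OF \<rho>2 order_refl] L2 \<zeta>)
    then have 3: "\<bar>\<mu> * Y (\<tau> (n - 1)) * L2_inner D (weak_deriv 2 \<rho>) \<zeta>\<bar> \<le> \<bar>\<mu>\<bar> * Y (\<tau> (n - 1)) * (n2 * z)"
      using Y_nonneg[of "\<tau> (n - 1)"] by (simp add: abs_mult mult_left_mono)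
    have "\<bar>f n \<zeta>\<bar> \<le> \<bar>g n\<bar> * (sqrt 2 * z) + q n * (n0 * z) + \<bar>\<mu>\<bar> * Y (\<tau> (n - 1)) * (n2 * z)"
      unfolding f_def using 1 2 3 by linarith
    also have "\<dots> = \<phi> n * z" by (simp add: \<phi>_def algebra_simps)
    finally show ?thesis by (simp add: z_def)
  qed
  have en: "(\<Sum>n\<in>{1..M}. d * (L2_norm D (\<theta> n))\<^sup>2) \<le> 2 * (0\<^sup>2 + (\<Sum>n\<in>{1..M}. d * (\<phi> n)\<^sup>2)) * exp (4 * \<mu>\<^sup>2 * T)"
  proof (rule energy_estimate[where \<Theta> = \<Theta> and e = "\<lambda>x. 0" and f = f and S = S and M = M, OF fe d])
    show "\<theta> n \<in> S" for n by (rule \<theta>S)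
    show "L2_inner D (\<theta> n) \<zeta> + bending (\<Theta> n) \<zeta> + \<mu> * L2_inner D (weak_deriv 2 (\<Theta> (n - 1))) \<zeta>
      = L2_inner D (\<lambda>x. 0) \<zeta> + f n \<zeta>" if "n \<in> {1..M}" "\<zeta> \<in> S" for n \<zeta> using eq that .
    show "real M * d \<le> T" using \<tau>_M by (simp add: \<tau>_def)
    show "\<Theta> n = (\<lambda>x. \<Sum>j\<in>{1..n}. d * \<theta> j x)" for n by (simp add: \<Theta>_def fun_eq_iff)
    show "\<bar>f n \<zeta>\<bar> \<le> \<phi> n * L2_norm D \<zeta>" if "n \<in> {1..M}" "\<zeta> \<in> S" for n \<zeta> using f that .
  qed auto
  define c1 where "c1 = 1 + 2 * \<bar>\<mu>\<bar>"
  have phi_sq: "d * (\<phi> n)\<^sup>2 \<le> (6 * c1\<^sup>2 * (d\<^sup>2 * l ^ 8) + 3 * a0\<^sup>2) * (d * (q n)\<^sup>2)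
      + d * (3 * \<mu>\<^sup>2 * (4 * E\<^sup>2 / l ^ 8) * a2\<^sup>2)" if n: "n \<in> {1..M}" for n
  proof -
    have "\<bar>g n\<bar> \<le> c1 * l ^ 4 * (d * q n)"
      using oscillation_end[of n] n by (simp add: g_def c1_def)
    then have "\<bar>g n\<bar>\<^sup>2 \<le> (c1 * l ^ 4 * (d * q n))\<^sup>2" by (intro power_mono) auto
    then have 1: "(sqrt 2 * \<bar>g n\<bar>)\<^sup>2 \<le> 2 * c1\<^sup>2 * (d\<^sup>2 * l ^ 8) * (q n)\<^sup>2"
      by (simp add: power_mult_distrib mult_ac flip: power_mult)
    have "q n * n0 \<le> q n * a0" using n0 q_nonneg by (intro mult_left_mono) auto
    then have "(q n * n0)\<^sup>2 \<le> (q n * a0)\<^sup>2" using q_nonneg n_nonneg by (intro power_mono) auto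
    then have 2: "(q n * n0)\<^sup>2 \<le> a0\<^sup>2 * (q n)\<^sup>2" by (simp add: power_mult_distrib mult.commute)
    have "n - 1 \<le> M" using n by auto
    then have "Y (\<tau> (n - 1)) \<le> 2 * E / l ^ 4" by (intro Y_le \<tau>_le) auto
    then have "(Y (\<tau> (n - 1)))\<^sup>2 \<le> (2 * E / l ^ 4)\<^sup>2" using Y_nonneg[of "\<tau> (n - 1)"] by (intro power_mono) auto
    then have "(Y (\<tau> (n - 1)))\<^sup>2 * n2\<^sup>2 \<le> (2 * E / l ^ 4)\<^sup>2 * a2\<^sup>2"
      using power_mono[OF n2, of 2] n_nonneg by (intro mult_mono) auto
    then have "\<mu>\<^sup>2 * ((Y (\<tau> (n - 1)))\<^sup>2 * n2\<^sup>2) \<le> \<mu>\<^sup>2 * ((2 * E / l ^ 4)\<^sup>2 * a2\<^sup>2)" by (intro mult_left_mono) auto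
    then have 3: "(\<bar>\<mu>\<bar> * Y (\<tau> (n - 1)) * n2)\<^sup>2 \<le> \<mu>\<^sup>2 * (4 * E\<^sup>2 / l ^ 8) * a2\<^sup>2"
      by (simp add: power_mult_distrib power_divide mult.assoc flip: power_mult)
    have "(\<phi> n)\<^sup>2 \<le> 3 * (2 * c1\<^sup>2 * (d\<^sup>2 * l ^ 8) * (q n)\<^sup>2 + a0\<^sup>2 * (q n)\<^sup>2 + \<mu>\<^sup>2 * (4 * E\<^sup>2 / l ^ 8) * a2\<^sup>2)"
      using power2_sum3_le[of "sqrt 2 * \<bar>g n\<bar>" "q n * n0" "\<bar>\<mu>\<bar> * Y (\<tau> (n - 1)) * n2"] 1 2 3
      unfolding \<phi>_def by argo
    then have "d * (\<phi> n)\<^sup>2 \<le> d * (3 * (2 * c1\<^sup>2 * (d\<^sup>2 * l ^ 8) * (q n)\<^sup>2 + a0\<^sup>2 * (q n)\<^sup>2 + \<mu>\<^sup>2 * (4 * E\<^sup>2 / l ^ 8) * a2\<^sup>2))"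
      using d by (intro mult_left_mono) auto
    also have "\<dots> = (6 * c1\<^sup>2 * (d\<^sup>2 * l ^ 8) + 3 * a0\<^sup>2) * (d * (q n)\<^sup>2)
      + d * (3 * \<mu>\<^sup>2 * (4 * E\<^sup>2 / l ^ 8) * a2\<^sup>2)" by (simp add: distrib_left distrib_right mult_ac)
    finally show ?thesis .
  qed
  define Ex where "Ex = exp (4 * \<mu>\<^sup>2 * T)"
  have Ex: "0 < Ex" "E\<^sup>2 \<le> Ex" using E_square_le by (simp_all add: Ex_def)
  \<comment> \<open>The shares of g, of \<rho> and of its second derivative. In the last,
    \<open>Y\<close> is of order l^-4, and (h l^3)^2 l^-8 = l^-4 X3.\<close>
  define X1 where "X1 = d\<^sup>2 * l ^ 8"
  define X2 where "X2 = h ^ (2 * r) * l ^ 6"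
  define X3 where "X3 = h\<^sup>2 * l\<^sup>2"
  have X: "0 \<le> X1" "0 \<le> X2" "0 \<le> X3" using h by (simp_all add: X1_def X2_def X3_def)
  have a0: "a0\<^sup>2 = 1296 * C ^ 4 * X2"
    by (simp add: a0_def X2_def power_mult_distrib mult_ac flip: power_mult)
  have a2: "a2\<^sup>2 = 16 * C\<^sup>2 * (l ^ 4 * X3)"
    by (simp add: a2_def X3_def power_mult_distrib mult_ac flip: power_mult power_add)
  have q2: "(\<Sum>n\<in>{1..M}. d * (q n)\<^sup>2) \<le> Ex / l ^ 4"
    using q_square_sum[of M] Ex(2) l1 by (meson order_refl order_trans divide_right_mono zero_le_power zero_le_one)
  have "(\<Sum>n\<in>{1..M}. d * (\<phi> n)\<^sup>2) \<le> (\<Sum>n\<in>{1..M}. (6 * c1\<^sup>2 * X1 + 3 * a0\<^sup>2) * (d * (q n)\<^sup>2)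
      + d * (3 * \<mu>\<^sup>2 * (4 * E\<^sup>2 / l ^ 8) * a2\<^sup>2))"
    unfolding X1_def by (intro sum_mono phi_sq)
  also have "\<dots> = (6 * c1\<^sup>2 * X1 + 3 * a0\<^sup>2) * (\<Sum>n\<in>{1..M}. d * (q n)\<^sup>2)
      + T * (3 * \<mu>\<^sup>2 * (4 * E\<^sup>2 / l ^ 8) * a2\<^sup>2)"
    using M by (simp add: sum.distrib sum_distrib_left d_def)
  also have "\<dots> \<le> (6 * c1\<^sup>2 * X1 + 3 * a0\<^sup>2) * (Ex / l ^ 4) + T * (3 * \<mu>\<^sup>2 * (4 * Ex / l ^ 8) * a2\<^sup>2)"
    using X T Ex l1 by (intro add_mono mult_left_mono mult_right_mono divide_right_mono q2) auto
  also have "\<dots> = Ex / l ^ 4 * (6 * c1\<^sup>2 * X1 + 3888 * C ^ 4 * X2 + 192 * T * \<mu>\<^sup>2 * C\<^sup>2 * X3)"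
  proof -
    have "l ^ 8 = l ^ 4 * l ^ 4" by (simp flip: power_add)
    then show ?thesis using l1 unfolding a0 a2 by (simp add: field_simps)
  qed
  finally have P: "(\<Sum>n\<in>{1..M}. d * (\<phi> n)\<^sup>2)
    \<le> Ex / l ^ 4 * (6 * c1\<^sup>2 * X1 + 3888 * C ^ 4 * X2 + 192 * T * \<mu>\<^sup>2 * C\<^sup>2 * X3)" .
  define K where "K = 2 * c1\<^sup>2 + 1296 * C ^ 4 + 64 * T * \<mu>\<^sup>2 * C\<^sup>2"
  have Tn: "0 \<le> 64 * T * \<mu>\<^sup>2 * C\<^sup>2" using T by simp
  have "6 * c1\<^sup>2 * X1 + 3888 * C ^ 4 * X2 + 192 * T * \<mu>\<^sup>2 * C\<^sup>2 * X3 \<le> 3 * K * X1 + 3 * K * X2 + 3 * K * X3"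
    using X Tn C unfolding K_def by (intro add_mono mult_right_mono) auto
  then have P': "(\<Sum>n\<in>{1..M}. d * (\<phi> n)\<^sup>2) \<le> Ex / l ^ 4 * (3 * K * (X1 + X2 + X3))"
    using P Ex l1 by (intro order_trans[OF P] mult_left_mono) (auto simp: algebra_simps)
  have \<theta>_bound: "(\<Sum>n\<in>{1..M}. d * (L2_norm D (\<theta> n))\<^sup>2) \<le> 6 * Ex\<^sup>2 * K / l ^ 4 * (X1 + X2 + X3)"
  proof -
    have "(\<Sum>n\<in>{1..M}. d * (L2_norm D (\<theta> n))\<^sup>2) \<le> 2 * (\<Sum>n\<in>{1..M}. d * (\<phi> n)\<^sup>2) * Ex"
      using en by (simp add: Ex_def)
    also have "\<dots> \<le> 2 * (Ex / l ^ 4 * (3 * K * (X1 + X2 + X3))) * Ex"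
      using P' Ex by (intro mult_left_mono mult_right_mono) auto
    finally show ?thesis by (simp add: power2_eq_square field_simps)
  qed
  have "d * (L2_norm D (\<lambda>x. V n x - q n * eps i x))\<^sup>2 \<le> 2 * (d * (L2_norm D (\<theta> n))\<^sup>2) + 2 * a0\<^sup>2 * (d * (q n)\<^sup>2)" for n
  proof -
    have "(\<lambda>x. V n x - q n * eps i x) = (\<lambda>x. \<theta> n x + q n * \<rho> x)"
      by (simp add: \<theta>_def \<rho>_def fun_eq_iff algebra_simps)
    then have "(L2_norm D (\<lambda>x. V n x - q n * eps i x))\<^sup>2 \<le> 2 * (L2_norm D (\<theta> n))\<^sup>2 + 2 * (q n * n0)\<^sup>2"
      using L2_norm_square_add_le[OF L2[OF \<theta>S[of n]] L2_cmult[OF sobolev_L2[OF \<rho>2], of "q n"]] q_nonneg[of n]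
      by (simp add: n0_def)
    also have "(q n * n0)\<^sup>2 \<le> (q n * a0)\<^sup>2"
      using n0 n_nonneg q_nonneg[of n] by (intro power_mono mult_left_mono) auto
    finally have "d * (L2_norm D (\<lambda>x. V n x - q n * eps i x))\<^sup>2 \<le> d * (2 * (L2_norm D (\<theta> n))\<^sup>2 + 2 * (q n * a0)\<^sup>2)"
      using d by (intro mult_left_mono) auto
    then show ?thesis by (simp add: algebra_simps power_mult_distrib)
  qed
  then have "(\<Sum>n\<in>{1..M}. d * (L2_norm D (\<lambda>x. V n x - q n * eps i x))\<^sup>2)
      \<le> (\<Sum>n\<in>{1..M}. 2 * (d * (L2_norm D (\<theta> n))\<^sup>2) + 2 * a0\<^sup>2 * (d * (q n)\<^sup>2))" by (intro sum_mono)
  also have "\<dots> = 2 * (\<Sum>n\<in>{1..M}. d * (L2_norm D (\<theta> n))\<^sup>2) + 2 * a0\<^sup>2 * (\<Sum>n\<in>{1..M}. d * (q n)\<^sup>2)"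
    by (simp only: sum.distrib sum_distrib_left)
  also have "\<dots> \<le> 2 * (6 * Ex\<^sup>2 * K / l ^ 4 * (X1 + X2 + X3)) + 2 * a0\<^sup>2 * (Ex / l ^ 4)"
    by (intro add_mono mult_left_mono \<theta>_bound q2) auto
  also have "2 * a0\<^sup>2 * (Ex / l ^ 4) = 2592 * C ^ 4 * Ex / l ^ 4 * X2" unfolding a0 by simp
  also have "\<dots> \<le> 2592 * C ^ 4 * Ex / l ^ 4 * (X1 + X2 + X3)"
    using X Ex l1 by (intro mult_left_mono) auto
  also have "2 * (6 * Ex\<^sup>2 * K / l ^ 4 * (X1 + X2 + X3)) + 2592 * C ^ 4 * Ex / l ^ 4 * (X1 + X2 + X3)
      = mode_const T \<mu> C / l ^ 4 * (X1 + X2 + X3)"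
    by (simp add: mode_const_def Ex_def K_def c1_def add_divide_distrib algebra_simps)
  finally show ?thesis by (simp add: X1_def X2_def X3_def)
qed

end

section \<open>Overlaps of the two time grids\<close>

definition overlap :: "real \<Rightarrow> real \<Rightarrow> real \<Rightarrow> real \<Rightarrow> real" where
  "overlap a b c e = max 0 (min b e - max a c)"

lemma overlap_nonneg [simp]: "0 \<le> overlap a b c e" by (simp add: overlap_def)

lemma overlap_commute: "overlap a b c e = overlap c e a b"
  by (simp add: overlap_def max.commute min.commute)

lemma overlap_sum:
  fixes s :: "nat \<Rightarrow> real"
  assumes "a \<le> b" "\<And>k. s k \<le> s (Suc k)" "s 0 \<le> a" "b \<le> s m"
  shows "(\<Sum>k\<in>{1..m}. overlap a b (s (k - 1)) (s k)) = b - a"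
proof -
  have "(\<Sum>k\<in>{1..m}. overlap a b (s (k - 1)) (s k)) = overlap a b (s 0) (s m) \<and> s 0 \<le> s m"
  proof (induction m)
    case (Suc m)
    then show ?case using assms(1) assms(2)[of m] by (auto simp: overlap_def max_def min_def)
  qed (simp add: overlap_def)
  then show ?thesis using assms by (simp add: overlap_def)
qed

lemma weighted_Cauchy_Schwarz:
  fixes a x :: "'a \<Rightarrow> real"
  assumes "\<And>i. i \<in> A \<Longrightarrow> 0 \<le> a i"
  shows "(\<Sum>i\<in>A. a i * x i)\<^sup>2 \<le> (\<Sum>i\<in>A. a i) * (\<Sum>i\<in>A. a i * (x i)\<^sup>2)"
proof -
  have "(\<Sum>i\<in>A. sqrt (a i) * (sqrt (a i) * x i))\<^sup>2 \<le> (\<Sum>i\<in>A. (sqrt (a i))\<^sup>2) * (\<Sum>i\<in>A. (sqrt (a i) * x i)\<^sup>2)"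
    by (rule Cauchy_Schwarz_ineq_sum)
  then show ?thesis using assms by (simp add: power_mult_distrib flip: mult.assoc cong: sum.cong)
qed

lemma sum_reverse: "(\<Sum>k\<in>{1..m}. f (m + 1 - k)) = (\<Sum>k\<in>{1..m :: nat}. f k :: real)"
  using sum.atLeastAtMost_rev[of f 1 m] by (simp add: add.commute)

text \<open>The slab \<open>n\<close> of the load acts on step \<open>k\<close> of the scheme with weight \<open>ov k n\<close>; \<open>b n\<close> is its contribution
  to the exact amplitude at time \<open>\<tau> m\<close>.\<close>

locale mode_load = mode +
  fixes N :: nat and m :: nat
  assumes N: "1 \<le> N" and m: "m \<le> M"
begin

definition "dt = T / real N"
definition "t n = real n * dt"
definition "ov k n = overlap (\<tau> (k - 1)) (\<tau> k) (t (n - 1)) (t n)"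
text \<open>Slab nodes cut off at \<open>\<tau> m\<close>, since later noise does not influence the
  solution at that time.\<close>

definition "\<alpha> n = min (t n) (\<tau> m)"
definition "b n = Y (\<tau> m - \<alpha> (n - 1)) - Y (\<tau> m - \<alpha> n)"
text \<open>The error of the scalar amplitude alone, the response of the scheme being replaced by
  the step means of y. The index m + 1 - k counts back from \<open>\<tau> m\<close>.\<close>

definition "s n = (\<Sum>k\<in>{1..m}. ov k n * q (m + 1 - k)) - b n"

lemma dt: "0 < dt" using T N by (simp add: dt_def)

lemma t_mono: "j \<le> k \<Longrightarrow> t j \<le> t k" using dt by (simp add: t_def)

lemma \<tau>_mono: "j \<le> k \<Longrightarrow> \<tau> j \<le> \<tau> k" using d by (simp add: \<tau>_def)

lemma t_0 [simp]: "t 0 = 0" by (simp add: t_def)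

lemma t_N: "t N = T" using N by (simp add: t_def dt_def)

lemma t_step: "1 \<le> n \<Longrightarrow> t n = t (n - 1) + dt"
  by (cases n) (auto simp: t_def algebra_simps)

lemma \<alpha>: "0 \<le> \<alpha> n" "\<alpha> n \<le> \<tau> m" "\<alpha> (n - 1) \<le> \<alpha> n" "1 \<le> n \<Longrightarrow> \<alpha> n - \<alpha> (n - 1) \<le> dt"
  using t_mono[of 0 n] t_mono[of "n - 1" n] t_step[of n] dt by (auto simp: \<alpha>_def min_def)

lemma \<alpha>_0 [simp]: "\<alpha> 0 = 0" by (simp add: \<alpha>_def)

lemma \<alpha>_N: "\<alpha> N = \<tau> m" using \<tau>_le[OF m] t_N by (simp add: \<alpha>_def)

text \<open>Steps up to m end by \<open>\<tau> m\<close>, so cutting the slabs off there changes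
  none of these overlaps.\<close>

lemma ov_\<alpha>:
  assumes "k \<in> {1..m}" shows "ov k n = overlap (\<tau> (k - 1)) (\<tau> k) (\<alpha> (n - 1)) (\<alpha> n)"
  using assms \<tau>_mono[of k m] \<tau>_mono[of "k - 1" k] by (auto simp: ov_def overlap_def \<alpha>_def max_def min_def)

lemma sum_ov_k: "(\<Sum>k\<in>{1..m}. ov k n) = \<alpha> n - \<alpha> (n - 1)"
proof -
  have "(\<Sum>k\<in>{1..m}. ov k n) = (\<Sum>k\<in>{1..m}. overlap (\<alpha> (n - 1)) (\<alpha> n) (\<tau> (k - 1)) (\<tau> k))"
    by (intro sum.cong refl) (subst ov_\<alpha>, assumption, rule overlap_commute)
  also have "\<dots> = \<alpha> n - \<alpha> (n - 1)"
    using \<alpha> \<tau>_mono by (intro overlap_sum) auto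
  finally show ?thesis .
qed

lemma sum_ov_n:
  assumes "k \<in> {1..m}" shows "(\<Sum>n\<in>{1..N}. ov k n) = d"
proof -
  have "\<tau> k \<le> T" using assms m by (intro \<tau>_le) auto
  then have "(\<Sum>n\<in>{1..N}. ov k n) = \<tau> k - \<tau> (k - 1)"
    unfolding ov_def using \<tau>_mono t_mono t_N by (intro overlap_sum) auto
  then show ?thesis using \<tau>_step[of k] assms by simp
qed

lemma ov_nonneg [simp]: "0 \<le> ov k n" by (simp add: ov_def)

lemma sum_ov_le: "1 \<le> n \<Longrightarrow> (\<Sum>k\<in>{1..m}. ov k n) \<le> dt"
  unfolding sum_ov_k by (rule \<alpha>)

text \<open>The slabs cover each step of the scheme exactly once, so summing over them leaves only
  the step length: N disappears, whatever the relation of the two grids.\<close>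

lemma sum_ov_weighted:
  "(\<Sum>n\<in>{1..N}. \<Sum>k\<in>{1..m}. ov k n * f (m + 1 - k)) = (\<Sum>k\<in>{1..m}. d * f k)"
proof -
  have "(\<Sum>n\<in>{1..N}. \<Sum>k\<in>{1..m}. ov k n * f (m + 1 - k)) = (\<Sum>k\<in>{1..m}. (\<Sum>n\<in>{1..N}. ov k n) * f (m + 1 - k))"
    by (subst sum.swap) (simp add: sum_distrib_right)
  also have "\<dots> = (\<Sum>k\<in>{1..m}. d * f (m + 1 - k))" by (intro sum.cong refl) (simp only: sum_ov_n)
  finally show ?thesis using sum_reverse[of "\<lambda>k. d * f k" m] by simp
qed

text \<open>The weights of one slab add up to at most \<open>dt\<close>, so Cauchy-Schwarz pays
  exactly for the division by \<open>dt\<close> that the variance of the increments brings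
  in.\<close>

lemma ov_square_le:
  assumes "1 \<le> n"
  shows "(\<Sum>k\<in>{1..m}. ov k n * x k)\<^sup>2 / dt \<le> (\<Sum>k\<in>{1..m}. ov k n * (x k)\<^sup>2)"
proof -
  have "(\<Sum>k\<in>{1..m}. ov k n * x k)\<^sup>2 \<le> (\<Sum>k\<in>{1..m}. ov k n) * (\<Sum>k\<in>{1..m}. ov k n * (x k)\<^sup>2)"
    by (rule weighted_Cauchy_Schwarz) simp
  also have "\<dots> \<le> dt * (\<Sum>k\<in>{1..m}. ov k n * (x k)\<^sup>2)"
    by (intro mult_right_mono sum_ov_le assms sum_nonneg) auto
  finally show ?thesis using dt by (simp add: divide_le_eq mult.commute)
qed

lemma amplitude_error_stability: "(\<Sum>n\<in>{1..N}. (s n)\<^sup>2 / dt) \<le> 4 * E\<^sup>2 / l ^ 4"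
proof -
  have "(s n)\<^sup>2 / dt \<le> 2 * (\<Sum>k\<in>{1..m}. ov k n * (q (m + 1 - k))\<^sup>2) + 2 * (G (\<tau> m - \<alpha> (n - 1)) - G (\<tau> m - \<alpha> n))"
    if n: "n \<in> {1..N}" for n
  proof -
    have "(b n)\<^sup>2 \<le> (\<alpha> n - \<alpha> (n - 1)) * (G (\<tau> m - \<alpha> (n - 1)) - G (\<tau> m - \<alpha> n))"
      using mean_square_le[of "\<tau> m - \<alpha> n" "\<tau> m - \<alpha> (n - 1)"] \<alpha>(3)[of n] by (simp add: b_def)
    also have "\<dots> \<le> dt * (G (\<tau> m - \<alpha> (n - 1)) - G (\<tau> m - \<alpha> n))"
      using n \<alpha>(3)[of n] by (intro mult_right_mono \<alpha>(4)) (auto intro!: G_mono)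
    finally have 1: "(b n)\<^sup>2 / dt \<le> G (\<tau> m - \<alpha> (n - 1)) - G (\<tau> m - \<alpha> n)"
      using dt by (simp add: divide_le_eq mult.commute)
    have 2: "(\<Sum>k\<in>{1..m}. ov k n * q (m + 1 - k))\<^sup>2 / dt \<le> (\<Sum>k\<in>{1..m}. ov k n * (q (m + 1 - k))\<^sup>2)"
      using n by (intro ov_square_le) auto
    have "(u - v)\<^sup>2 \<le> 2 * u\<^sup>2 + 2 * v\<^sup>2" for u v :: real
      using zero_le_power2[of "u + v"] by (simp add: power2_sum power2_diff)
    then have "(s n)\<^sup>2 / dt \<le> (2 * (\<Sum>k\<in>{1..m}. ov k n * q (m + 1 - k))\<^sup>2 + 2 * (b n)\<^sup>2) / dt"
      unfolding s_def using dt by (intro divide_right_mono) auto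
    also have "\<dots> = 2 * ((\<Sum>k\<in>{1..m}. ov k n * q (m + 1 - k))\<^sup>2 / dt) + 2 * ((b n)\<^sup>2 / dt)"
      by (simp add: add_divide_distrib)
    finally show ?thesis using 1 2 by argo
  qed
  then have "(\<Sum>n\<in>{1..N}. (s n)\<^sup>2 / dt) \<le> (\<Sum>n\<in>{1..N}. 2 * (\<Sum>k\<in>{1..m}. ov k n * (q (m + 1 - k))\<^sup>2)
      + 2 * (G (\<tau> m - \<alpha> (n - 1)) - G (\<tau> m - \<alpha> n)))"
    by (rule sum_mono)
  also have "\<dots> = 2 * (\<Sum>n\<in>{1..N}. \<Sum>k\<in>{1..m}. ov k n * (q (m + 1 - k))\<^sup>2)
      + 2 * (\<Sum>n\<in>{1..N}. G (\<tau> m - \<alpha> (n - 1)) - G (\<tau> m - \<alpha> n))"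
    by (simp only: sum.distrib sum_distrib_left)
  also have "(\<Sum>n\<in>{1..N}. \<Sum>k\<in>{1..m}. ov k n * (q (m + 1 - k))\<^sup>2) = (\<Sum>k\<in>{1..m}. d * (q k)\<^sup>2)"
    by (rule sum_ov_weighted)
  also have "(\<Sum>n\<in>{1..N}. G (\<tau> m - \<alpha> (n - 1)) - G (\<tau> m - \<alpha> n)) = G (\<tau> m)"
  proof -
    have "(\<Sum>n\<in>{1..k}. G (\<tau> m - \<alpha> (n - 1)) - G (\<tau> m - \<alpha> n)) = G (\<tau> m - \<alpha> 0) - G (\<tau> m - \<alpha> k)" for k
      by (induction k) auto
    then show ?thesis by (simp add: \<alpha>_N G)
  qed
  also have "2 * (\<Sum>k\<in>{1..m}. d * (q k)\<^sup>2) + 2 * G (\<tau> m) \<le> 2 * (E\<^sup>2 / l ^ 4) + 2 * (E\<^sup>2 / l ^ 4)"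
    using \<tau>_le[OF m] by (intro add_mono mult_left_mono q_square_sum[OF m] G_le) auto
  finally show ?thesis by simp
qed

text \<open>On the part of slab n inside one step, the exact contribution is the length times a
  value of y, by the mean value theorem, and \<open>oscillation\<close> compares that value with the
  mean over the step.\<close>

lemma s_le: "\<bar>s n\<bar> \<le> (\<Sum>k\<in>{1..m}. ov k n * (\<bar>\<kappa>\<bar> * (d * q (m + 1 - k))))"
proof -
  \<comment> \<open>The nodes \<open>\<tau> k\<close> clamped to the slab. They cut it into its
    intersections with the steps, starting at \<open>\<alpha> (n - 1)\<close> and ending at
    \<open>\<alpha> n\<close>.\<close>
  define c where "c k = max (\<alpha> (n - 1)) (min (\<alpha> n) (\<tau> k))" for k
  have c0: "c 0 = \<alpha> (n - 1)" and cm: "c m = \<alpha> n"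
    using \<alpha>[of n] \<alpha>(1)[of "n - 1"] by (auto simp: c_def)
  have ov: "ov k n = c k - c (k - 1)" if "k \<in> {1..m}" for k
    using ov_\<alpha>[OF that] \<tau>_mono[of "k - 1" k] \<alpha>(3)[of n] by (auto simp: c_def overlap_def max_def min_def)
  have "(\<Sum>k\<in>{1..j}. Y (\<tau> m - c (k - 1)) - Y (\<tau> m - c k)) = Y (\<tau> m - c 0) - Y (\<tau> m - c j)" for j
    by (induction j) auto
  from this[of m] have b: "b n = (\<Sum>k\<in>{1..m}. Y (\<tau> m - c (k - 1)) - Y (\<tau> m - c k))"
    by (simp add: b_def c0 cm)
  have piece: "\<bar>ov k n * q (m + 1 - k) - (Y (\<tau> m - c (k - 1)) - Y (\<tau> m - c k))\<bar>
      \<le> ov k n * (\<bar>\<kappa>\<bar> * (d * q (m + 1 - k)))" if k: "k \<in> {1..m}" for k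
  proof (cases "c (k - 1) < c k")
    case False
    then have "c (k - 1) = c k" using ov[OF k] ov_nonneg[of k n] by linarith
    then show ?thesis using ov[OF k] by simp
  next
    case True
    then have in_step: "\<tau> (k - 1) \<le> c (k - 1)" "c k \<le> \<tau> k"
      using \<tau>_mono[of "k - 1" k] by (auto simp: c_def max_def min_def split: if_splits)
    obtain \<xi> where \<xi>: "\<tau> m - c k < \<xi>" "\<xi> < \<tau> m - c (k - 1)"
      "Y (\<tau> m - c (k - 1)) - Y (\<tau> m - c k) = (\<tau> m - c (k - 1) - (\<tau> m - c k)) * y \<xi>"
      using MVT2[of "\<tau> m - c k" "\<tau> m - c (k - 1)" Y y] True Y(1) by auto
    \<comment> \<open>Looking back from \<open>\<tau> m\<close>, step k occupies the place of step m
      + 1 - k.\<close>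
    have "\<tau> (m + 1 - k) = \<tau> m - \<tau> (k - 1)" "\<tau> (m + 1 - k - 1) = \<tau> m - \<tau> k"
      using k by (auto simp: \<tau>_def of_nat_diff algebra_simps)
    then have osc: "\<bar>y \<xi> - q (m + 1 - k)\<bar> \<le> \<bar>\<kappa>\<bar> * (d * q (m + 1 - k))"
      using \<xi> in_step k by (intro oscillation) auto
    have "ov k n * q (m + 1 - k) - (Y (\<tau> m - c (k - 1)) - Y (\<tau> m - c k)) = - (ov k n * (y \<xi> - q (m + 1 - k)))"
      unfolding \<xi>(3) ov[OF k] by (simp add: algebra_simps)
    then show ?thesis using osc by (simp add: abs_mult mult_left_mono)
  qed
  have "s n = (\<Sum>k\<in>{1..m}. ov k n * q (m + 1 - k) - (Y (\<tau> m - c (k - 1)) - Y (\<tau> m - c k)))"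
    by (simp add: s_def b sum_subtractf)
  then have "\<bar>s n\<bar> \<le> (\<Sum>k\<in>{1..m}. \<bar>ov k n * q (m + 1 - k) - (Y (\<tau> m - c (k - 1)) - Y (\<tau> m - c k))\<bar>)"
    by (simp only: sum_abs)
  also have "\<dots> \<le> (\<Sum>k\<in>{1..m}. ov k n * (\<bar>\<kappa>\<bar> * (d * q (m + 1 - k))))" by (intro sum_mono piece)
  finally show ?thesis .
qed

lemma amplitude_error_convergence: "(\<Sum>n\<in>{1..N}. (s n)\<^sup>2 / dt) \<le> \<kappa>\<^sup>2 * d\<^sup>2 * (E\<^sup>2 / l ^ 4)"
proof -
  have "(s n)\<^sup>2 / dt \<le> (\<Sum>k\<in>{1..m}. ov k n * (\<bar>\<kappa>\<bar> * (d * q (m + 1 - k)))\<^sup>2)" if n: "n \<in> {1..N}" for n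
  proof -
    have "\<bar>s n\<bar>\<^sup>2 \<le> (\<Sum>k\<in>{1..m}. ov k n * (\<bar>\<kappa>\<bar> * (d * q (m + 1 - k))))\<^sup>2"
      by (intro power_mono s_le) simp
    then have "(s n)\<^sup>2 / dt \<le> (\<Sum>k\<in>{1..m}. ov k n * (\<bar>\<kappa>\<bar> * (d * q (m + 1 - k))))\<^sup>2 / dt"
      using dt by (intro divide_right_mono) auto
    also have "\<dots> \<le> (\<Sum>k\<in>{1..m}. ov k n * (\<bar>\<kappa>\<bar> * (d * q (m + 1 - k)))\<^sup>2)"
      using n by (intro ov_square_le) auto
    finally show ?thesis .
  qed
  then have "(\<Sum>n\<in>{1..N}. (s n)\<^sup>2 / dt) \<le> (\<Sum>n\<in>{1..N}. \<Sum>k\<in>{1..m}. ov k n * (\<bar>\<kappa>\<bar> * (d * q (m + 1 - k)))\<^sup>2)"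
    by (rule sum_mono)
  also have "\<dots> = (\<Sum>k\<in>{1..m}. d * (\<bar>\<kappa>\<bar> * (d * q k))\<^sup>2)" by (rule sum_ov_weighted)
  also have "\<dots> = \<kappa>\<^sup>2 * d\<^sup>2 * (\<Sum>k\<in>{1..m}. d * (q k)\<^sup>2)"
    by (simp add: sum_distrib_left power_mult_distrib mult_ac)
  also have "\<dots> \<le> \<kappa>\<^sup>2 * d\<^sup>2 * (E\<^sup>2 / l ^ 4)" by (intro mult_left_mono q_square_sum m) auto
  finally show ?thesis .
qed

text \<open>Inserting \<open>q k\<close> times \<open>eps i\<close> separates the error of the
  scheme for one impulse from the scalar mismatch s caused by the two grids. The 4 is 2 times the
  bound 2 for the squared norm of \<open>eps i\<close>.\<close>

lemma mode_error_split:
  assumes V: "\<And>k. V k \<in> L2 D"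
  shows "(\<Sum>n\<in>{1..N}. (L2_norm D (\<lambda>x. (\<Sum>k\<in>{1..m}. ov k n * V (m + 1 - k) x) - b n * eps i x))\<^sup>2 / dt)
    \<le> 2 * (\<Sum>k\<in>{1..M}. d * (L2_norm D (\<lambda>x. V k x - q k * eps i x))\<^sup>2) + 4 * (\<Sum>n\<in>{1..N}. (s n)\<^sup>2 / dt)"
proof -
  define e where "e k x = V k x - q k * eps i x" for k x
  have eL2: "e k \<in> L2 D" for k unfolding e_def[abs_def] by (intro L2_diff V L2_cmult eps_sobolev)
  have "(L2_norm D (\<lambda>x. (\<Sum>k\<in>{1..m}. ov k n * V (m + 1 - k) x) - b n * eps i x))\<^sup>2 / dt
      \<le> 2 * (\<Sum>k\<in>{1..m}. ov k n * (L2_norm D (e (m + 1 - k)))\<^sup>2) + 4 * ((s n)\<^sup>2 / dt)" if n: "n \<in> {1..N}" for n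
  proof -
    define f where "f x = (\<Sum>k\<in>{1..m}. ov k n * e (m + 1 - k) x)" for x
    have fL2: "f \<in> L2 D" unfolding f_def[abs_def] by (intro L2_sum eL2)
    have "(\<lambda>x. (\<Sum>k\<in>{1..m}. ov k n * V (m + 1 - k) x) - b n * eps i x) = (\<lambda>x. f x + s n * eps i x)"
    proof
      fix x
      have "f x = (\<Sum>k\<in>{1..m}. ov k n * V (m + 1 - k) x) - (\<Sum>k\<in>{1..m}. ov k n * q (m + 1 - k)) * eps i x"
        by (simp add: f_def e_def sum_distrib_right sum_distrib_left sum_subtractf algebra_simps)
      then show "(\<Sum>k\<in>{1..m}. ov k n * V (m + 1 - k) x) - b n * eps i x = f x + s n * eps i x"
        by (simp add: s_def algebra_simps)
    qed
    then have "(L2_norm D (\<lambda>x. (\<Sum>k\<in>{1..m}. ov k n * V (m + 1 - k) x) - b n * eps i x))\<^sup>2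
        \<le> 2 * (L2_norm D f)\<^sup>2 + 2 * (\<bar>s n\<bar> * L2_norm D (eps i))\<^sup>2"
      using L2_norm_square_add_le[OF fL2 L2_cmult[OF eps_sobolev(3), of "s n" i]] by simp
    also have "(\<bar>s n\<bar> * L2_norm D (eps i))\<^sup>2 \<le> (\<bar>s n\<bar> * sqrt 2)\<^sup>2"
      by (intro power_mono mult_left_mono L2_norm_eps) auto
    also have "(\<bar>s n\<bar> * sqrt 2)\<^sup>2 = 2 * (s n)\<^sup>2" by (simp add: power_mult_distrib)
    also have "(L2_norm D f)\<^sup>2 \<le> (\<Sum>k\<in>{1..m}. ov k n * L2_norm D (e (m + 1 - k)))\<^sup>2"
      using L2_norm_sum_le[of "{1..m}" "\<lambda>k. e (m + 1 - k)" D "\<lambda>k. ov k n"] eL2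
      by (intro power_mono) (auto simp: f_def[abs_def])
    finally have "(L2_norm D (\<lambda>x. (\<Sum>k\<in>{1..m}. ov k n * V (m + 1 - k) x) - b n * eps i x))\<^sup>2 / dt
        \<le> (2 * (\<Sum>k\<in>{1..m}. ov k n * L2_norm D (e (m + 1 - k)))\<^sup>2 + 2 * (2 * (s n)\<^sup>2)) / dt"
      using dt by (intro divide_right_mono) auto
    also have "\<dots> = 2 * ((\<Sum>k\<in>{1..m}. ov k n * L2_norm D (e (m + 1 - k)))\<^sup>2 / dt) + 4 * ((s n)\<^sup>2 / dt)"
      by (simp add: add_divide_distrib)
    also have "\<dots> \<le> 2 * (\<Sum>k\<in>{1..m}. ov k n * (L2_norm D (e (m + 1 - k)))\<^sup>2) + 4 * ((s n)\<^sup>2 / dt)"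
      using n by (intro add_right_mono mult_left_mono ov_square_le) auto
    finally show ?thesis .
  qed
  then have "(\<Sum>n\<in>{1..N}. (L2_norm D (\<lambda>x. (\<Sum>k\<in>{1..m}. ov k n * V (m + 1 - k) x) - b n * eps i x))\<^sup>2 / dt)
      \<le> (\<Sum>n\<in>{1..N}. 2 * (\<Sum>k\<in>{1..m}. ov k n * (L2_norm D (e (m + 1 - k)))\<^sup>2) + 4 * ((s n)\<^sup>2 / dt))"
    by (rule sum_mono)
  also have "\<dots> = 2 * (\<Sum>n\<in>{1..N}. \<Sum>k\<in>{1..m}. ov k n * (L2_norm D (e (m + 1 - k)))\<^sup>2)
      + 4 * (\<Sum>n\<in>{1..N}. (s n)\<^sup>2 / dt)"
    by (simp only: sum.distrib sum_distrib_left)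
  also have "(\<Sum>n\<in>{1..N}. \<Sum>k\<in>{1..m}. ov k n * (L2_norm D (e (m + 1 - k)))\<^sup>2) = (\<Sum>k\<in>{1..m}. d * (L2_norm D (e k))\<^sup>2)"
    by (rule sum_ov_weighted)
  also have "\<dots> \<le> (\<Sum>k\<in>{1..M}. d * (L2_norm D (e k))\<^sup>2)"
    using m d by (intro sum_mono2) auto
  finally show ?thesis by (simp add: e_def[abs_def])
qed

text \<open>Two bounds for the same quantity, to be interpolated: stability, with 40 = 2 * 12 + 4 *
  4, and convergence.\<close>

lemma mode_error:
  assumes fe: "fe_space r h S" and ap: "approximation_property r C h S" and r: "r = 2 \<or> r = 3" and C: "0 < C"
    and V: "impulse_response d \<mu> S (eps i) V"
  defines "err \<equiv> (\<Sum>n\<in>{1..N}. (L2_norm D (\<lambda>x. (\<Sum>k\<in>{1..m}. ov k n * V (m + 1 - k) x) - b n * eps i x))\<^sup>2 / dt)"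
  shows "err \<le> 40 * exp (4 * \<mu>\<^sup>2 * T) / l ^ 4"
    "err \<le> (2 * mode_const T \<mu> C + 4 * (1 + 2 * \<bar>\<mu>\<bar>)\<^sup>2 * exp (4 * \<mu>\<^sup>2 * T)) / l ^ 4
      * (d\<^sup>2 * l ^ 8 + h ^ (2 * r) * l ^ 6 + h\<^sup>2 * l\<^sup>2)"
proof -
  have VL2: "V k \<in> L2 D" for k using V fe_space_L2[OF fe] by (simp add: impulse_response_def)
  note split = mode_error_split[of V, OF VL2, folded err_def]
  have E: "E\<^sup>2 / l ^ 4 \<le> exp (4 * \<mu>\<^sup>2 * T) / l ^ 4"
    using E_square_le l1 by (intro divide_right_mono) auto
  have "err \<le> 2 * (12 * exp (4 * \<mu>\<^sup>2 * T) / l ^ 4) + 4 * (4 * E\<^sup>2 / l ^ 4)"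
    using split response_stability[OF fe V] amplitude_error_stability by argo
  then show "err \<le> 40 * exp (4 * \<mu>\<^sup>2 * T) / l ^ 4" using E by argo
  define X where "X = d\<^sup>2 * l ^ 8 + h ^ (2 * r) * l ^ 6 + h\<^sup>2 * l\<^sup>2"
  have h: "0 < h" using fe_space_mesh[OF fe] by simp
  have "\<bar>\<kappa>\<bar> \<le> (1 + 2 * \<bar>\<mu>\<bar>) * l ^ 4" using \<kappa>_abs zero_le_power2[of l] abs_ge_zero[of \<mu>]
    by (smt (verit) mult_nonneg_nonneg)
  then have "\<bar>\<kappa>\<bar>\<^sup>2 * d\<^sup>2 \<le> ((1 + 2 * \<bar>\<mu>\<bar>) * l ^ 4)\<^sup>2 * d\<^sup>2"
    by (intro mult_right_mono power_mono) auto
  then have "\<kappa>\<^sup>2 * d\<^sup>2 \<le> (1 + 2 * \<bar>\<mu>\<bar>)\<^sup>2 * (d\<^sup>2 * l ^ 8)"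
    by (simp add: power_mult_distrib mult_ac flip: power_mult)
  also have "\<dots> \<le> (1 + 2 * \<bar>\<mu>\<bar>)\<^sup>2 * X" using h by (intro mult_left_mono) (auto simp: X_def)
  finally have "\<kappa>\<^sup>2 * d\<^sup>2 \<le> (1 + 2 * \<bar>\<mu>\<bar>)\<^sup>2 * X" .
  then have "\<kappa>\<^sup>2 * d\<^sup>2 * (E\<^sup>2 / l ^ 4) \<le> (1 + 2 * \<bar>\<mu>\<bar>)\<^sup>2 * X * (exp (4 * \<mu>\<^sup>2 * T) / l ^ 4)"
    by (rule mult_mono[OF _ E]) (use h l1 in \<open>auto simp: X_def\<close>)
  then have "err \<le> 2 * (mode_const T \<mu> C / l ^ 4 * X) + 4 * ((1 + 2 * \<bar>\<mu>\<bar>)\<^sup>2 * X * (exp (4 * \<mu>\<^sup>2 * T) / l ^ 4))"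
    using split response_convergence[OF fe ap r C V] amplitude_error_convergence by (simp add: X_def)
  also have "\<dots> = (2 * mode_const T \<mu> C + 4 * (1 + 2 * \<bar>\<mu>\<bar>)\<^sup>2 * exp (4 * \<mu>\<^sup>2 * T)) / l ^ 4 * X"
    by (simp add: add_divide_distrib algebra_simps)
  finally show "err \<le> (2 * mode_const T \<mu> C + 4 * (1 + 2 * \<bar>\<mu>\<bar>)\<^sup>2 * exp (4 * \<mu>\<^sup>2 * T)) / l ^ 4
      * (d\<^sup>2 * l ^ 8 + h ^ (2 * r) * l ^ 6 + h\<^sup>2 * l\<^sup>2)" by (simp add: X_def)
qed

end

section \<open>Second moments of the white noise\<close>

lemma centered_gaussian_second_moment:
  assumes "prob_space P" "0 \<le> \<sigma>" "centered_gaussian P \<sigma> X"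
  shows "integrable P (\<lambda>\<omega>. (X \<omega>)\<^sup>2)" "(\<integral>\<omega>. (X \<omega>)\<^sup>2 \<partial>P) = \<sigma>\<^sup>2"
proof -
  interpret prob_space P by fact
  have X: "X \<in> borel_measurable P" using assms by (simp add: centered_gaussian_def)
  have "integrable P (\<lambda>\<omega>. (X \<omega>)\<^sup>2) \<and> (\<integral>\<omega>. (X \<omega>)\<^sup>2 \<partial>P) = \<sigma>\<^sup>2"
  proof (cases "\<sigma> = 0")
    case True
    then have ae: "AE \<omega> in P. (X \<omega>)\<^sup>2 = 0" using assms by (simp add: centered_gaussian_def)
    have "integrable P (\<lambda>\<omega>. (X \<omega>)\<^sup>2) \<longleftrightarrow> integrable P (\<lambda>\<omega>. 0 :: real)"
      using ae X by (intro integrable_cong_AE) auto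
    moreover have "(\<integral>\<omega>. (X \<omega>)\<^sup>2 \<partial>P) = (\<integral>\<omega>. 0 \<partial>P)" using ae X by (intro integral_cong_AE) auto
    ultimately show ?thesis using True by simp
  next
    case False
    then have \<sigma>: "0 < \<sigma>" using assms by simp
    have d: "distributed P lborel X (normal_density 0 \<sigma>)" using assms False by (simp add: centered_gaussian_def)
    have m: "has_bochner_integral lborel (\<lambda>x. normal_density 0 \<sigma> x * x\<^sup>2) (\<sigma>\<^sup>2)"
      using normal_moment_even[OF \<sigma>, of 0 1] by (simp add: fact_numeral)
    have "integrable lborel (\<lambda>x. normal_density 0 \<sigma> x * x\<^sup>2) \<longleftrightarrow> integrable P (\<lambda>\<omega>. (X \<omega>)\<^sup>2)"
      using d by (intro distributed_integrable) auto
    moreover have "(\<integral>x. normal_density 0 \<sigma> x * x\<^sup>2 \<partial>lborel) = (\<integral>\<omega>. (X \<omega>)\<^sup>2 \<partial>P)"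
      using d by (intro distributed_integral) auto
    ultimately show ?thesis using m by (simp add: has_bochner_integral_iff)
  qed
  then show "integrable P (\<lambda>\<omega>. (X \<omega>)\<^sup>2)" "(\<integral>\<omega>. (X \<omega>)\<^sup>2 \<partial>P) = \<sigma>\<^sup>2" by auto
qed

text \<open>Polarisation: almost sure linearity gives the product of two integrals as a combination
  of squares, whose means are the variances. Second moments are all that is taken from the
  noise.\<close>

lemma white_noise_covariance:
  assumes P: "prob_space P" and I: "white_noise P Q I" and f: "f \<in> L2 Q" and g: "g \<in> L2 Q"
  shows "integrable P (\<lambda>\<omega>. I f \<omega> * I g \<omega>)" "(\<integral>\<omega>. I f \<omega> * I g \<omega> \<partial>P) = L2_inner Q f g"
proof -
  have gauss: "centered_gaussian P (L2_norm Q k) (I k)" if "k \<in> L2 Q" for k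
    using I that by (simp add: white_noise_def)
  note mom = centered_gaussian_second_moment[OF P L2_norm_ge_0 gauss]
  have meas: "I k \<in> borel_measurable P" if "k \<in> L2 Q" for k
    using gauss[OF that] by (simp add: centered_gaussian_def)
  note k = L2_lincomb[OF f g, of 1 1]
  have ae: "AE \<omega> in P. I (\<lambda>z. 1 * f z + 1 * g z) \<omega> = 1 * I f \<omega> + 1 * I g \<omega>"
    using I f g unfolding white_noise_def by blast
  then have ae2: "AE \<omega> in P. ((I (\<lambda>z. 1 * f z + 1 * g z) \<omega>)\<^sup>2 - (I f \<omega>)\<^sup>2 - (I g \<omega>)\<^sup>2) / 2 = I f \<omega> * I g \<omega>"
    by eventually_elim (simp add: power2_sum)
  have int: "integrable P (\<lambda>\<omega>. ((I (\<lambda>z. 1 * f z + 1 * g z) \<omega>)\<^sup>2 - (I f \<omega>)\<^sup>2 - (I g \<omega>)\<^sup>2) / 2)"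
    by (intro Bochner_Integration.integrable_diff integrable_divide_zero mom f g k)
  have m: "(\<lambda>\<omega>. I f \<omega> * I g \<omega>) \<in> borel_measurable P" by (intro borel_measurable_times meas f g)
  show "integrable P (\<lambda>\<omega>. I f \<omega> * I g \<omega>)"
    using int m ae2 by (rule integrable_cong_AE_imp)
  have "(\<integral>\<omega>. I f \<omega> * I g \<omega> \<partial>P)
      = (\<integral>\<omega>. ((I (\<lambda>z. 1 * f z + 1 * g z) \<omega>)\<^sup>2 - (I f \<omega>)\<^sup>2 - (I g \<omega>)\<^sup>2) / 2 \<partial>P)"
    using ae2 int m by (intro integral_cong_AE) auto
  also have "\<dots> = ((L2_norm Q (\<lambda>z. 1 * f z + 1 * g z))\<^sup>2 - (L2_norm Q f)\<^sup>2 - (L2_norm Q g)\<^sup>2) / 2"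
    using mom[OF f] mom[OF g] mom[OF k] by simp
  also have "\<dots> = L2_inner Q f g"
    unfolding L2_norm_square
    using f g by (simp add: L2_inner_add L2_add L2_inner_commute[of Q g f])
  finally show "(\<integral>\<omega>. I f \<omega> * I g \<omega> \<partial>P) = L2_inner Q f g" .
qed

section \<open>Covariance of the load increments\<close>

lemma phi_measurable [measurable]: "phi i \<in> borel_measurable borel"
  unfolding phi_def[abs_def] by measurable

lemma phi_bound: "\<bar>phi i x\<bar> \<le> 2"
proof -
  have "sqrt 2 \<le> 2" by (rule real_le_lsqrt) auto
  then have "sqrt 2 * \<bar>cos (lam i * x)\<bar> \<le> 2 * 1" by (intro mult_mono) auto
  then show ?thesis by (simp add: phi_def abs_mult)
qed

lemma integral_D_cos: "(\<integral>x. cos (real_of_int k * pi * x) \<partial>lebesgue_on D) = (if k = 0 then 1 else 0)"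
proof (cases "k = 0")
  case False
  have "(\<integral>x. cos (real_of_int k * pi * x) \<partial>lebesgue_on D)
      = sin (real_of_int k * pi * 1) / (real_of_int k * pi) - sin (real_of_int k * pi * 0) / (real_of_int k * pi)"
    using False by (intro integral_lebesgue_on_Ioo_FTC) (auto intro!: derivative_eq_intros continuous_intros)
  then show ?thesis using False by (simp add: sin_int_times_real mult.commute sin_zero_iff_int2)
qed simp

lemma phi_orthonormal:
  assumes "1 \<le> i" "1 \<le> j" shows "L2_inner D (phi i) (phi j) = (if i = j then 1 else 0)"
proof -
  have int: "integrable (lebesgue_on D) (\<lambda>x. cos (real_of_int k * pi * x))" for k
    by (intro L2_D_integrable continuous_L2_D continuous_intros)
  have "phi i x * phi j x = cos (real_of_int (int i - int j) * pi * x) + cos (real_of_int (int i + int j) * pi * x)" for x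
  proof -
    have "phi i x * phi j x = 2 * (cos (lam i * x) * cos (lam j * x))" by (simp add: phi_def)
    also have "\<dots> = cos (lam i * x - lam j * x) + cos (lam i * x + lam j * x)" by (simp add: cos_diff cos_add)
    finally show ?thesis by (simp add: lam_def algebra_simps)
  qed
  then have "L2_inner D (phi i) (phi j) = (\<integral>x. cos (real_of_int (int i - int j) * pi * x) \<partial>lebesgue_on D)
      + (\<integral>x. cos (real_of_int (int i + int j) * pi * x) \<partial>lebesgue_on D)"
    unfolding L2_inner_def by (simp only:) (intro Bochner_Integration.integral_add int)
  then show ?thesis unfolding integral_D_cos using assms by auto
qed

lemma measure_lebesgue_on_Ioo_Int:
  "(\<integral>x. indicat_real {c<..<e} x \<partial>lebesgue_on {a<..<b}) = overlap a b c e"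
proof -
  have "(\<integral>x. indicat_real {c<..<e} x \<partial>lebesgue_on {a<..<b})
      = (\<integral>x. indicator {a<..<b} x *\<^sub>R indicat_real {c<..<e} x \<partial>lebesgue)"
    by (rule integral_restrict_space) simp
  also have "\<dots> = (\<integral>x. indicat_real {max a c<..<min b e} x \<partial>lebesgue)"
    by (intro Bochner_Integration.integral_cong) (auto simp: indicator_def)
  also have "\<dots> = overlap a b c e" by (cases "max a c \<le> min b e") (auto simp: overlap_def)
  finally show ?thesis .
qed

lemma subint_eq: "1 \<le> n \<Longrightarrow> subint d n = {real (n - 1) * d<..<real n * d}"
  by (simp add: subint_def of_nat_diff)

text \<open>Fubini is applied to \<open>lborel\<close>, which is a product measure, with a Borel
  integrand; the Lebesgue integrals are then those of the completion. Boundedness on a box of finite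
  measure gives integrability.\<close>

lemma space_time_L2_inner:
  fixes a b :: "real \<Rightarrow> real"
  assumes [measurable]: "a \<in> borel_measurable borel" "b \<in> borel_measurable borel"
    and bound: "\<And>x. \<bar>a x\<bar> \<le> A" "\<And>x. \<bar>b x\<bar> \<le> B"
  shows "integrable (lebesgue_on ({0..T} \<times> D)) (\<lambda>(s, y). a s * b y)"
    "(\<integral>z. (case z of (s, y) \<Rightarrow> a s * b y) \<partial>lebesgue_on ({0..T} \<times> D))
      = (\<integral>s. a s \<partial>lebesgue_on {0..T}) * (\<integral>y. b y \<partial>lebesgue_on D)"
proof -
  have Q: "{0..T} \<times> D \<in> sets borel" by (simp add: borel_prod[symmetric])
  have Ql: "{0..T} \<times> D \<in> sets lebesgue" using Q by simp
  define F where "F z = indicator ({0..T} \<times> D) z * (case z of (s, y) \<Rightarrow> a s * b y)" for z :: "real \<times> real"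
  have Fm: "F \<in> borel_measurable borel"
    unfolding F_def[abs_def] borel_prod[symmetric] by measurable
  have AB: "0 \<le> A" "0 \<le> B" using bound(1)[of 0] bound(2)[of 0] by auto
  have "integrable lborel (\<lambda>z. indicator (cbox (0, 0) (T, 1)) z *\<^sub>R F z)"
  proof (rule integrableI_bounded_set_indicator)
    show "AE z in lborel. z \<in> cbox (0, 0) (T, 1) \<longrightarrow> norm (F z) \<le> A * B"
      using bound AB
      by (intro AE_I2) (auto simp: F_def abs_mult indicator_def split: prod.splits intro!: mult_mono)
    show "emeasure lborel (cbox (0, 0) (T, 1 :: real)) < \<infinity>" by (rule emeasure_lborel_cbox_finite)
  qed (use Fm in auto)
  also have "(\<lambda>z. indicator (cbox (0, 0) (T, 1)) z *\<^sub>R F z) = F"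
    by (auto simp: F_def fun_eq_iff indicator_def cbox_Pair_eq)
  finally have int: "integrable lborel F" .
  have eq: "(\<lambda>z. indicator ({0..T} \<times> D) z * (case z of (s, y) \<Rightarrow> a s * b y)) = F"
    by (auto simp: F_def)
  show "integrable (lebesgue_on ({0..T} \<times> D)) (\<lambda>(s, y). a s * b y)"
    using int Fm Ql by (simp add: integrable_restrict_space eq integrable_completion)
  have "(\<integral>z. (case z of (s, y) \<Rightarrow> a s * b y) \<partial>lebesgue_on ({0..T} \<times> D)) = (\<integral>z. F z \<partial>lborel)"
    using Fm Ql by (simp add: integral_restrict_space eq integral_completion)
  also have "\<dots> = (\<integral>s. (\<integral>y. F (s, y) \<partial>lborel) \<partial>lborel)"
    using int unfolding lborel_prod[symmetric] by (rule lborel_pair.integral_fst'[symmetric])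
  also have "\<dots> = (\<integral>s. (indicator {0..T} s * a s) * (\<integral>y. indicator D y * b y \<partial>lborel) \<partial>lborel)"
  proof (intro Bochner_Integration.integral_cong refl)
    fix s
    have "F (s, y) = (indicator {0..T} s * a s) * (indicator D y * b y)" for y
      by (auto simp: F_def indicator_def)
    then show "(\<integral>y. F (s, y) \<partial>lborel) = (indicator {0..T} s * a s) * (\<integral>y. indicator D y * b y \<partial>lborel)"
      by simp
  qed
  also have "\<dots> = (\<integral>s. indicator {0..T} s * a s \<partial>lborel) * (\<integral>y. indicator D y * b y \<partial>lborel)"
    by simp
  also have "(\<integral>s. indicator {0..T} s * a s \<partial>lborel) = (\<integral>s. a s \<partial>lebesgue_on {0..T})"
    by (simp add: integral_restrict_space integral_completion)
  also have "(\<integral>y. indicator D y * b y \<partial>lborel) = (\<integral>y. b y \<partial>lebesgue_on D)"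
    by (simp add: integral_restrict_space integral_completion)
  finally show "(\<integral>z. (case z of (s, y) \<Rightarrow> a s * b y) \<partial>lebesgue_on ({0..T} \<times> D))
      = (\<integral>s. a s \<partial>lebesgue_on {0..T}) * (\<integral>y. b y \<partial>lebesgue_on D)" .
qed

lemma canvas_R_covariance:
  assumes P: "prob_space P" and I: "white_noise P ({0..T} \<times> D) I" and T: "0 < T" and N: "1 \<le> N"
    and n: "n \<in> {1..N}" "n' \<in> {1..N}" and i: "1 \<le> i" "1 \<le> i'"
  shows "integrable P (\<lambda>\<omega>. canvas_R I (T / real N) i n \<omega> * canvas_R I (T / real N) i' n' \<omega>)"
    "(\<integral>\<omega>. canvas_R I (T / real N) i n \<omega> * canvas_R I (T / real N) i' n' \<omega> \<partial>P)
      = (if n = n' \<and> i = i' then T / real N else 0)"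
proof -
  define dt where "dt = T / real N"
  have dt: "0 < dt" using T N by (simp add: dt_def)
  let ?Q = "{0..T} \<times> D"
  define f where "f i n = (\<lambda>(s, y). indicator (subint dt n) s * phi i y)" for i n
  have sub_meas: "subint dt n \<in> sets borel" for n by (simp add: subint_def)
  have prod_eq: "f i n z * f i' n' z
      = (case z of (s, y) \<Rightarrow> (indicator (subint dt n) s * indicator (subint dt n') s) * (phi i y * phi i' y))"
    for i n i' n' z
    by (simp add: f_def mult_ac split: prod.splits)
  have m1: "(\<lambda>s. indicat_real (subint dt n) s * indicator (subint dt n') s) \<in> borel_measurable borel" for n n'
    using sub_meas by (intro borel_measurable_times borel_measurable_indicator)
  have m2: "(\<lambda>y. phi i y * phi i' y) \<in> borel_measurable borel" for i i'
    by measurable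
  have b1: "\<bar>indicat_real (subint dt n) s * indicator (subint dt n') s\<bar> \<le> 1" for n n' s
    by (simp add: indicator_def)
  have b2: "\<bar>phi i y * phi i' y\<bar> \<le> 4" for i i' y
    using mult_mono[OF phi_bound[of i y] phi_bound[of i' y]] by (simp add: abs_mult)
  have L2: "f i n \<in> L2 ?Q" for i n
  proof -
    have "f i n \<in> borel_measurable borel"
      unfolding f_def borel_prod[symmetric] using sub_meas[of n] by measurable
    then have "f i n \<in> borel_measurable (lebesgue_on ?Q)"
      by (intro measurable_restrict_space1 measurable_completion) simp
    moreover have "integrable (lebesgue_on ?Q) (\<lambda>z. f i n z * f i n z)"
      unfolding prod_eq by (rule space_time_L2_inner(1)[OF m1 m2 b1 b2])
    ultimately show ?thesis by (simp add: L2_def power2_eq_square)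
  qed
  have time: "(\<integral>s. indicat_real (subint dt n) s * indicator (subint dt n') s \<partial>lebesgue_on {0..T}) = (if n = n' then dt else 0)"
  proof -
    have n1: "1 \<le> n" "1 \<le> n'" "n \<le> N" using n by auto
    have "real n * dt \<le> real N * dt" using n1 dt by (intro mult_right_mono) auto
    then have nT: "real n * dt \<le> T" using N by (simp add: dt_def)
    have sub: "subint dt n \<subseteq> {0..T}"
    proof
      fix s assume "s \<in> subint dt n"
      then have "real (n - 1) * dt < s" "s < real n * dt" using subint_eq[OF n1(1)] by auto
      moreover have "0 \<le> real (n - 1) * dt" using dt by simp
      ultimately show "s \<in> {0..T}" using nT by auto
    qed
    have "(\<integral>s. indicat_real (subint dt n) s * indicator (subint dt n') s \<partial>lebesgue_on {0..T})
        = (\<integral>s. indicat_real (subint dt n') s \<partial>lebesgue_on (subint dt n))"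
    proof -
      have "(\<integral>s. indicat_real (subint dt n) s * indicator (subint dt n') s \<partial>lebesgue_on {0..T})
          = (\<integral>s. indicator {0..T} s *\<^sub>R (indicat_real (subint dt n) s * indicator (subint dt n') s) \<partial>lebesgue)"
        by (rule integral_restrict_space) simp
      also have "\<dots> = (\<integral>s. indicator (subint dt n) s *\<^sub>R indicat_real (subint dt n') s \<partial>lebesgue)"
        using sub by (intro Bochner_Integration.integral_cong) (auto simp: indicator_def)
      also have "\<dots> = (\<integral>s. indicat_real (subint dt n') s \<partial>lebesgue_on (subint dt n))"
        using sub_meas[of n] by (intro integral_restrict_space[symmetric]) simp
      finally show ?thesis .
    qed
    also have "\<dots> = overlap (real (n - 1) * dt) (real n * dt) (real (n' - 1) * dt) (real n' * dt)"
      unfolding subint_eq[OF n1(1)] subint_eq[OF n1(2)] by (rule measure_lebesgue_on_Ioo_Int)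
    also have "\<dots> = (if n = n' then dt else 0)"
    proof (cases n n' rule: linorder_cases)
      case less
      then have "real n * dt \<le> real (n' - 1) * dt" using dt by (intro mult_right_mono) auto
      then show ?thesis using less by (simp add: overlap_def)
    next
      case equal
      have "real (n - 1) * dt = real n * dt - dt" using n1 by (simp add: of_nat_diff algebra_simps)
      then show ?thesis using equal dt by (simp add: overlap_def)
    next
      case greater
      then have "real n' * dt \<le> real (n - 1) * dt" using dt by (intro mult_right_mono) auto
      then show ?thesis using greater by (simp add: overlap_def)
    qed
    finally show ?thesis .
  qed
  have "L2_inner ?Q (f i n) (f i' n') = (if n = n' then dt else 0) * (if i = i' then 1 else 0)"
    unfolding L2_inner_def prod_eq space_time_L2_inner(2)[OF m1 m2 b1 b2] time
    using phi_orthonormal[OF i] by (simp add: L2_inner_def)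
  then have inner: "L2_inner ?Q (f i n) (f i' n') = (if n = n' \<and> i = i' then dt else 0)" by auto
  have R: "canvas_R I dt i n = I (f i n)" for i n by (simp add: canvas_R_def f_def)
  show "integrable P (\<lambda>\<omega>. canvas_R I (T / real N) i n \<omega> * canvas_R I (T / real N) i' n' \<omega>)"
    "(\<integral>\<omega>. canvas_R I (T / real N) i n \<omega> * canvas_R I (T / real N) i' n' \<omega> \<partial>P)
      = (if n = n' \<and> i = i' then T / real N else 0)"
    unfolding dt_def[symmetric] R
    using white_noise_covariance[OF P I L2[of i n] L2[of i' n']] inner by simp_all
qed

section \<open>Mode expansions of the load, the canvas solution and the approximations\<close>

text \<open>\<open>slab_overlap\<close> and \<open>slab_amplitude\<close> are \<open>ov\<close> and
  \<open>b\<close> of \<open>mode_load\<close> with all parameters explicit, for statements outside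
  the locale.\<close>

definition slab_overlap :: "real \<Rightarrow> nat \<Rightarrow> nat \<Rightarrow> nat \<Rightarrow> nat \<Rightarrow> real" where
  "slab_overlap T M N k n = overlap (real (k - 1) * (T / real M)) (real k * (T / real M))
     (real (n - 1) * (T / real N)) (real n * (T / real N))"

definition slab_amplitude :: "real \<Rightarrow> nat \<Rightarrow> (real \<Rightarrow> real) \<Rightarrow> real \<Rightarrow> nat \<Rightarrow> real" where
  "slab_amplitude T N Y t n = Y (t - min (real (n - 1) * (T / real N)) t) - Y (t - min (real n * (T / real N)) t)"

lemma canvas_load_expansion:
  "canvas_load I T N K \<omega> t x = (\<Sum>p\<in>{1..K} \<times> {1..N}.
     (canvas_R I (T / real N) (fst p) (snd p) \<omega> / (T / real N) * indicator (subint (T / real N) (snd p)) t) * phi (fst p) x)"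
proof -
  have "canvas_load I T N K \<omega> t x = (\<Sum>n\<in>{1..N}. \<Sum>i\<in>{1..K}.
     (canvas_R I (T / real N) i n \<omega> / (T / real N) * indicator (subint (T / real N) n) t) * phi i x)"
    by (simp add: canvas_load_def Let_def sum_distrib_left mult_ac)
  also have "\<dots> = (\<Sum>i\<in>{1..K}. \<Sum>n\<in>{1..N}.
     (canvas_R I (T / real N) i n \<omega> / (T / real N) * indicator (subint (T / real N) n) t) * phi i x)"
    by (rule sum.swap)
  finally show ?thesis by (simp add: sum.cartesian_product case_prod_unfold)
qed

lemma phi_L2: "phi i \<in> L2 D"
  unfolding phi_def[abs_def] by (intro continuous_L2_D continuous_intros)

text \<open>Termwise integration and orthogonality single out one term of the series. At a positive
  time the exponential is at most of order l^-4, which against the factor l leaves l^-3 and makes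
  the series absolutely summable, uniformly in y.\<close>

lemma Psi_phi:
  assumes \<tau>: "0 < \<tau>" and i: "1 \<le> i"
  shows "integrable (lebesgue_on D) (\<lambda>y. Psi \<mu> \<tau> x y * phi i y)"
    "(\<integral>y. Psi \<mu> \<tau> x y * phi i y \<partial>lebesgue_on D) = - lam i * exp (- ((lam i)\<^sup>2 * ((lam i)\<^sup>2 - \<mu>) * \<tau>)) * eps i x"
proof -
  define a where "a j = lam (Suc j) * exp (- ((lam (Suc j))\<^sup>2 * ((lam (Suc j))\<^sup>2 - \<mu>) * \<tau>)) * eps (Suc j) x" for j
  \<comment> \<open>One 2 comes from exp (- z) <= 1 / z with z = l^4 \<tau> / 2, the other bounds
    \<open>eps\<close>.\<close>
  define B where "B = 4 * exp (\<mu>\<^sup>2 * \<tau> / 2) / \<tau>"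
  have a_le: "\<bar>a j\<bar> \<le> B * inverse (real (Suc j) ^ 2)" for j
  proof -
    define l where "l = lam (Suc j)"
    have l: "real (Suc j) \<le> l" "1 \<le> l" using lam_ge[of "Suc j"] by (auto simp: l_def)
    have "l ^ 4 / 2 - \<mu>\<^sup>2 / 2 \<le> l\<^sup>2 * (l\<^sup>2 - \<mu>)"
      using zero_le_power2[of "l\<^sup>2 - \<mu>"] by (simp add: power2_diff algebra_simps flip: power_add power_mult)
    then have "(l ^ 4 / 2 - \<mu>\<^sup>2 / 2) * \<tau> \<le> l\<^sup>2 * (l\<^sup>2 - \<mu>) * \<tau>" using \<tau> by (intro mult_right_mono) auto
    then have "exp (- (l\<^sup>2 * (l\<^sup>2 - \<mu>) * \<tau>)) \<le> exp (\<mu>\<^sup>2 * \<tau> / 2 + - (l ^ 4 * \<tau> / 2))"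
      by (simp add: algebra_simps)
    also have "\<dots> = exp (\<mu>\<^sup>2 * \<tau> / 2) * exp (- (l ^ 4 * \<tau> / 2))" by (rule exp_add)
    also have "exp (- (l ^ 4 * \<tau> / 2)) \<le> 2 / (l ^ 4 * \<tau>)"
    proof -
      have z: "0 < l ^ 4 * \<tau> / 2" using l \<tau> by simp
      have "l ^ 4 * \<tau> / 2 \<le> exp (l ^ 4 * \<tau> / 2)" using exp_ge_add_one_self[of "l ^ 4 * \<tau> / 2"] by linarith
      then have "1 / exp (l ^ 4 * \<tau> / 2) \<le> 1 / (l ^ 4 * \<tau> / 2)" using z by (intro divide_left_mono) auto
      then show ?thesis by (simp add: exp_minus inverse_eq_divide)
    qed
    finally have e: "exp (- (l\<^sup>2 * (l\<^sup>2 - \<mu>) * \<tau>)) \<le> exp (\<mu>\<^sup>2 * \<tau> / 2) * (2 / (l ^ 4 * \<tau>))"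
      by (simp add: mult_left_mono)
    have "sqrt 2 \<le> 2" by (rule real_le_lsqrt) auto
    then have "sqrt 2 * \<bar>sin (l * x)\<bar> \<le> 2 * 1" by (intro mult_mono) auto
    then have s: "\<bar>eps (Suc j) x\<bar> \<le> 2" by (simp add: eps_def abs_mult l_def)
    have "\<bar>a j\<bar> = l * exp (- (l\<^sup>2 * (l\<^sup>2 - \<mu>) * \<tau>)) * \<bar>eps (Suc j) x\<bar>"
      using l by (simp add: a_def abs_mult flip: l_def)
    also have "\<dots> \<le> l * (exp (\<mu>\<^sup>2 * \<tau> / 2) * (2 / (l ^ 4 * \<tau>))) * 2"
      using l s e \<tau> by (intro mult_mono mult_left_mono) auto
    also have "\<dots> = B * (l / l ^ 4)" by (simp add: B_def mult_ac)
    also have "\<dots> \<le> B * inverse (real (Suc j) ^ 2)"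
    proof (intro mult_left_mono)
      have "l / l ^ 4 = inverse (l ^ 3)" using l by (simp add: field_simps power_eq_if)
      also have "\<dots> \<le> inverse (l ^ 2)" using l by (intro le_imp_inverse_le power_increasing) auto
      also have "\<dots> \<le> inverse (real (Suc j) ^ 2)" using l by (intro le_imp_inverse_le power_mono) auto
      finally show "l / l ^ 4 \<le> inverse (real (Suc j) ^ 2)" .
    qed (use \<tau> in \<open>simp add: B_def\<close>)
    finally show ?thesis .
  qed
  have "summable (\<lambda>j. inverse (real (Suc j) ^ 2))"
    using inverse_power_summable[of 2] by (subst summable_Suc_iff) auto
  then have sa: "summable (\<lambda>j. \<bar>a j\<bar>)"
    using a_le by (intro summable_comparison_test'[of "\<lambda>j. B * inverse (real (Suc j) ^ 2)" 0 "\<lambda>j. \<bar>a j\<bar>"] summable_mult)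
      (auto simp del: of_nat_Suc)
  define f where "f j y = a j * (phi (Suc j) y * phi i y)" for j y
  have ff: "\<bar>f j y\<bar> \<le> 4 * \<bar>a j\<bar>" for j y
  proof -
    have "\<bar>phi (Suc j) y * phi i y\<bar> \<le> 4"
      using mult_mono[OF phi_bound[of "Suc j" y] phi_bound[of i y]] by (simp add: abs_mult)
    then have "\<bar>a j\<bar> * \<bar>phi (Suc j) y * phi i y\<bar> \<le> \<bar>a j\<bar> * 4" by (intro mult_left_mono) auto
    then show ?thesis by (simp add: f_def abs_mult mult_ac)
  qed
  have int: "integrable (lebesgue_on D) (f j)" for j
    unfolding f_def[abs_def] by (intro integrable_mult_right L2_mult_integrable phi_L2)
  have s1: "summable (\<lambda>j. norm (f j y))" for y
    using ff sa by (intro summable_comparison_test'[of "\<lambda>j. 4 * \<bar>a j\<bar>" 0 "\<lambda>j. norm (f j y)"] summable_mult) auto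
  have s2: "summable (\<lambda>j. \<integral>y. norm (f j y) \<partial>lebesgue_on D)"
  proof (rule summable_comparison_test'[of "\<lambda>j. 4 * \<bar>a j\<bar>" 0])
    show "summable (\<lambda>j. 4 * \<bar>a j\<bar>)" using sa by (rule summable_mult)
    fix j
    interpret finite_measure "lebesgue_on D" by (rule finite_measure_D)
    have "(\<integral>y. norm (f j y) \<partial>lebesgue_on D) \<le> (\<integral>y. 4 * \<bar>a j\<bar> \<partial>lebesgue_on D)"
      using int ff by (intro integral_mono integrable_norm) auto
    then show "norm (\<integral>y. norm (f j y) \<partial>lebesgue_on D) \<le> 4 * \<bar>a j\<bar>" by simp
  qed
  have eq: "Psi \<mu> \<tau> x y * phi i y = - (\<Sum>j. f j y)" for y
  proof -
    have "summable (\<lambda>j. a j * phi (Suc j) y)"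
    proof (rule summable_comparison_test'[of "\<lambda>j. 2 * \<bar>a j\<bar>" 0])
      fix j
      have "\<bar>a j\<bar> * \<bar>phi (Suc j) y\<bar> \<le> \<bar>a j\<bar> * 2" by (intro mult_left_mono phi_bound) auto
      then show "norm (a j * phi (Suc j) y) \<le> 2 * \<bar>a j\<bar>" by (simp add: abs_mult mult_ac)
    qed (use sa in \<open>rule summable_mult\<close>)
    from suminf_mult2[OF this, of "phi i y"] show ?thesis
      by (simp add: Psi_def Let_def f_def a_def mult.assoc)
  qed
  show "integrable (lebesgue_on D) (\<lambda>y. Psi \<mu> \<tau> x y * phi i y)"
    unfolding eq using int s1 s2 by (intro Bochner_Integration.integrable_minus integrable_suminf) auto
  have "(\<integral>y. Psi \<mu> \<tau> x y * phi i y \<partial>lebesgue_on D) = - (\<Sum>j. \<integral>y. f j y \<partial>lebesgue_on D)"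
    unfolding eq using int s1 s2 by (subst integral_suminf[symmetric]) auto
  also have "(\<lambda>j. \<integral>y. f j y \<partial>lebesgue_on D) = (\<lambda>j. if j = i - 1 then a j else 0)"
  proof
    fix j
    have "(\<integral>y. f j y \<partial>lebesgue_on D) = a j * L2_inner D (phi (Suc j)) (phi i)" by (simp add: f_def L2_inner_def)
    then show "(\<integral>y. f j y \<partial>lebesgue_on D) = (if j = i - 1 then a j else 0)"
      using phi_orthonormal[of "Suc j" i] i by auto
  qed
  also have "(\<Sum>j. if j = i - 1 then a j else 0) = a (i - 1)"
    using sums_single[of "i - 1" a] by (rule sums_unique[symmetric])
  finally show "(\<integral>y. Psi \<mu> \<tau> x y * phi i y \<partial>lebesgue_on D)
      = - lam i * exp (- ((lam i)\<^sup>2 * ((lam i)\<^sup>2 - \<mu>) * \<tau>)) * eps i x"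
    using i by (simp add: a_def)
qed

lemma slab_integral:
  assumes T: "0 < T" and N: "1 \<le> N" and n: "1 \<le> n" and t: "0 \<le> t"
    and Y: "\<And>s. (Y has_real_derivative y s) (at s)" and y: "continuous_on UNIV y"
  shows "integrable (lebesgue_on {0<..<t}) (\<lambda>s. indicator (subint (T / real N) n) s * y (t - s))"
    "(\<integral>s. indicator (subint (T / real N) n) s * y (t - s) \<partial>lebesgue_on {0<..<t}) = slab_amplitude T N Y t n"
proof -
  define a where "a = min (real (n - 1) * (T / real N)) t"
  define b where "b = min (real n * (T / real N)) t"
  have "real (n - 1) * (T / real N) \<le> real n * (T / real N)" using T by (intro mult_right_mono) auto
  then have ab: "a \<le> b" by (auto simp: a_def b_def)
  have n0: "0 \<le> real (n - 1) * (T / real N)" using T by simp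
  have ind: "indicator {0<..<t} s *\<^sub>R (indicator (subint (T / real N) n) s * y (t - s)) = indicator {a<..<b} s *\<^sub>R y (t - s)" for s
    using n0 unfolding subint_eq[OF n] by (auto simp: indicator_def a_def b_def)
  have D: "((\<lambda>s. - Y (t - s)) has_real_derivative y (t - s)) (at s)" for s
    by (auto intro!: derivative_eq_intros DERIV_chain2[OF Y])
  have cont: "continuous_on {a..b} (\<lambda>s. y (t - s))"
    by (rule continuous_on_compose2[OF y]) (auto intro!: continuous_intros)
  note F = integral_lebesgue_on_Ioo_FTC[OF ab D cont]
  show "integrable (lebesgue_on {0<..<t}) (\<lambda>s. indicator (subint (T / real N) n) s * y (t - s))"
  proof (subst integrable_restrict_space)
    have "integrable lebesgue (\<lambda>s. indicator {a<..<b} s *\<^sub>R y (t - s))"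
      using F(1) by (subst (asm) integrable_restrict_space) simp_all
    then show "integrable lebesgue (\<lambda>s. indicator {0<..<t} s *\<^sub>R (indicator (subint (T / real N) n) s * y (t - s)))"
      by (simp only: ind)
  qed simp
  have "(\<integral>s. indicator (subint (T / real N) n) s * y (t - s) \<partial>lebesgue_on {0<..<t})
      = (\<integral>s. indicator {a<..<b} s *\<^sub>R y (t - s) \<partial>lebesgue)"
    by (subst integral_restrict_space) (simp_all only: ind, simp)
  also have "\<dots> = (\<integral>s. y (t - s) \<partial>lebesgue_on {a<..<b})" by (rule integral_restrict_space[symmetric]) simp
  finally show "(\<integral>s. indicator (subint (T / real N) n) s * y (t - s) \<partial>lebesgue_on {0<..<t}) = slab_amplitude T N Y t n"
    using F(2) by (simp add: slab_amplitude_def a_def b_def)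
qed

text \<open>Only times s strictly between 0 and t enter, so \<open>Psi\<close> is evaluated at
  positive times, where \<open>Psi_phi\<close> applies.\<close>

lemma canvas_solution_expansion:
  assumes T: "0 < T" and N: "1 \<le> N" and t: "0 \<le> t"
    and Y: "\<And>i s. (Y i has_real_derivative exp (- ((lam i)\<^sup>2 * ((lam i)\<^sup>2 - \<mu>) * s))) (at s)"
  shows "canvas_solution \<mu> (canvas_load I T N K \<omega>) t x = (\<Sum>p\<in>{1..K} \<times> {1..N}.
    canvas_R I (T / real N) (fst p) (snd p) \<omega> / (T / real N) * - lam (fst p) * (slab_amplitude T N (Y (fst p)) t (snd p) * eps (fst p) x))"
proof -
  define dt where "dt = T / real N"
  define R where "R p = canvas_R I dt (fst p) (snd p) \<omega> / dt" for p
  define A where "A = {1..K} \<times> {1..N}"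
  define y where "y i s = exp (- ((lam i)\<^sup>2 * ((lam i)\<^sup>2 - \<mu>) * s))" for i s
  have ycont: "continuous_on UNIV (y i)" for i unfolding y_def[abs_def] by (intro continuous_intros)
  have YD: "(Y i has_real_derivative y i s) (at s)" for i s unfolding y_def by (rule Y)
  have A: "1 \<le> fst p" "1 \<le> snd p" if "p \<in> A" for p using that by (auto simp: A_def)
  have inner: "(\<integral>y. Psi \<mu> (t - s) x y * canvas_load I T N K \<omega> s y \<partial>lebesgue_on D)
      = (\<Sum>p\<in>A. (R p * - lam (fst p) * eps (fst p) x) * (indicator (subint dt (snd p)) s * y (fst p) (t - s)))"
    if s: "s \<in> {0<..<t}" for s
  proof -
    have ts: "0 < t - s" using s by simp
    have "(\<integral>y. Psi \<mu> (t - s) x y * canvas_load I T N K \<omega> s y \<partial>lebesgue_on D)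
        = (\<integral>y. (\<Sum>p\<in>A. (R p * indicator (subint dt (snd p)) s) * (Psi \<mu> (t - s) x y * phi (fst p) y)) \<partial>lebesgue_on D)"
      by (simp add: canvas_load_expansion sum_distrib_left R_def dt_def A_def mult_ac)
    also have "\<dots> = (\<Sum>p\<in>A. (R p * indicator (subint dt (snd p)) s) * (\<integral>y. Psi \<mu> (t - s) x y * phi (fst p) y \<partial>lebesgue_on D))"
      using Psi_phi(1)[OF ts] A by (subst Bochner_Integration.integral_sum) auto
    also have "\<dots> = (\<Sum>p\<in>A. (R p * - lam (fst p) * eps (fst p) x) * (indicator (subint dt (snd p)) s * y (fst p) (t - s)))"
      using Psi_phi(2)[OF ts] A by (intro sum.cong refl) (simp add: y_def)
    finally show ?thesis .
  qed
  have "canvas_solution \<mu> (canvas_load I T N K \<omega>) t x = (\<integral>s. (\<Sum>p\<in>A. (R p * - lam (fst p) * eps (fst p) x)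
      * (indicator (subint dt (snd p)) s * y (fst p) (t - s))) \<partial>lebesgue_on {0<..<t})"
    unfolding canvas_solution_def using inner by (intro Bochner_Integration.integral_cong) auto
  also have "\<dots> = (\<Sum>p\<in>A. (R p * - lam (fst p) * eps (fst p) x)
      * (\<integral>s. indicator (subint dt (snd p)) s * y (fst p) (t - s) \<partial>lebesgue_on {0<..<t}))"
    using slab_integral(1)[OF T N A(2) t YD ycont]
    by (subst Bochner_Integration.integral_sum) (auto simp: dt_def)
  also have "\<dots> = (\<Sum>p\<in>A. R p * - lam (fst p) * (slab_amplitude T N (Y (fst p)) t (snd p) * eps (fst p) x))"
    using slab_integral(2)[OF T N A(2) t YD ycont] by (intro sum.cong refl) (simp add: dt_def)
  finally show ?thesis by (simp add: R_def dt_def A_def)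
qed

lemma load_integral:
  assumes k: "1 \<le> k" and \<zeta>: "\<zeta> \<in> L2 D"
  shows "(\<integral>t. L2_inner D (deriv (canvas_load I T N K \<omega> t)) \<zeta> \<partial>lebesgue_on (subint (T / real M) k))
    = (\<Sum>p\<in>{1..K} \<times> {1..N}. canvas_R I (T / real N) (fst p) (snd p) \<omega> / (T / real N) * - lam (fst p)
        * (slab_overlap T M N k (snd p) * L2_inner D (eps (fst p)) \<zeta>))"
proof -
  define dt where "dt = T / real N"
  define R where "R p = canvas_R I dt (fst p) (snd p) \<omega> / dt" for p
  define A where "A = {1..K} \<times> {1..N}"
  have A: "1 \<le> snd p" if "p \<in> A" for p using that by (auto simp: A_def)
  have "deriv (canvas_load I T N K \<omega> t) = (\<lambda>x. \<Sum>p\<in>A. (R p * indicator (subint dt (snd p)) t * - lam (fst p)) * eps (fst p) x)" for t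
  proof (rule deriv_eqI)
    fix x
    have "canvas_load I T N K \<omega> t = (\<lambda>x. \<Sum>p\<in>A. (R p * indicator (subint dt (snd p)) t) * phi (fst p) x)"
      by (rule ext) (simp add: canvas_load_expansion R_def dt_def A_def)
    moreover have "(phi i has_real_derivative - lam i * eps i x) (at x)" for i
      unfolding phi_def[abs_def] eps_def by (auto intro!: derivative_eq_intros)
    ultimately show "(canvas_load I T N K \<omega> t has_real_derivative
        (\<Sum>p\<in>A. (R p * indicator (subint dt (snd p)) t * - lam (fst p)) * eps (fst p) x)) (at x)"
      by (auto intro!: derivative_eq_intros sum.cong)
  qed
  then have "L2_inner D (deriv (canvas_load I T N K \<omega> t)) \<zeta>
      = (\<Sum>p\<in>A. (R p * - lam (fst p) * L2_inner D (eps (fst p)) \<zeta>) * indicat_real (subint dt (snd p)) t)" for t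
    by (simp only: L2_inner_sum[OF eps_sobolev(3) \<zeta>]) (simp add: mult_ac)
  then have "(\<integral>t. L2_inner D (deriv (canvas_load I T N K \<omega> t)) \<zeta> \<partial>lebesgue_on (subint (T / real M) k))
      = (\<integral>t. (\<Sum>p\<in>A. (R p * - lam (fst p) * L2_inner D (eps (fst p)) \<zeta>) * indicat_real (subint dt (snd p)) t)
          \<partial>lebesgue_on (subint (T / real M) k))" by simp
  also have "\<dots> = (\<Sum>p\<in>A. (R p * - lam (fst p) * L2_inner D (eps (fst p)) \<zeta>)
      * (\<integral>t. indicat_real (subint dt (snd p)) t \<partial>lebesgue_on (subint (T / real M) k)))"
  proof (subst Bochner_Integration.integral_sum)
    fix p :: "nat \<times> nat"
    have fin: "finite_measure (lebesgue_on (subint (T / real M) k))"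
      by (rule finite_measure_lebesgue_on) (simp add: subint_def)
    interpret finite_measure "lebesgue_on (subint (T / real M) k)" by (rule fin)
    have "integrable (lebesgue_on (subint (T / real M) k)) (indicat_real (subint dt (snd p)))"
    proof (rule integrable_const_bound[of _ 1])
      have "indicat_real (subint dt (snd p)) \<in> borel_measurable lebesgue"
        by (intro borel_measurable_indicator) (simp add: subint_def)
      then show "indicat_real (subint dt (snd p)) \<in> borel_measurable (lebesgue_on (subint (T / real M) k))"
        by (rule measurable_restrict_space1)
    qed (auto simp: indicator_def)
    then show "integrable (lebesgue_on (subint (T / real M) k))
        (\<lambda>t. (R p * - lam (fst p) * L2_inner D (eps (fst p)) \<zeta>) * indicat_real (subint dt (snd p)) t)"
      by (rule integrable_mult_right)
  qed simp
  also have "\<dots> = (\<Sum>p\<in>A. R p * - lam (fst p) * (slab_overlap T M N k (snd p) * L2_inner D (eps (fst p)) \<zeta>))"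
  proof (intro sum.cong refl)
    fix p :: "nat \<times> nat" assume "p \<in> A"
    then have "(\<integral>t. indicat_real (subint dt (snd p)) t \<partial>lebesgue_on (subint (T / real M) k)) = slab_overlap T M N k (snd p)"
      unfolding subint_eq[OF k] subint_eq[OF A] slab_overlap_def dt_def
      using A by (simp only: subint_eq measure_lebesgue_on_Ioo_Int)
    then show "(R p * - lam (fst p) * L2_inner D (eps (fst p)) \<zeta>)
      * (\<integral>t. indicat_real (subint dt (snd p)) t \<partial>lebesgue_on (subint (T / real M) k))
      = R p * - lam (fst p) * (slab_overlap T M N k (snd p) * L2_inner D (eps (fst p)) \<zeta>)"
      by simp
  qed
  finally show ?thesis by (simp add: R_def dt_def A_def)
qed

text \<open>Discrete Duhamel principle: the scheme has constant coefficients in time, so the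
  convolution of the weights c with the impulse response solves it for the load c m times e.\<close>

lemma superposed_response_scheme:
  fixes c :: "nat \<Rightarrow> real"
  assumes fe: "fe_space r h S" and V: "impulse_response d \<mu> S e V" and m: "1 \<le> m" and \<zeta>: "\<zeta> \<in> S"
  defines "W \<equiv> \<lambda>m x. \<Sum>k\<in>{1..m}. c k * V (m + 1 - k) x"
  shows "L2_inner D (W m) \<zeta> - L2_inner D (W (m - 1)) \<zeta>
    + d * (bending (W m) \<zeta> + \<mu> * L2_inner D (weak_deriv 2 (W (m - 1))) \<zeta>) = c m * L2_inner D e \<zeta>"
proof -
  note s2 = fe_spaceD(1)[OF fe] note L2 = fe_space_L2[OF fe]
  have VS: "V n \<in> S" for n using V by (simp add: impulse_response_def)
  have V0: "V 0 = (\<lambda>x. 0)" using V by (simp add: impulse_response_def)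
  define v where "v n = L2_inner D (V n) \<zeta>" for n
  define b where "b n = bending (V n) \<zeta>" for n
  define g where "g n = L2_inner D (weak_deriv 2 (V n)) \<zeta>" for n
  define e0 where "e0 = L2_inner D e \<zeta>"
  have wsum: "L2_inner D (weak_deriv 2 (\<lambda>x. \<Sum>j\<in>A. a j * V (f j) x)) \<zeta> = (\<Sum>j\<in>A. a j * g (f j))" for A a and f :: "nat \<Rightarrow> nat"
    using L2_inner_weak_deriv_sum[of A "\<lambda>j. V (f j)" 2 2 \<zeta> a] s2[OF VS] L2[OF \<zeta>] by (simp add: g_def)
  have bsum: "bending (\<lambda>x. \<Sum>j\<in>A. a j * V (f j) x) \<zeta> = (\<Sum>j\<in>A. a j * b (f j))" for A a and f :: "nat \<Rightarrow> nat"
    unfolding b_def by (intro bending_sum s2 VS \<zeta>)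
  have vsum: "L2_inner D (\<lambda>x. \<Sum>j\<in>A. a j * V (f j) x) \<zeta> = (\<Sum>j\<in>A. a j * v (f j))" for A a and f :: "nat \<Rightarrow> nat"
    unfolding v_def by (intro L2_inner_sum L2 VS \<zeta>)
  have v0: "v 0 = 0" "g 0 = 0"
    using wsum[where A = "{}"] by (simp_all add: v_def g_def V0)
  have summed: "v n + (\<Sum>j\<in>{1..n}. d * b j) + \<mu> * (\<Sum>j\<in>{1..n-1}. d * g j) = e0" if n: "1 \<le> n" for n
  proof -
    have "L2_inner D (V n) \<zeta> + bending (\<lambda>x. \<Sum>j\<in>{1..n}. d * V j x) \<zeta>
       + \<mu> * L2_inner D (weak_deriv 2 (\<lambda>x. \<Sum>j\<in>{1..n-1}. d * V j x)) \<zeta> = L2_inner D e \<zeta>"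
      using V n \<zeta> unfolding impulse_response_def by blast
    then show ?thesis
      unfolding v_def[symmetric] e0_def[symmetric] bsum[where a = "\<lambda>_. d" and f = "\<lambda>j. j"] wsum[where a = "\<lambda>_. d" and f = "\<lambda>j. j"] .
  qed
  \<comment> \<open>Differencing the summed scheme removes the constant datum except at the first
    step: e acts as an impulse.\<close>
  have step: "v n - v (n - 1) + d * (b n + \<mu> * g (n - 1)) = (if n = 1 then e0 else 0)" if n: "1 \<le> n" for n
  proof (cases "n = 1")
    case True
    then show ?thesis using summed[of 1] v0 by simp
  next
    case False
    then have "n = Suc (Suc (n - 2))" using n by arith
    then obtain j where j: "n = Suc (Suc j)" by blast
    show ?thesis using summed[of n] summed[of "n - 1"] by (simp add: j algebra_simps)
  qed
  \<comment> \<open>The summand k = m is zero because \<open>V 0\<close> is, so both values of W are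
    sums over the same range.\<close>
  have W': "W (m - 1) = (\<lambda>x. \<Sum>k\<in>{1..m}. c k * V (m - k) x)"
  proof -
    obtain j where j: "m = Suc j" using m by (cases m) auto
    show ?thesis unfolding W_def j by (simp add: V0)
  qed
  have "L2_inner D (W m) \<zeta> - L2_inner D (W (m - 1)) \<zeta>
    + d * (bending (W m) \<zeta> + \<mu> * L2_inner D (weak_deriv 2 (W (m - 1))) \<zeta>)
    = (\<Sum>k\<in>{1..m}. c k * v (m + 1 - k)) - (\<Sum>k\<in>{1..m}. c k * v (m - k))
      + d * ((\<Sum>k\<in>{1..m}. c k * b (m + 1 - k)) + \<mu> * (\<Sum>k\<in>{1..m}. c k * g (m - k)))"
    unfolding W' unfolding W_def vsum bsum wsum ..
  also have "\<dots> = (\<Sum>k\<in>{1..m}. c k * (v (m + 1 - k) - v (m - k) + d * (b (m + 1 - k) + \<mu> * g (m - k))))"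
    by (simp add: sum.distrib sum_subtractf sum_distrib_left algebra_simps)
  also have "\<dots> = (\<Sum>k\<in>{1..m}. if k = m then c m * e0 else 0)"
  proof (intro sum.cong refl)
    fix k assume k: "k \<in> {1..m}"
    then have "m + 1 - k - 1 = m - k" "1 \<le> m + 1 - k" "(m + 1 - k = 1) = (k = m)" by auto
    then show "c k * (v (m + 1 - k) - v (m - k) + d * (b (m + 1 - k) + \<mu> * g (m - k))) = (if k = m then c m * e0 else 0)"
      using step[of "m + 1 - k"] by auto
  qed
  also have "\<dots> = c m * e0" using m by simp
  finally show ?thesis by (simp add: e0_def)
qed

text \<open>Each step is tested with the difference itself. The second derivative is carried through
  the induction because the \<mu> term of the next step contains it. Vanishing norms give equality
  almost everywhere.\<close>

lemma scheme_unique: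
  fixes U U' :: "nat \<Rightarrow> real \<Rightarrow> real"
  assumes fe: "fe_space r h S" and d: "0 < d"
    and U: "U 0 = (\<lambda>x. 0)" "\<And>m. m \<in> {1..M} \<Longrightarrow> U m \<in> S"
    and U': "U' 0 = (\<lambda>x. 0)" "\<And>m. m \<in> {1..M} \<Longrightarrow> U' m \<in> S"
    and eq: "\<And>m \<zeta>. m \<in> {1..M} \<Longrightarrow> \<zeta> \<in> S \<Longrightarrow> L2_inner D (U m) \<zeta> - L2_inner D (U (m - 1)) \<zeta>
      + d * (bending (U m) \<zeta> + \<mu> * L2_inner D (weak_deriv 2 (U (m - 1))) \<zeta>) = F m \<zeta>"
    and eq': "\<And>m \<zeta>. m \<in> {1..M} \<Longrightarrow> \<zeta> \<in> S \<Longrightarrow> L2_inner D (U' m) \<zeta> - L2_inner D (U' (m - 1)) \<zeta>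
      + d * (bending (U' m) \<zeta> + \<mu> * L2_inner D (weak_deriv 2 (U' (m - 1))) \<zeta>) = F m \<zeta>"
    and m: "m \<le> M"
  shows "AE x in lebesgue_on D. U m x = U' m x"
proof -
  note s2 = fe_spaceD(1)[OF fe] note L2 = fe_space_L2[OF fe]
  define E where "E m x = 1 * U m x + (-1) * U' m x" for m x
  have US: "U m \<in> S" "U' m \<in> S" if "m \<le> M" for m
  proof -
    have "m = 0 \<or> m \<in> {1..M}" using that by auto
    then show "U m \<in> S" "U' m \<in> S" using U U' fe_spaceD(3)[OF fe] by metis+
  qed
  have ES: "E m \<in> S" if "m \<le> M" for m
    unfolding E_def[abs_def] by (intro fe_spaceD(4)[OF fe] US that)
  have "L2_norm D (E m) = 0 \<and> L2_norm D (weak_deriv 2 (E m)) = 0"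
    using m
  proof (induction m)
    case 0
    have E0: "E 0 = (\<lambda>x. 0)" by (rule ext) (simp add: E_def U U')
    have "AE x in lebesgue_on D. weak_deriv 2 (\<lambda>x. 0 * 0 + 0 * 0) x = 0 * weak_deriv 2 (\<lambda>x. 0) x + 0 * weak_deriv 2 (\<lambda>x. 0) x"
      using weak_deriv_lincomb_AE[OF smooth_sobolev smooth_sobolev order_refl, of "\<lambda>x. 0" "\<lambda>x. 0" 2 0 0] by simp
    then have "L2_norm D (weak_deriv 2 (\<lambda>x. 0)) = L2_norm D (\<lambda>x. 0)"
      by (intro L2_norm_cong_AE weak_deriv_L2[OF smooth_sobolev order_refl]) auto
    then show ?case by (simp add: E0)
  next
    case (Suc m)
    have m: "m \<le> M" "Suc m \<le> M" "Suc m \<in> {1..M}" using Suc.prems by auto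
    let ?z = "E (Suc m)"
    note z = ES[OF m(2)]
    have IH: "L2_norm D (E m) = 0" "L2_norm D (weak_deriv 2 (E m)) = 0" using Suc.IH m by auto
    have lin: "L2_inner D (E j) ?z = L2_inner D (U j) ?z - L2_inner D (U' j) ?z"
      "bending (E j) ?z = bending (U j) ?z - bending (U' j) ?z"
      "L2_inner D (weak_deriv 2 (E j)) ?z = L2_inner D (weak_deriv 2 (U j)) ?z - L2_inner D (weak_deriv 2 (U' j)) ?z"
      if j: "j \<le> M" for j
    proof -
      show "L2_inner D (E j) ?z = L2_inner D (U j) ?z - L2_inner D (U' j) ?z"
        using L2_inner_lincomb[OF L2[OF US(1)[OF j]] L2[OF US(2)[OF j]] L2[OF z], of 1 "-1"] by (simp add: E_def[abs_def])
      show "bending (E j) ?z = bending (U j) ?z - bending (U' j) ?z"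
        using bending_lincomb[OF s2[OF US(1)[OF j]] s2[OF US(2)[OF j]] s2[OF z], of 1 "-1"] by (simp add: E_def[abs_def])
      show "L2_inner D (weak_deriv 2 (E j)) ?z = L2_inner D (weak_deriv 2 (U j)) ?z - L2_inner D (weak_deriv 2 (U' j)) ?z"
        using L2_inner_weak_deriv_lincomb[OF s2[OF US(1)[OF j]] s2[OF US(2)[OF j]] order_refl L2[OF z], of 1 "-1"]
        by (simp add: E_def[abs_def])
    qed
    have "L2_inner D ?z ?z - L2_inner D (E m) ?z + d * (bending ?z ?z + \<mu> * L2_inner D (weak_deriv 2 (E m)) ?z) = 0"
    proof -
      have "L2_inner D ?z ?z - L2_inner D (E m) ?z + d * (bending ?z ?z + \<mu> * L2_inner D (weak_deriv 2 (E m)) ?z)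
        = (L2_inner D (U (Suc m)) ?z - L2_inner D (U m) ?z
            + d * (bending (U (Suc m)) ?z + \<mu> * L2_inner D (weak_deriv 2 (U m)) ?z))
          - (L2_inner D (U' (Suc m)) ?z - L2_inner D (U' m) ?z
            + d * (bending (U' (Suc m)) ?z + \<mu> * L2_inner D (weak_deriv 2 (U' m)) ?z))"
        unfolding lin[OF m(2)] lin[OF m(1)] by (simp add: algebra_simps)
      then show ?thesis using eq[OF m(3) z] eq'[OF m(3) z] by simp
    qed
    moreover have "L2_inner D (E m) ?z = 0" using L2_Cauchy_Schwarz[OF L2[OF ES[OF m(1)]] L2[OF z]] IH by simp
    moreover have "L2_inner D (weak_deriv 2 (E m)) ?z = 0"
      using L2_Cauchy_Schwarz[OF weak_deriv_L2[OF s2[OF ES[OF m(1)]] order_refl] L2[OF z]] IH by simp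
    ultimately have "L2_inner D ?z ?z + d * bending ?z ?z = 0" by simp
    moreover have "0 \<le> L2_inner D ?z ?z" "0 \<le> d * bending ?z ?z" using d by (simp_all add: bending_self)
    ultimately have "L2_inner D ?z ?z = 0" "d * bending ?z ?z = 0" by linarith+
    then show ?case using d by (simp add: L2_norm_def bending_def)
  qed
  then have "AE x in lebesgue_on D. E m x = 0" using L2_norm_eq_0_AE[OF L2[OF ES[OF m]]] by blast
  then show ?thesis by eventually_elim (simp add: E_def)
qed

text \<open>The integrated load is a finite combination of the functions \<open>eps i\<close>, so
  the superposed responses solve the same scheme as \<open>U\<close>, and uniqueness identifies the
  two. The factor \<open>- lam\<close> stems from differentiating \<open>phi\<close>.\<close>

lemma imex_fem_expansion:
  assumes fe: "fe_space r h S" and T: "0 < T" and M: "1 \<le> M"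
    and U: "imex_fem T \<mu> S (canvas_load I T N K \<omega>) M U"
    and V: "\<And>i. 1 \<le> i \<Longrightarrow> impulse_response (T / real M) \<mu> S (eps i) (V i)"
    and m: "m \<le> M"
  shows "AE x in lebesgue_on D. U m x = (\<Sum>p\<in>{1..K} \<times> {1..N}.
    (canvas_R I (T / real N) (fst p) (snd p) \<omega> / (T / real N) * - lam (fst p))
      * (\<Sum>k\<in>{1..m}. slab_overlap T M N k (snd p) * V (fst p) (m + 1 - k) x))"
proof -
  note s2 = fe_spaceD(1)[OF fe] note L2 = fe_space_L2[OF fe]
  define d where "d = T / real M"
  have d: "0 < d" using T M by (simp add: d_def)
  define A where "A = {1..K} \<times> {1..N}"
  define R where "R p = canvas_R I (T / real N) (fst p) (snd p) \<omega> / (T / real N) * - lam (fst p)" for p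
  define W where "W p m x = (\<Sum>k\<in>{1..m}. slab_overlap T M N k (snd p) * V (fst p) (m + 1 - k) x)" for p m x
  define U' where "U' m x = (\<Sum>p\<in>A. R p * W p m x)" for m x
  have A: "1 \<le> fst p" if "p \<in> A" for p using that by (auto simp: A_def)
  have WS: "W p m \<in> S" if "p \<in> A" for p m
    unfolding W_def[abs_def] using V[OF A[OF that]]
    by (intro fe_space_sum[OF fe]) (auto simp: impulse_response_def)
  have "AE x in lebesgue_on D. U m x = U' m x"
  proof (rule scheme_unique[OF fe d])
    show "U 0 = (\<lambda>x. 0)" "U' 0 = (\<lambda>x. 0)" using U by (simp_all add: imex_fem_def Let_def U'_def[abs_def] W_def)
    show US: "U j \<in> S" if "j \<in> {1..M}" for j using U that by (auto simp: imex_fem_def Let_def)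
    show "U' j \<in> S" for j unfolding U'_def[abs_def] by (intro fe_space_sum[OF fe] WS)
    show "m \<le> M" by fact
    fix j \<zeta> assume j: "j \<in> {1..M}" and \<zeta>: "\<zeta> \<in> S"
    have U0: "U (j - 1) \<in> S"
    proof (cases "j = 1")
      case True
      then show ?thesis using U fe_spaceD(3)[OF fe] by (simp add: imex_fem_def Let_def)
    next
      case False
      then show ?thesis using j by (intro US) auto
    qed
    have k: "1 \<le> j" using j by simp
    have "L2_inner D (\<lambda>x. U j x - U (j - 1) x) \<zeta> + d * (bending (U j) \<zeta> + \<mu> * L2_inner D (weak_deriv 2 (U (j - 1))) \<zeta>)
        = (\<integral>\<tau>. L2_inner D (deriv (canvas_load I T N K \<omega> \<tau>)) \<zeta> \<partial>lebesgue_on (subint d j))"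
      using U j \<zeta> by (simp add: imex_fem_def Let_def bending_def d_def)
    also have "\<dots> = (\<Sum>p\<in>A. R p * (slab_overlap T M N j (snd p) * L2_inner D (eps (fst p)) \<zeta>))"
      unfolding d_def load_integral[OF k L2[OF \<zeta>]] A_def R_def ..
    finally show "L2_inner D (U j) \<zeta> - L2_inner D (U (j - 1)) \<zeta> + d * (bending (U j) \<zeta> + \<mu> * L2_inner D (weak_deriv 2 (U (j - 1))) \<zeta>)
        = (\<Sum>p\<in>A. R p * (slab_overlap T M N j (snd p) * L2_inner D (eps (fst p)) \<zeta>))"
      using L2_inner_diff(1)[OF L2[OF US[OF j]] L2[OF U0] L2[OF \<zeta>]] by simp
    have b: "bending (U' i) \<zeta> = (\<Sum>p\<in>A. R p * bending (W p i) \<zeta>)" for i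
      unfolding U'_def[abs_def] by (intro bending_sum s2 WS \<zeta>)
    have w: "L2_inner D (weak_deriv 2 (U' i)) \<zeta> = (\<Sum>p\<in>A. R p * L2_inner D (weak_deriv 2 (W p i)) \<zeta>)" for i
      unfolding U'_def[abs_def] using L2_inner_weak_deriv_sum[of A "\<lambda>p. W p i" 2 2 \<zeta> R] s2[OF WS] L2[OF \<zeta>] by simp
    have v: "L2_inner D (U' i) \<zeta> = (\<Sum>p\<in>A. R p * L2_inner D (W p i) \<zeta>)" for i
      unfolding U'_def[abs_def] by (intro L2_inner_sum L2 WS \<zeta>)
    have "L2_inner D (U' j) \<zeta> - L2_inner D (U' (j - 1)) \<zeta> + d * (bending (U' j) \<zeta> + \<mu> * L2_inner D (weak_deriv 2 (U' (j - 1))) \<zeta>)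
        = (\<Sum>p\<in>A. R p * (L2_inner D (W p j) \<zeta> - L2_inner D (W p (j - 1)) \<zeta>
          + d * (bending (W p j) \<zeta> + \<mu> * L2_inner D (weak_deriv 2 (W p (j - 1))) \<zeta>)))"
      unfolding b w v by (simp add: sum.distrib sum_subtractf sum_distrib_left algebra_simps)
    also have "\<dots> = (\<Sum>p\<in>A. R p * (slab_overlap T M N j (snd p) * L2_inner D (eps (fst p)) \<zeta>))"
    proof (intro sum.cong refl arg_cong2[of _ _ _ _ "(*)"])
      fix p assume p: "p \<in> A"
      show "L2_inner D (W p j) \<zeta> - L2_inner D (W p (j - 1)) \<zeta>
          + d * (bending (W p j) \<zeta> + \<mu> * L2_inner D (weak_deriv 2 (W p (j - 1))) \<zeta>)
          = slab_overlap T M N j (snd p) * L2_inner D (eps (fst p)) \<zeta>"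
        using superposed_response_scheme[OF fe V[OF A[OF p]] k \<zeta>, of "\<lambda>k. slab_overlap T M N k (snd p)"]
        by (simp add: W_def[abs_def] d_def)
    qed
    finally show "L2_inner D (U' j) \<zeta> - L2_inner D (U' (j - 1)) \<zeta> + d * (bending (U' j) \<zeta> + \<mu> * L2_inner D (weak_deriv 2 (U' (j - 1))) \<zeta>)
        = (\<Sum>p\<in>A. R p * (slab_overlap T M N j (snd p) * L2_inner D (eps (fst p)) \<zeta>))" .
  qed
  then show ?thesis by (simp add: U'_def R_def W_def A_def)
qed

section \<open>The error estimate\<close>

text \<open>\<open>mode_error\<close> freed from its locale; the antiderivative \<open>G\<close> of
  the squared amplitude is supplied inside the proof.\<close>

lemma mode_error_explicit:
  assumes T: "0 < T" and i: "1 \<le> i" and M: "1 \<le> M" and N: "1 \<le> N" and m: "m \<le> M"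
    and Y: "\<And>t. (Y has_real_derivative exp (- ((lam i)\<^sup>2 * ((lam i)\<^sup>2 - \<mu>) * t))) (at t)" "Y 0 = 0"
    and fe: "fe_space r h S" and ap: "approximation_property r C h S" and r: "r = 2 \<or> r = 3" and C: "0 < C"
    and V: "impulse_response (T / real M) \<mu> S (eps i) V"
  defines "err \<equiv> (\<Sum>n\<in>{1..N}. (L2_norm D (\<lambda>x. (\<Sum>k\<in>{1..m}. slab_overlap T M N k n * V (m + 1 - k) x)
      - slab_amplitude T N Y (real m * (T / real M)) n * eps i x))\<^sup>2 / (T / real N))"
  shows "err \<le> 40 * exp (4 * \<mu>\<^sup>2 * T) / lam i ^ 4"
    "err \<le> (2 * mode_const T \<mu> C + 4 * (1 + 2 * \<bar>\<mu>\<bar>)\<^sup>2 * exp (4 * \<mu>\<^sup>2 * T)) / lam i ^ 4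
      * ((T / real M)\<^sup>2 * lam i ^ 8 + h ^ (2 * r) * lam i ^ 6 + h\<^sup>2 * (lam i)\<^sup>2)"
proof -
  define y where "y t = exp (- ((lam i)\<^sup>2 * ((lam i)\<^sup>2 - \<mu>) * t))" for t
  have "isCont (\<lambda>t. (y t)\<^sup>2) t" for t unfolding y_def by (intro continuous_intros)
  then obtain G where G: "G 0 = 0" "\<And>t. (G has_real_derivative (y t)\<^sup>2) (at t)"
    using antiderivative_exists by blast
  interpret mode_load \<mu> T i M y Y G N m
    using T i M N m Y G by unfold_locales (auto simp: y_def[abs_def])
  have ov: "ov k n = slab_overlap T M N k n" for k n
    by (simp add: ov_def slab_overlap_def \<tau>_def t_def d_def dt_def)
  have b: "b n = slab_amplitude T N Y (real m * (T / real M)) n" for n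
    by (simp add: b_def slab_amplitude_def \<alpha>_def \<tau>_def t_def d_def dt_def)
  note e = mode_error[OF fe ap r C, of V, unfolded ov b d_def dt_def, OF V]
  show "err \<le> 40 * exp (4 * \<mu>\<^sup>2 * T) / lam i ^ 4"
    "err \<le> (2 * mode_const T \<mu> C + 4 * (1 + 2 * \<bar>\<mu>\<bar>)\<^sup>2 * exp (4 * \<mu>\<^sup>2 * T)) / lam i ^ 4
      * ((T / real M)\<^sup>2 * lam i ^ 8 + h ^ (2 * r) * lam i ^ 6 + h\<^sup>2 * (lam i)\<^sup>2)"
    unfolding err_def by (rule e)+
qed

text \<open>Comparison with an integral, by the mean value theorem and telescoping. The explicit
  dependence 2 / \<delta> is the source of the factors \<open>\<epsilon>1 powr (-1/2)\<close> and
  \<open>\<epsilon>2 powr (-1/2)\<close> of the theorem.\<close>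

lemma sum_powr_le:
  assumes "0 < \<delta>" "\<delta> \<le> 1"
  shows "(\<Sum>i\<in>{1..K}. real i powr (- 1 - \<delta>)) \<le> 2 / \<delta>"
proof (cases "1 \<le> K")
  case True
  have "(\<Sum>i\<in>{1..K}. real i powr (- 1 - \<delta>)) \<le> 1 + 1 / \<delta> - real K powr (- \<delta>) / \<delta>"
    using True
  proof (induction K rule: nat_induct_at_least)
    case (Suc k)
    then have k: "0 < real k" by simp
    have "((\<lambda>x. x powr (- \<delta>)) has_real_derivative (- \<delta>) * x powr (- \<delta> - 1)) (at x)" if "0 < x" for x :: real
      using that by (auto intro!: derivative_eq_intros)
    then obtain z where z: "real k < z" "z < real (Suc k)"
      "real (Suc k) powr (- \<delta>) - real k powr (- \<delta>) = (real (Suc k) - real k) * ((- \<delta>) * z powr (- \<delta> - 1))"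
      using MVT2[of "real k" "real (Suc k)" "\<lambda>x. x powr (- \<delta>)" "\<lambda>x. (- \<delta>) * x powr (- \<delta> - 1)"] k by auto
    have "real (Suc k) powr (- \<delta> - 1) \<le> z powr (- \<delta> - 1)"
      using z k assms by (intro powr_mono2') auto
    then have "\<delta> * real (Suc k) powr (- \<delta> - 1) \<le> \<delta> * z powr (- \<delta> - 1)" using assms by (intro mult_left_mono) auto
    also have "\<dots> = real k powr (- \<delta>) - real (Suc k) powr (- \<delta>)" using z(3) by simp
    finally have "\<delta> * real (Suc k) powr (- \<delta> - 1) \<le> real k powr (- \<delta>) - real (Suc k) powr (- \<delta>)" .
    moreover have "- \<delta> - 1 = - 1 - \<delta>" by simp
    ultimately have "\<delta> * real (Suc k) powr (- 1 - \<delta>) \<le> real k powr (- \<delta>) - real (Suc k) powr (- \<delta>)"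
      by (simp only:)
    then have "real (Suc k) powr (- 1 - \<delta>) \<le> real k powr (- \<delta>) / \<delta> - real (Suc k) powr (- \<delta>) / \<delta>"
      using assms by (simp add: field_simps)
    then show ?case using Suc.IH by simp
  qed simp
  also have "\<dots> \<le> 1 + 1 / \<delta>" using assms by simp
  also have "\<dots> \<le> 2 / \<delta>" using assms by (simp add: field_simps)
  finally show ?thesis .
qed (use assms in simp)

text \<open>If all X are at most 1, each is bounded by its power with exponent in [0, 1]. Otherwise
  some power is at least 1 and the bound by A alone suffices.\<close>

lemma interpolate_min:
  fixes e A X1 X2 X3 :: real
  assumes "0 \<le> A" "e \<le> A" "e \<le> A * (X1 + X2 + X3)" "0 < X1" "0 < X2" "0 < X3"
    and \<theta>: "\<theta>1 \<in> {0..1}" "\<theta>2 \<in> {0..1}" "\<theta>3 \<in> {0..1}"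
  shows "e \<le> A * (X1 powr \<theta>1 + X2 powr \<theta>2 + X3 powr \<theta>3)"
proof (cases "X1 \<le> 1 \<and> X2 \<le> 1 \<and> X3 \<le> 1")
  case True
  have le: "X \<le> X powr \<theta>" if "0 < X" "X \<le> 1" "\<theta> \<in> {0..1}" for X \<theta> :: real
    using powr_mono'[of \<theta> 1 X] that by simp
  have "X1 + X2 + X3 \<le> X1 powr \<theta>1 + X2 powr \<theta>2 + X3 powr \<theta>3"
    using True assms by (intro add_mono le) auto
  then show ?thesis using mult_left_mono[OF _ assms(1)] assms(3) by (meson order_trans)
next
  case False
  have ge: "1 \<le> X powr \<theta>" if "1 < X" "\<theta> \<in> {0..1}" for X \<theta> :: real
    using that ge_one_powr_ge_zero[of X \<theta>] by auto
  have "1 \<le> X1 powr \<theta>1 + X2 powr \<theta>2 + X3 powr \<theta>3"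
    using False ge[of X1 \<theta>1] ge[of X2 \<theta>2] ge[of X3 \<theta>3] \<theta>
      powr_ge_zero[of X1 \<theta>1] powr_ge_zero[of X2 \<theta>2] powr_ge_zero[of X3 \<theta>3] by linarith
  then have "A * 1 \<le> A * (X1 powr \<theta>1 + X2 powr \<theta>2 + X3 powr \<theta>3)" using assms(1) by (rule mult_left_mono)
  then show ?thesis using assms(2) by simp
qed

lemma power_powr: "0 < x \<Longrightarrow> (x ^ n) powr \<theta> = x powr (real n * \<theta>)" for x :: real
  by (simp add: powr_powr flip: powr_realpow)

text \<open>The exponents interpolate between stability and convergence so that the sum over the modes
  converges, like \<open>\<Sum> i powr (- 1 - \<delta>)\<close> with \<open>\<delta>\<close> proportional to \<open>\<epsilon>1\<close> or \<open>\<epsilon>2\<close>.\<close>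

lemma mode_error_interpolated:
  fixes e \<epsilon>1 \<epsilon>2 d h K :: real
  assumes i: "1 \<le> i" and K: "0 \<le> K" and d: "0 < d" and h: "0 < h" and r: "r = 2 \<or> r = (3 :: nat)"
    and e: "e \<le> K / lam i ^ 4" "e \<le> K / lam i ^ 4 * (d\<^sup>2 * lam i ^ 8 + h ^ (2 * r) * lam i ^ 6 + h\<^sup>2 * (lam i)\<^sup>2)"
    and \<epsilon>: "\<epsilon>1 \<in> {0<..1/8}" "\<epsilon>2 \<in> {0<..real r / 6}"
  shows "(lam i)\<^sup>2 * e \<le> K * (d powr (2 * (1/8 - \<epsilon>1)) * real i powr (- 1 - 8 * \<epsilon>1)
    + h powr (2 * (real r / 6 - \<epsilon>2)) * real i powr (- 1 - 6 * \<epsilon>2 / real r)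
    + h powr (2 * (real r / 6 - \<epsilon>2)) * real i powr (- 1 - 2 * \<epsilon>2))"
proof -
  define l where "l = lam i"
  have l: "real i \<le> l" "1 \<le> l" using lam_ge[OF i] by (auto simp: l_def)
  have l0: "0 < l" using l by simp
  have i0: "0 < real i" using i by simp
  have r0: "0 < real r" using r by auto
  \<comment> \<open>The second exponent is chosen so that h^(2r) turns into h powr (2 (r/6 -
    \<epsilon>2)), the power of h that the third term also produces.\<close>
  have \<theta>: "1/8 - \<epsilon>1 \<in> {0..1}" "1/6 - \<epsilon>2 / real r \<in> {0..1}" "real r / 6 - \<epsilon>2 \<in> {0..1}"
    using \<epsilon> r by (auto simp: field_simps)
  have "e \<le> K / l ^ 4 * ((d\<^sup>2 * l ^ 8) powr (1/8 - \<epsilon>1) + (h ^ (2 * r) * l ^ 6) powr (1/6 - \<epsilon>2 / real r)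
      + (h\<^sup>2 * l\<^sup>2) powr (real r / 6 - \<epsilon>2))"
    using e K d h l0 \<theta> by (intro interpolate_min) (auto simp: l_def)
  then have "l\<^sup>2 * e \<le> l\<^sup>2 * (K / l ^ 4 * ((d\<^sup>2 * l ^ 8) powr (1/8 - \<epsilon>1) + (h ^ (2 * r) * l ^ 6) powr (1/6 - \<epsilon>2 / real r)
      + (h\<^sup>2 * l\<^sup>2) powr (real r / 6 - \<epsilon>2)))" by (intro mult_left_mono) auto
  also have "\<dots> = K * (l powr (- 2) * (d\<^sup>2 * l ^ 8) powr (1/8 - \<epsilon>1) + l powr (- 2) * (h ^ (2 * r) * l ^ 6) powr (1/6 - \<epsilon>2 / real r)
      + l powr (- 2) * (h\<^sup>2 * l\<^sup>2) powr (real r / 6 - \<epsilon>2))"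
  proof -
    have 1: "l powr (- 2) = 1 / l\<^sup>2" using l0 by (simp add: powr_minus inverse_eq_divide)
    have 2: "l ^ 4 = l\<^sup>2 * l\<^sup>2" by (simp flip: power_add)
    have 3: "s * (K / (s * s) * B) = K * (1 / s * B)" if "s \<noteq> 0" for s B using that by simp
    have "l\<^sup>2 * (K / l ^ 4 * B) = K * (l powr (- 2) * B)" for B unfolding 1 2 by (rule 3) (use l0 in simp)
    then show ?thesis by (simp only: distrib_left)
  qed
  also have "l powr (- 2) * (d\<^sup>2 * l ^ 8) powr (1/8 - \<epsilon>1) = d powr (2 * (1/8 - \<epsilon>1)) * l powr (- 1 - 8 * \<epsilon>1)"
    using d l0 by (simp add: powr_mult power_powr algebra_simps flip: powr_add)
  also have "l powr (- 2) * (h ^ (2 * r) * l ^ 6) powr (1/6 - \<epsilon>2 / real r)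
      = h powr (2 * (real r / 6 - \<epsilon>2)) * l powr (- 1 - 6 * \<epsilon>2 / real r)"
  proof -
    have "real (2 * r) * (1/6 - \<epsilon>2 / real r) = 2 * (real r / 6 - \<epsilon>2)" using r0 by (simp add: field_simps)
    moreover have "- 2 + real 6 * (1/6 - \<epsilon>2 / real r) = - 1 - 6 * \<epsilon>2 / real r" by (simp add: algebra_simps)
    ultimately show ?thesis
      using h l0 by (simp only: powr_mult power_powr zero_less_power mult.left_commute[of "l powr (- 2)"] flip: powr_add)
  qed
  also have "l powr (- 2) * (h\<^sup>2 * l\<^sup>2) powr (real r / 6 - \<epsilon>2)
      = h powr (2 * (real r / 6 - \<epsilon>2)) * l powr (- 2 + 2 * (real r / 6 - \<epsilon>2))"
    using h l0 by (simp add: powr_mult power_powr mult.left_commute flip: powr_add)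
  also have "K * (d powr (2 * (1/8 - \<epsilon>1)) * l powr (- 1 - 8 * \<epsilon>1)
      + h powr (2 * (real r / 6 - \<epsilon>2)) * l powr (- 1 - 6 * \<epsilon>2 / real r)
      + h powr (2 * (real r / 6 - \<epsilon>2)) * l powr (- 2 + 2 * (real r / 6 - \<epsilon>2)))
    \<le> K * (d powr (2 * (1/8 - \<epsilon>1)) * real i powr (- 1 - 8 * \<epsilon>1)
      + h powr (2 * (real r / 6 - \<epsilon>2)) * real i powr (- 1 - 6 * \<epsilon>2 / real r)
      + h powr (2 * (real r / 6 - \<epsilon>2)) * real i powr (- 1 - 2 * \<epsilon>2))"
  proof (intro mult_left_mono add_mono K)
    have anti: "l powr (- 1 - a) \<le> real i powr (- 1 - a)" if "0 < a" for a
      using that l i0 by (intro powr_mono2') auto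
    show "l powr (- 1 - 8 * \<epsilon>1) \<le> real i powr (- 1 - 8 * \<epsilon>1)" using \<epsilon> by (intro anti) auto
    show "l powr (- 1 - 6 * \<epsilon>2 / real r) \<le> real i powr (- 1 - 6 * \<epsilon>2 / real r)" using \<epsilon> r0 by (intro anti) auto
    \<comment> \<open>This uses r <= 3: then r/3 - 2 is at most -1.\<close>
    have "l powr (- 2 + 2 * (real r / 6 - \<epsilon>2)) \<le> l powr (- 1 - 2 * \<epsilon>2)"
      using r l by (intro powr_mono) auto
    also have "\<dots> \<le> real i powr (- 1 - 2 * \<epsilon>2)" using \<epsilon> by (intro anti) auto
    finally show "l powr (- 2 + 2 * (real r / 6 - \<epsilon>2)) \<le> real i powr (- 1 - 2 * \<epsilon>2)" .
  qed auto
  finally show ?thesis by (simp add: l_def)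
qed

lemma sqrt_error_bound:
  fixes \<epsilon>1 \<epsilon>2 d h K e :: real
  assumes "e \<le> 4 * K * (d powr (2 * a) / \<epsilon>1 + h powr (2 * b) / \<epsilon>2)" "0 \<le> K" "0 < \<epsilon>1" "0 < \<epsilon>2" "0 < d" "0 < h"
  shows "sqrt e \<le> sqrt (4 * K) * (\<epsilon>1 powr (- 1 / 2) * d powr a + \<epsilon>2 powr (- 1 / 2) * h powr b)"
proof -
  have sq: "sqrt (x powr (2 * c) / \<epsilon>) = \<epsilon> powr (- 1 / 2) * x powr c" if "0 < x" "0 < \<epsilon>" for x c \<epsilon> :: real
  proof -
    have "(\<epsilon> powr (- 1 / 2))\<^sup>2 = \<epsilon> powr (- 1)" by (simp add: power2_eq_square flip: powr_add)
    then have 1: "(\<epsilon> powr (- 1 / 2))\<^sup>2 = 1 / \<epsilon>" using that by (simp add: powr_neg_one)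
    have 2: "(x powr c)\<^sup>2 = x powr (2 * c)" by (simp add: power2_eq_square flip: powr_add)
    have "x powr (2 * c) / \<epsilon> = (\<epsilon> powr (- 1 / 2) * x powr c)\<^sup>2"
      unfolding power_mult_distrib 1 2 by simp
    then have "sqrt (x powr (2 * c) / \<epsilon>) = \<bar>\<epsilon> powr (- 1 / 2) * x powr c\<bar>" by (simp only: real_sqrt_abs)
    then show ?thesis by (simp only: abs_mult abs_of_nonneg powr_ge_zero)
  qed
  have "sqrt e \<le> sqrt (4 * K * (d powr (2 * a) / \<epsilon>1 + h powr (2 * b) / \<epsilon>2))"
    using assms(1) by (rule real_sqrt_le_mono)
  also have "\<dots> = sqrt (4 * K) * sqrt (d powr (2 * a) / \<epsilon>1 + h powr (2 * b) / \<epsilon>2)" by (rule real_sqrt_mult)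
  also have "\<dots> \<le> sqrt (4 * K) * (sqrt (d powr (2 * a) / \<epsilon>1) + sqrt (h powr (2 * b) / \<epsilon>2))"
    using assms by (intro mult_left_mono sqrt_add_le_add_sqrt) auto
  finally show ?thesis using assms sq by simp
qed

text \<open>Being uncorrelated removes the cross terms. Writing the square as a finite sum over
  pairs also yields integrability.\<close>

lemma expected_square_norm:
  assumes "finite A" and g: "\<And>p. p \<in> A \<Longrightarrow> g p \<in> L2 D"
    and int: "\<And>p p'. p \<in> A \<Longrightarrow> p' \<in> A \<Longrightarrow> integrable P (\<lambda>\<omega>. R p \<omega> * R p' \<omega>)"
    and cov: "\<And>p p'. p \<in> A \<Longrightarrow> p' \<in> A \<Longrightarrow> (\<integral>\<omega>. R p \<omega> * R p' \<omega> \<partial>P) = (if p = p' then v else (0 :: real))"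
  shows "integrable P (\<lambda>\<omega>. (L2_norm D (\<lambda>x. \<Sum>p\<in>A. R p \<omega> * g p x))\<^sup>2)"
    "(\<integral>\<omega>. (L2_norm D (\<lambda>x. \<Sum>p\<in>A. R p \<omega> * g p x))\<^sup>2 \<partial>P) = (\<Sum>p\<in>A. v * (L2_norm D (g p))\<^sup>2)"
proof -
  have eq: "(L2_norm D (\<lambda>x. \<Sum>p\<in>A. R p \<omega> * g p x))\<^sup>2
      = (\<Sum>p\<in>A. \<Sum>p'\<in>A. (R p \<omega> * R p' \<omega>) * L2_inner D (g p) (g p'))" for \<omega>
  proof -
    have s: "(\<lambda>x. \<Sum>p\<in>A. R p \<omega> * g p x) \<in> L2 D" by (intro L2_sum g)
    have "(L2_norm D (\<lambda>x. \<Sum>p\<in>A. R p \<omega> * g p x))\<^sup>2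
        = (\<Sum>p\<in>A. R p \<omega> * L2_inner D (g p) (\<lambda>x. \<Sum>p\<in>A. R p \<omega> * g p x))"
      unfolding L2_norm_square by (intro L2_inner_sum g s)
    also have "\<dots> = (\<Sum>p\<in>A. R p \<omega> * (\<Sum>p'\<in>A. R p' \<omega> * L2_inner D (g p) (g p')))"
      by (intro sum.cong refl arg_cong2[of _ _ _ _ "(*)"] L2_inner_sum_right g)
    finally show ?thesis by (simp add: sum_distrib_left mult.assoc)
  qed
  show "integrable P (\<lambda>\<omega>. (L2_norm D (\<lambda>x. \<Sum>p\<in>A. R p \<omega> * g p x))\<^sup>2)"
    unfolding eq by (intro Bochner_Integration.integrable_sum integrable_mult_left int)
  have "(\<integral>\<omega>. (L2_norm D (\<lambda>x. \<Sum>p\<in>A. R p \<omega> * g p x))\<^sup>2 \<partial>P)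
      = (\<Sum>p\<in>A. \<Sum>p'\<in>A. (\<integral>\<omega>. R p \<omega> * R p' \<omega> \<partial>P) * L2_inner D (g p) (g p'))"
    unfolding eq using int by (simp add: Bochner_Integration.integral_sum)
  also have "\<dots> = (\<Sum>p\<in>A. \<Sum>p'\<in>A. if p = p' then v * L2_inner D (g p) (g p') else 0)"
    using cov by (intro sum.cong refl) auto
  also have "\<dots> = (\<Sum>p\<in>A. v * (L2_norm D (g p))\<^sup>2)"
    using assms(1) by (simp add: L2_norm_square)
  finally show "(\<integral>\<omega>. (L2_norm D (\<lambda>x. \<Sum>p\<in>A. R p \<omega> * g p x))\<^sup>2 \<partial>P) = (\<Sum>p\<in>A. v * (L2_norm D (g p))\<^sup>2)" .
qed

text \<open>The constant c adds up those of the two mode bounds so that one constant serves the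
  interpolation. The errors e may depend on m and N; their bounds do not.\<close>

lemma mean_square_error:
  fixes U :: "nat \<Rightarrow> 'w \<Rightarrow> real \<Rightarrow> real"
  assumes P: "prob_space P" and T: "0 < T" and I: "white_noise P ({0..T} \<times> D) I"
    and fe: "fe_space r h S" and ap: "approximation_property r C h S" and r: "r = 2 \<or> r = 3" and C: "0 < C"
    and N: "1 \<le> N" and M: "1 \<le> M" and m: "m \<le> M"
    and U: "\<And>\<omega>. \<omega> \<in> space P \<Longrightarrow> imex_fem T \<mu> S (canvas_load I T N K \<omega>) M (\<lambda>m. U m \<omega>)"
  defines "err \<equiv> (\<lambda>\<omega>. (L2_norm D (\<lambda>x. U m \<omega> x - canvas_solution \<mu> (canvas_load I T N K \<omega>) (real m * (T / real M)) x))\<^sup>2)"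
    and "c \<equiv> 40 * exp (4 * \<mu>\<^sup>2 * T) + (2 * mode_const T \<mu> C + 4 * (1 + 2 * \<bar>\<mu>\<bar>)\<^sup>2 * exp (4 * \<mu>\<^sup>2 * T))"
  shows "integrable P err"
    "\<exists>e :: nat \<Rightarrow> real. (\<forall>i\<ge>1. e i \<le> c / lam i ^ 4 \<and>
        e i \<le> c / lam i ^ 4 * ((T / real M)\<^sup>2 * lam i ^ 8 + h ^ (2 * r) * lam i ^ 6 + h\<^sup>2 * (lam i)\<^sup>2))
      \<and> (\<integral>\<omega>. err \<omega> \<partial>P) = (\<Sum>i\<in>{1..K}. (lam i)\<^sup>2 * e i)"
proof -
  define dt where "dt = T / real N"
  have dt: "0 < dt" using T N by (simp add: dt_def)
  define tm where "tm = real m * (T / real M)"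
  have tm: "0 \<le> tm" using T by (simp add: tm_def)
  have h: "0 < h" using fe_space_mesh[OF fe] by simp
  have "\<exists>V. impulse_response (T / real M) \<mu> S (eps i) V" for i
    using impulse_response_exists[OF fe _ eps_sobolev(3)] T M by (metis divide_pos_pos of_nat_0_less_iff less_le_trans zero_less_one)
  then obtain V where V: "\<And>i. impulse_response (T / real M) \<mu> S (eps i) (V i)" by metis
  have "\<exists>Y. Y 0 = 0 \<and> (\<forall>s. (Y has_real_derivative exp (- ((lam i)\<^sup>2 * ((lam i)\<^sup>2 - \<mu>) * s))) (at s))" for i
  proof -
    have "isCont (\<lambda>s. exp (- ((lam i)\<^sup>2 * ((lam i)\<^sup>2 - \<mu>) * s))) s" for s by (intro continuous_intros)
    from antiderivative_exists[OF this] show ?thesis by metis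
  qed
  then obtain Y where Y: "\<And>i. Y i 0 = (0 :: real)"
    "\<And>i s. (Y i has_real_derivative exp (- ((lam i)\<^sup>2 * ((lam i)\<^sup>2 - \<mu>) * s))) (at s)" by metis
  define A where "A = {1..K} \<times> {1..N}"
  have A: "1 \<le> fst p" "snd p \<in> {1..N}" if "p \<in> A" for p using that by (auto simp: A_def)
  define R where "R p \<omega> = canvas_R I dt (fst p) (snd p) \<omega>" for p \<omega>
  define f where "f i n x = (\<Sum>k\<in>{1..m}. slab_overlap T M N k n * V i (m + 1 - k) x) - slab_amplitude T N (Y i) tm n * eps i x"
    for i n x
  define g where "g p x = (- lam (fst p) / dt) * f (fst p) (snd p) x" for p x
  have VL2: "V i k \<in> L2 D" for i k using V[of i] fe_space_L2[OF fe] by (simp add: impulse_response_def)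
  have fL2: "f i n \<in> L2 D" for i n
    unfolding f_def[abs_def] by (intro L2_diff L2_sum VL2 L2_cmult eps_sobolev)
  have gL2: "g p \<in> L2 D" for p unfolding g_def[abs_def] by (intro L2_cmult fL2)
  have err: "err \<omega> = (L2_norm D (\<lambda>x. \<Sum>p\<in>A. R p \<omega> * g p x))\<^sup>2" if \<omega>: "\<omega> \<in> space P" for \<omega>
  proof -
    define u where "u x = (\<Sum>p\<in>A. (R p \<omega> / dt * - lam (fst p) * slab_amplitude T N (Y (fst p)) tm (snd p)) * eps (fst p) x)" for x
    have u_eq: "canvas_solution \<mu> (canvas_load I T N K \<omega>) tm x = u x" for x
      unfolding canvas_solution_expansion[OF T N tm Y(2)] u_def R_def A_def dt_def by (simp only: mult.assoc)
    have uL2: "u \<in> L2 D" unfolding u_def[abs_def] by (intro L2_sum eps_sobolev)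
    have "U m \<omega> \<in> S"
    proof (cases "m = 0")
      case True
      then show ?thesis using U[OF \<omega>] fe_spaceD(3)[OF fe] by (simp add: imex_fem_def Let_def)
    next
      case False
      then have "m \<in> {1..M}" using m by auto
      then show ?thesis using U[OF \<omega>] by (simp add: imex_fem_def Let_def)
    qed
    then have UL2: "U m \<omega> \<in> L2 D" by (rule fe_space_L2[OF fe])
    have "AE x in lebesgue_on D. U m \<omega> x = (\<Sum>p\<in>A. (R p \<omega> / dt * - lam (fst p))
        * (\<Sum>k\<in>{1..m}. slab_overlap T M N k (snd p) * V (fst p) (m + 1 - k) x))"
      using imex_fem_expansion[OF fe T M U[OF \<omega>] V m] by (simp add: A_def R_def dt_def)
    then have "AE x in lebesgue_on D. U m \<omega> x - u x = (\<Sum>p\<in>A. R p \<omega> * g p x)"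
    proof eventually_elim
      case (elim x)
      have "(\<Sum>p\<in>A. R p \<omega> * g p x) = (\<Sum>p\<in>A. (R p \<omega> / dt * - lam (fst p))
        * (\<Sum>k\<in>{1..m}. slab_overlap T M N k (snd p) * V (fst p) (m + 1 - k) x)) - u x"
        unfolding u_def sum_subtractf[symmetric] g_def f_def
        by (intro sum.cong refl) (simp add: divide_inverse algebra_simps)
      then show ?case using elim by simp
    qed
    then have "L2_norm D (\<lambda>x. U m \<omega> x - u x) = L2_norm D (\<lambda>x. \<Sum>p\<in>A. R p \<omega> * g p x)"
      by (intro L2_norm_cong_AE L2_diff UL2 uL2 L2_sum gL2)
    then have "(L2_norm D (\<lambda>x. U m \<omega> x - canvas_solution \<mu> (canvas_load I T N K \<omega>) tm x))\<^sup>2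
        = (L2_norm D (\<lambda>x. \<Sum>p\<in>A. R p \<omega> * g p x))\<^sup>2" by (simp only: u_eq)
    then show ?thesis unfolding err_def tm_def .
  qed
  have cov: "integrable P (\<lambda>\<omega>. R p \<omega> * R p' \<omega>)" "(\<integral>\<omega>. R p \<omega> * R p' \<omega> \<partial>P) = (if p = p' then dt else 0)"
    if "p \<in> A" "p' \<in> A" for p p'
    using canvas_R_covariance[OF P I T N A(2)[OF that(1)] A(2)[OF that(2)] A(1)[OF that(1)] A(1)[OF that(2)]]
    by (auto simp: R_def dt_def prod_eq_iff)
  have "finite A" by (simp add: A_def)
  note esn = expected_square_norm[OF this gL2 cov]
  have "integrable P err \<longleftrightarrow> integrable P (\<lambda>\<omega>. (L2_norm D (\<lambda>x. \<Sum>p\<in>A. R p \<omega> * g p x))\<^sup>2)"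
    using err by (intro Bochner_Integration.integrable_cong) auto
  then show "integrable P err" using esn(1) by simp
  \<comment> \<open>The variance \<open>dt\<close> times the square of the factor 1 /
    \<open>dt\<close> in g leaves the division by \<open>dt\<close>; the factor \<open>lam\<close>
    is kept outside.\<close>
  define e where "e i = (\<Sum>n\<in>{1..N}. (L2_norm D (f i n))\<^sup>2 / dt)" for i
  have "(\<integral>\<omega>. err \<omega> \<partial>P) = (\<Sum>p\<in>A. dt * (L2_norm D (g p))\<^sup>2)"
    using err esn(2) by (simp cong: Bochner_Integration.integral_cong)
  also have "\<dots> = (\<Sum>p\<in>A. (lam (fst p))\<^sup>2 * ((L2_norm D (f (fst p) (snd p)))\<^sup>2 / dt))"
  proof (intro sum.cong refl)
    fix p
    have "L2_norm D (g p) = \<bar>- lam (fst p) / dt\<bar> * L2_norm D (f (fst p) (snd p))"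
      unfolding g_def[abs_def] by (rule L2_norm_cmult)
    then show "dt * (L2_norm D (g p))\<^sup>2 = (lam (fst p))\<^sup>2 * ((L2_norm D (f (fst p) (snd p)))\<^sup>2 / dt)"
      using dt by (simp add: power_mult_distrib power_divide power2_eq_square)
  qed
  also have "\<dots> = (\<Sum>i\<in>{1..K}. \<Sum>n\<in>{1..N}. (lam i)\<^sup>2 * ((L2_norm D (f i n))\<^sup>2 / dt))"
    by (simp add: A_def sum.cartesian_product case_prod_unfold)
  also have "\<dots> = (\<Sum>i\<in>{1..K}. (lam i)\<^sup>2 * e i)" by (simp add: e_def sum_distrib_left)
  finally have E: "(\<integral>\<omega>. err \<omega> \<partial>P) = (\<Sum>i\<in>{1..K}. (lam i)\<^sup>2 * e i)" .
  have "e i \<le> c / lam i ^ 4 \<and>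
        e i \<le> c / lam i ^ 4 * ((T / real M)\<^sup>2 * lam i ^ 8 + h ^ (2 * r) * lam i ^ 6 + h\<^sup>2 * (lam i)\<^sup>2)" if i: "1 \<le> i" for i
  proof -
    define X where "X = (T / real M)\<^sup>2 * lam i ^ 8 + h ^ (2 * r) * lam i ^ 6 + h\<^sup>2 * (lam i)\<^sup>2"
    have X: "0 \<le> X" using h lam_ge[OF i] by (auto simp: X_def)
    have l4: "0 < lam i ^ 4" using lam_ge[OF i] by simp
    have mc: "0 \<le> mode_const T \<mu> C" using T C by (simp add: mode_const_def)
    note me = mode_error_explicit[OF T i M N m Y(2) Y(1) fe ap r C V]
    have 1: "e i \<le> 40 * exp (4 * \<mu>\<^sup>2 * T) / lam i ^ 4" using me(1) by (simp add: e_def f_def[abs_def] dt_def tm_def)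
    have 2: "e i \<le> (2 * mode_const T \<mu> C + 4 * (1 + 2 * \<bar>\<mu>\<bar>)\<^sup>2 * exp (4 * \<mu>\<^sup>2 * T)) / lam i ^ 4 * X"
      using me(2) by (simp add: e_def f_def[abs_def] dt_def tm_def X_def)
    have "40 * exp (4 * \<mu>\<^sup>2 * T) / lam i ^ 4 \<le> c / lam i ^ 4"
      using l4 mc unfolding c_def by (intro divide_right_mono) auto
    moreover have "(2 * mode_const T \<mu> C + 4 * (1 + 2 * \<bar>\<mu>\<bar>)\<^sup>2 * exp (4 * \<mu>\<^sup>2 * T)) / lam i ^ 4 * X \<le> c / lam i ^ 4 * X"
      using l4 X unfolding c_def by (intro mult_right_mono divide_right_mono) auto
    ultimately show ?thesis using 1 2 by (simp add: X_def)
  qed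
  then show "\<exists>e :: nat \<Rightarrow> real. (\<forall>i\<ge>1. e i \<le> c / lam i ^ 4 \<and>
        e i \<le> c / lam i ^ 4 * ((T / real M)\<^sup>2 * lam i ^ 8 + h ^ (2 * r) * lam i ^ 6 + h\<^sup>2 * (lam i)\<^sup>2))
      \<and> (\<integral>\<omega>. err \<omega> \<partial>P) = (\<Sum>i\<in>{1..K}. (lam i)\<^sup>2 * e i)"
    using E by blast
qed

text \<open>The spaces form a family \<open>S\<close> over the mesh sizes in \<open>H\<close> with
  one common \<open>C\<close>, so that the resulting constant can be independent of h.\<close>

theorem theorem5p3:
  fixes P :: "'w measure"
    and I :: "(real \<times> real \<Rightarrow> real) \<Rightarrow> 'w \<Rightarrow> real"
    and T \<mu> C :: real
    and r :: nat
    and H :: "real set"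
    and S :: "real \<Rightarrow> (real \<Rightarrow> real) set"
  assumes "prob_space P" and "complete_measure P"
    and "T > 0"
    and "r = 2 \<or> r = 3"
    and "white_noise P ({0..T} \<times> D) I"
    and "C > 0"
    and "\<And>h. h \<in> H \<Longrightarrow> fe_space r h (S h) \<and> approximation_property r C h (S h)"
  shows "\<exists>c>0. \<forall>h\<in>H. \<forall>N\<ge>1. \<forall>K\<ge>1. \<forall>M\<ge>1. \<forall>U :: nat \<Rightarrow> 'w \<Rightarrow> real \<Rightarrow> real.
    (\<forall>\<omega>\<in>space P. imex_fem T \<mu> (S h) (canvas_load I T N K \<omega>) M (\<lambda>m. U m \<omega>)) \<longrightarrow>
    (let err = (\<lambda>m \<omega>. (L2_norm D (\<lambda>x. U m \<omega> x
                   - canvas_solution \<mu> (canvas_load I T N K \<omega>) (real m * (T / real M)) x))\<^sup>2)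
     in (\<forall>m\<le>M. integrable P (err m)) \<and>
        (\<forall>\<epsilon>1 \<epsilon>2. \<epsilon>1 \<in> {0<..1/8} \<longrightarrow> \<epsilon>2 \<in> {0<..real r / 6} \<longrightarrow>
          (MAX m\<in>{0..M}. sqrt (prob_space.expectation P (err m)))
          \<le> c * (\<epsilon>1 powr (-1/2) * (T / real M) powr (1/8 - \<epsilon>1)
                 + \<epsilon>2 powr (-1/2) * h powr (real r / 6 - \<epsilon>2))))"
proof -
  define c0 where "c0 = 40 * exp (4 * \<mu>\<^sup>2 * T) + (2 * mode_const T \<mu> C + 4 * (1 + 2 * \<bar>\<mu>\<bar>)\<^sup>2 * exp (4 * \<mu>\<^sup>2 * T))"
  have "0 \<le> mode_const T \<mu> C" using assms(3,6) by (simp add: mode_const_def)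
  then have c0: "0 < c0" unfolding c0_def by (intro add_pos_nonneg) auto
  show ?thesis
  proof (intro exI[of _ "sqrt (4 * c0)"] conjI ballI allI impI)
    show "0 < sqrt (4 * c0)" using c0 by simp
    fix h N K M and U :: "nat \<Rightarrow> 'w \<Rightarrow> real \<Rightarrow> real"
    assume h: "h \<in> H" and N: "1 \<le> N" and M: "1 \<le> M"
      and U: "\<forall>\<omega>\<in>space P. imex_fem T \<mu> (S h) (canvas_load I T N K \<omega>) M (\<lambda>m. U m \<omega>)"
    have fe: "fe_space r h (S h)" and ap: "approximation_property r C h (S h)" using assms(7)[OF h] by auto
    have h0: "0 < h" using fe_space_mesh[OF fe] by simp
    define d where "d = T / real M"
    have d: "0 < d" using assms(3) M by (simp add: d_def)
    define err where "err m \<omega> = (L2_norm D (\<lambda>x. U m \<omega> x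
                   - canvas_solution \<mu> (canvas_load I T N K \<omega>) (real m * (T / real M)) x))\<^sup>2" for m \<omega>
    have U': "\<And>\<omega>. \<omega> \<in> space P \<Longrightarrow> imex_fem T \<mu> (S h) (canvas_load I T N K \<omega>) M (\<lambda>m. U m \<omega>)" using U by blast
    note mse = mean_square_error[OF assms(1,3,5) fe ap assms(4,6) N M _ U', folded err_def c0_def d_def]
    have bound: "sqrt (\<integral>\<omega>. err m \<omega> \<partial>P) \<le> sqrt (4 * c0) * (\<epsilon>1 powr (-1/2) * d powr (1/8 - \<epsilon>1)
                 + \<epsilon>2 powr (-1/2) * h powr (real r / 6 - \<epsilon>2))"
      if m: "m \<le> M" and \<epsilon>: "\<epsilon>1 \<in> {0<..1/8}" "\<epsilon>2 \<in> {0<..real r / 6}" for m \<epsilon>1 \<epsilon>2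
    proof (rule sqrt_error_bound)
      have r0: "0 < real r" using assms(4) by auto
      obtain e :: "nat \<Rightarrow> real" where e: "\<And>i. 1 \<le> i \<Longrightarrow> e i \<le> c0 / lam i ^ 4"
        "\<And>i. 1 \<le> i \<Longrightarrow> e i \<le> c0 / lam i ^ 4 * (d\<^sup>2 * lam i ^ 8 + h ^ (2 * r) * lam i ^ 6 + h\<^sup>2 * (lam i)\<^sup>2)"
        "(\<integral>\<omega>. err m \<omega> \<partial>P) = (\<Sum>i\<in>{1..K}. (lam i)\<^sup>2 * e i)"
        using mse(2)[OF m] by blast
      define p1 where "p1 = d powr (2 * (1/8 - \<epsilon>1))"
      define p2 where "p2 = h powr (2 * (real r / 6 - \<epsilon>2))"
      have p: "0 \<le> p1" "0 \<le> p2" by (simp_all add: p1_def p2_def)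
      have "(\<integral>\<omega>. err m \<omega> \<partial>P) \<le> (\<Sum>i\<in>{1..K}. c0 * (p1 * real i powr (- 1 - 8 * \<epsilon>1)
          + p2 * real i powr (- 1 - 6 * \<epsilon>2 / real r) + p2 * real i powr (- 1 - 2 * \<epsilon>2)))"
        unfolding e(3) p1_def p2_def
        using c0 d h0 assms(4) e(1,2) \<epsilon> by (intro sum_mono mode_error_interpolated) auto
      also have "\<dots> = c0 * (p1 * (\<Sum>i\<in>{1..K}. real i powr (- 1 - 8 * \<epsilon>1))
          + p2 * (\<Sum>i\<in>{1..K}. real i powr (- 1 - 6 * \<epsilon>2 / real r)) + p2 * (\<Sum>i\<in>{1..K}. real i powr (- 1 - 2 * \<epsilon>2)))"
        by (simp only: sum_distrib_left[symmetric] sum.distrib)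
      \<comment> \<open>The exponents 8 \<epsilon>1, 6 \<epsilon>2 / r and 2 \<epsilon>2 are at most
        1 by the ranges of \<epsilon>1 and \<epsilon>2 and by r <= 3, as \<open>sum_powr_le\<close>
        demands.\<close>
      also have "\<dots> \<le> c0 * (p1 * (2 / (8 * \<epsilon>1)) + p2 * (2 / (6 * \<epsilon>2 / real r)) + p2 * (2 / (2 * \<epsilon>2)))"
        using c0 p \<epsilon> r0 assms(4)
        by (intro mult_left_mono add_mono sum_powr_le) (auto simp: field_simps)
      \<comment> \<open>The coefficients are 1/4 for the first term and r/3 + 1 <= 2 for the second;
        4 is a generous common bound.\<close>
      also have "\<dots> \<le> c0 * (4 * (p1 / \<epsilon>1) + 4 * (p2 / \<epsilon>2))"
      proof (intro mult_left_mono)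
        have "0 \<le> p1 / \<epsilon>1" "0 \<le> p2 / \<epsilon>2" using p \<epsilon> by auto
        moreover have "p1 * (2 / (8 * \<epsilon>1)) = (p1 / \<epsilon>1) / 4" "p2 * (2 / (2 * \<epsilon>2)) = p2 / \<epsilon>2"
          "p2 * (2 / (6 * \<epsilon>2 / real r)) = (p2 / \<epsilon>2) * (real r / 3)" by auto
        moreover have "(p2 / \<epsilon>2) * (real r / 3) \<le> (p2 / \<epsilon>2) * 1"
          using assms(4) \<open>0 \<le> p2 / \<epsilon>2\<close> by (intro mult_left_mono) auto
        ultimately show "p1 * (2 / (8 * \<epsilon>1)) + p2 * (2 / (6 * \<epsilon>2 / real r)) + p2 * (2 / (2 * \<epsilon>2)) \<le> 4 * (p1 / \<epsilon>1) + 4 * (p2 / \<epsilon>2)"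
          by argo
      qed (use c0 in simp)
      also have "\<dots> = 4 * c0 * (p1 / \<epsilon>1 + p2 / \<epsilon>2)" by (simp add: algebra_simps)
      finally show "(\<integral>\<omega>. err m \<omega> \<partial>P) \<le> 4 * c0 * (d powr (2 * (1/8 - \<epsilon>1)) / \<epsilon>1 + h powr (2 * (real r / 6 - \<epsilon>2)) / \<epsilon>2)"
        by (simp add: p1_def p2_def)
    qed (use c0 \<epsilon> d h0 in auto)
    have int: "integrable P (err m)" if "m \<le> M" for m
      using mse(1)[OF that] by (simp add: err_def[abs_def])
    have max: "(MAX m\<in>{0..M}. sqrt (\<integral>\<omega>. err m \<omega> \<partial>P)) \<le> sqrt (4 * c0) * (\<epsilon>1 powr (-1/2) * d powr (1/8 - \<epsilon>1)
                 + \<epsilon>2 powr (-1/2) * h powr (real r / 6 - \<epsilon>2))"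
      if \<epsilon>: "\<epsilon>1 \<in> {0<..1/8}" "\<epsilon>2 \<in> {0<..real r / 6}" for \<epsilon>1 \<epsilon>2
    proof (rule Max.boundedI)
      fix a assume "a \<in> (\<lambda>m. sqrt (\<integral>\<omega>. err m \<omega> \<partial>P)) ` {0..M}"
      then obtain m where "m \<le> M" "a = sqrt (\<integral>\<omega>. err m \<omega> \<partial>P)" by auto
      then show "a \<le> sqrt (4 * c0) * (\<epsilon>1 powr (-1/2) * d powr (1/8 - \<epsilon>1)
                 + \<epsilon>2 powr (-1/2) * h powr (real r / 6 - \<epsilon>2))" using bound \<epsilon> by blast
    qed auto
    have err: "(\<lambda>m \<omega>. (L2_norm D (\<lambda>x. U m \<omega> x
        - canvas_solution \<mu> (canvas_load I T N K \<omega>) (real m * (T / real M)) x))\<^sup>2) = err"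
      by (simp add: err_def fun_eq_iff)
    show "let err = (\<lambda>m \<omega>. (L2_norm D (\<lambda>x. U m \<omega> x
                   - canvas_solution \<mu> (canvas_load I T N K \<omega>) (real m * (T / real M)) x))\<^sup>2)
     in (\<forall>m\<le>M. integrable P (err m)) \<and>
        (\<forall>\<epsilon>1 \<epsilon>2. \<epsilon>1 \<in> {0<..1/8} \<longrightarrow> \<epsilon>2 \<in> {0<..real r / 6} \<longrightarrow>
          (MAX m\<in>{0..M}. sqrt (prob_space.expectation P (err m)))
          \<le> sqrt (4 * c0) * (\<epsilon>1 powr (-1/2) * (T / real M) powr (1/8 - \<epsilon>1)
                 + \<epsilon>2 powr (-1/2) * h powr (real r / 6 - \<epsilon>2)))"
      unfolding err Let_def by (intro conjI allI impI int max[unfolded d_def])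
  qed
qed

end
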